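(* Let $\mathcal{L}=\mathfrak{sl}_2\ltimes\mathcal{GN}(1,1)$, where $\mathcal{GN}(1,1)$ is taken with $n=5$. Then $\dim H^2(\mathcal{L},\mathcal{L})=2$.
   Context: All Lie algebras are finite-dimensional over $\mathbb{C}$. $H^2(\mathcal{L},\mathcal{L})$ is the second Chevalley–Eilenberg cohomology of $\mathcal{L}$ with coefficients in the adjoint module. **The algebra $\mathcal{GN}(1,1)$ for $n=5$** (superscripts are indices). It has basis $x_1,x_2,y_1,y_2$; $c,z_1,z_2,z_3$; and, for $3\le k\le 5$, $x^k_1,\dots,x^k_{k+1},y^k_1,\dots,y^k_{k+1}$. Its only nonzero brackets of basis elements, up to skew-symmetry, are: - $[x_1,x_2]=c$, $[y_1,y_2]=c$, $[x_1,y_1]=z_1$, $[x_1,y_2]=[x_2,y_1]=z_2$, $[x_2,y_2]=z_3$; - $[x_1,z_i]=x_i^3$, $[x_2,z_i]=x_{i+1}^3$, $[y_1,z_i]=y_i^3$, $[y_2,z_i]=y_{i+1}^3$ for $1\le i\le3$; - $[x_1,x_i^3]=x_i^4$, $[x_2,x_i^3]=x_{i+1}^4$, $[y_1,y_i^3]=y_i^4$, $[y_2,y_i^3]=y_{i+1}^4$ for $1\le i\le4$; - $[x_1,x_i^4]=x_i^5$, $[x_2,x_i^4]=x_{i+1}^5$, $[y_1,x_i^4]=y_i^5$, $[y_2,x_i^4]=y_{i+1}^5$ for $1\le i\le 5$; - $[z_j,x_i^3]=-y^5_{i+j-1}$ for $1\le i\le4$, $1\le j\le3$; - $[x_j,y_i^5]=(i-1-5(j-1))\,y^4_{i+j-2}$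 and $[y_j,x_i^5]=-(i-1-5(j-1))\,y^4_{i+j-2}$ for $1\le i\le6$, $1\le j\le2$; - $[z_j,x_i^4]=\big(2(i-1)-4(j-1)\big)y^4_{i+j-2}$ for $1\le i\le5$, $1\le j\le3$; - $[x_j^3,x_i^3]=-3(i-j)\,y^4_{i+j-2}$ for $1\le i,j\le4$. (Terms with out-of-range index have coefficient zero.) **Action of $\mathfrak{sl}_2$.** With basis $e,f,h$ ($[e,f]=h$, $[h,e]=2e$, $[h,f]=-2f$), $\mathfrak{sl}_2$ acts by $[h,v_i^k]=(k+2-2i)v_i^k$, $[e,v_i^k]=(i-1)v_{i-1}^k$, $[f,v_i^k]=(k+1-i)v_{i+1}^k$ for $v\in\{x,y\}$, $k\in\{1,3,4,5\}$, $1\le i\le k+1$ (with $x_i^1=x_i$, $y_i^1=y_i$); $[h,z_i]=(4-2i)z_i$, $[e,z_i]=(i-1)z_{i-1}$, $[f,z_i]=(3-i)z_{i+1}$; $[\mathfrak{sl}_2,c]=0$. *)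

theory Defs
  imports "HOL-Analysis.Analysis"
begin

section \<open>Complex Lie algebras and the cohomology space \<open>H\<^sup>2(L, L)\<close>\<close>

class complex_lie_algebra = ab_group_add +
  fixes scaleC :: "complex \<Rightarrow> 'a \<Rightarrow> 'a"
    and lie :: "'a \<Rightarrow> 'a \<Rightarrow> 'a"
  assumes scaleC_add_right: "scaleC c (x + y) = scaleC c x + scaleC c y"
    and scaleC_add_left: "scaleC (c + d) x = scaleC c x + scaleC d x"
    and scaleC_scaleC: "scaleC c (scaleC d x) = scaleC (c * d) x"
    and scaleC_one: "scaleC 1 x = x"
    and lie_add_left: "lie (x + y) z = lie x z + lie y z"
    and lie_add_right: "lie x (y + z) = lie x y + lie x z"
    and lie_scaleC_left: "lie (scaleC c x) y = scaleC c (lie x y)"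
    and lie_scaleC_right: "lie x (scaleC c y) = scaleC c (lie x y)"
    and lie_self: "lie x x = 0"
    and jacobi: "lie x (lie y z) + lie y (lie z x) + lie z (lie x y) = 0"

interpretation scaleC: vector_space "scaleC :: complex \<Rightarrow> 'a \<Rightarrow> 'a::complex_lie_algebra"
  by standard (simp_all add: scaleC_add_right scaleC_add_left scaleC_scaleC scaleC_one)

definition cochains1 :: "('a::complex_lie_algebra \<Rightarrow> 'a) set" where
  "cochains1 = {g. Vector_Spaces.linear scaleC scaleC g}"

definition cochains2 :: "('a::complex_lie_algebra \<Rightarrow> 'a \<Rightarrow> 'a) set" where
  "cochains2 = {f. (\<forall>x. Vector_Spaces.linear scaleC scaleC (\<lambda>y. f x y)) \<and>
                   (\<forall>y. Vector_Spaces.linear scaleC scaleC (\<lambda>x. f x y)) \<and>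
                   (\<forall>x. f x x = 0)}"

text \<open>The Chevalley--Eilenberg differentials in degrees 1 and 2, for the adjoint module.\<close>

definition diff1 :: "('a::complex_lie_algebra \<Rightarrow> 'a) \<Rightarrow> 'a \<Rightarrow> 'a \<Rightarrow> 'a" where
  "diff1 g x y = lie x (g y) - lie y (g x) - g (lie x y)"

definition diff2 :: "('a::complex_lie_algebra \<Rightarrow> 'a \<Rightarrow> 'a) \<Rightarrow> 'a \<Rightarrow> 'a \<Rightarrow> 'a \<Rightarrow> 'a" where
  "diff2 f x y z = lie x (f y z) - lie y (f x z) + lie z (f x y)
     - f (lie x y) z + f (lie x z) y - f (lie y z) x"

definition cocycles2 :: "('a::complex_lie_algebra \<Rightarrow> 'a \<Rightarrow> 'a) set" where
  "cocycles2 = {f \<in> cochains2. \<forall>x y z. diff2 f x y z = 0}"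

definition coboundaries2 :: "('a::complex_lie_algebra \<Rightarrow> 'a \<Rightarrow> 'a) set" where
  "coboundaries2 = diff1 ` cochains1"

lemma linear_scaleC_iff:
  "Vector_Spaces.linear scaleC scaleC (f :: 'a::complex_lie_algebra \<Rightarrow> 'a) \<longleftrightarrow>
     (\<forall>x y. f (x + y) = f x + f y) \<and> (\<forall>c x. f (scaleC c x) = scaleC c (f x))"
  unfolding Vector_Spaces.linear_iff
  using scaleC.vector_space_axioms by blast

lemmas lie_algebra_simps = lie_add_left lie_add_right lie_scaleC_left lie_scaleC_right
  scaleC.scale_right_distrib scaleC.scale_right_diff_distrib

lemma lie_zero_left [simp]: "lie 0 (x :: 'a::complex_lie_algebra) = 0"
  using lie_add_left[of 0 0 x] by simp

lemma lie_zero_right [simp]: "lie (x :: 'a::complex_lie_algebra) 0 = 0"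
  using lie_add_right[of x 0 0] by simp

lemma cocycles2_zero: "(\<lambda>x y. 0) \<in> cocycles2"
  by (simp add: cocycles2_def cochains2_def diff2_def linear_scaleC_iff)

lemma cocycles2_add:
  assumes "f \<in> cocycles2" "g \<in> cocycles2"
  shows "(\<lambda>x y. f x y + g x y) \<in> cocycles2"
proof -
  have "diff2 (\<lambda>x y. f x y + g x y) x y z = diff2 f x y z + diff2 g x y z" for x y z
    by (simp add: diff2_def lie_algebra_simps)
  then show ?thesis
    using assms by (simp add: cocycles2_def cochains2_def linear_scaleC_iff lie_algebra_simps)
qed

lemma cocycles2_scaleC:
  assumes "f \<in> cocycles2"
  shows "(\<lambda>x y. scaleC c (f x y)) \<in> cocycles2"
proof -
  have "diff2 (\<lambda>x y. scaleC c (f x y)) x y z = scaleC c (diff2 f x y z)" for x y z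
    by (simp add: diff2_def lie_algebra_simps)
  then show ?thesis
    using assms
    by (simp add: cocycles2_def cochains2_def linear_scaleC_iff lie_algebra_simps scaleC.scale_left_commute)
qed

lemma coboundaries2I: "f = diff1 g \<Longrightarrow> g \<in> cochains1 \<Longrightarrow> f \<in> coboundaries2"
  by (simp add: coboundaries2_def)

lemma coboundaries2_zero: "(\<lambda>(x :: 'a::complex_lie_algebra) y. 0) \<in> coboundaries2"
proof -
  have "(\<lambda>x y. 0) = diff1 (\<lambda>x :: 'a. 0 :: 'a)"
    by (simp add: diff1_def fun_eq_iff)
  then show ?thesis
    by (rule coboundaries2I) (simp add: cochains1_def linear_scaleC_iff)
qed

lemma coboundaries2_add:
  assumes "f \<in> coboundaries2" "g \<in> coboundaries2"
  shows "(\<lambda>x y. f x y + g x y) \<in> coboundaries2"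
proof -
  obtain p q where pq: "p \<in> cochains1" "q \<in> cochains1" "f = diff1 p" "g = diff1 q"
    using assms by (auto simp: coboundaries2_def)
  have "(\<lambda>x y. f x y + g x y) = diff1 (\<lambda>x. p x + q x)"
    by (simp add: diff1_def fun_eq_iff lie_algebra_simps pq)
  then show ?thesis
    by (rule coboundaries2I)
      (use pq in \<open>simp add: cochains1_def linear_scaleC_iff lie_algebra_simps\<close>)
qed

lemma coboundaries2_scaleC:
  assumes "f \<in> coboundaries2"
  shows "(\<lambda>x y. scaleC c (f x y)) \<in> coboundaries2"
proof -
  obtain p where p: "p \<in> cochains1" "f = diff1 p"
    using assms by (auto simp: coboundaries2_def)
  have "(\<lambda>x y. scaleC c (f x y)) = diff1 (\<lambda>x. scaleC c (p x))"
    by (simp add: diff1_def fun_eq_iff lie_algebra_simps p)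
  then show ?thesis
    by (rule coboundaries2I)
      (use p in \<open>simp add: cochains1_def linear_scaleC_iff lie_algebra_simps scaleC.scale_left_commute\<close>)
qed

definition cohomologous2 ::
    "('a::complex_lie_algebra \<Rightarrow> 'a \<Rightarrow> 'a) \<Rightarrow> ('a \<Rightarrow> 'a \<Rightarrow> 'a) \<Rightarrow> bool" where
  "cohomologous2 f g \<longleftrightarrow>
     f \<in> cocycles2 \<and> g \<in> cocycles2 \<and> (\<lambda>x y. f x y - g x y) \<in> coboundaries2"

lemma part_equivp_cohomologous2: "part_equivp cohomologous2"
proof (rule part_equivpI)
  show "\<exists>f. cohomologous2 f f"
    using cocycles2_zero coboundaries2_zero by (auto simp: cohomologous2_def)
  show "symp (cohomologous2 :: ('a \<Rightarrow> 'a \<Rightarrow> 'a) \<Rightarrow> _)"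
    using coboundaries2_scaleC[where c = "-1"]
    by (force intro!: sympI simp: cohomologous2_def)
  show "transp (cohomologous2 :: ('a \<Rightarrow> 'a \<Rightarrow> 'a) \<Rightarrow> _)"
    using coboundaries2_add by (fastforce intro!: transpI simp: cohomologous2_def)
qed

text \<open>The quotient of the 2-cocycles by the 2-coboundaries.  The relation is partial: its domain is
  the set of cocycles.\<close>

quotient_type (overloaded) 'a H2 = "'a::complex_lie_algebra \<Rightarrow> 'a \<Rightarrow> 'a" / partial: cohomologous2
  by (rule part_equivp_cohomologous2)

instantiation H2 :: (complex_lie_algebra) ab_group_add
begin

lift_definition zero_H2 :: "'a H2" is "\<lambda>x y. 0"
  using cocycles2_zero coboundaries2_zero by (simp add: cohomologous2_def)

lift_definition plus_H2 :: "'a H2 \<Rightarrow> 'a H2 \<Rightarrow> 'a H2" is "\<lambda>f g x y. f x y + g x y"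
  using cocycles2_add coboundaries2_add by (fastforce simp: cohomologous2_def algebra_simps)

lift_definition uminus_H2 :: "'a H2 \<Rightarrow> 'a H2" is "\<lambda>f x y. - f x y"
  using cocycles2_scaleC[where c = "-1"] coboundaries2_scaleC[where c = "-1"]
  by (force simp: cohomologous2_def)

definition minus_H2 :: "'a H2 \<Rightarrow> 'a H2 \<Rightarrow> 'a H2" where
  "minus_H2 a b = a + (- b)"

instance
proof
  fix a b c :: "'a H2"
  show "a + b + c = a + (b + c)"
    by transfer (use cocycles2_add coboundaries2_zero in \<open>auto simp: cohomologous2_def add.assoc\<close>)
  show "a + b = b + a"
    by transfer (use cocycles2_add coboundaries2_zero in \<open>auto simp: cohomologous2_def\<close>)
  show "0 + a = a"
    by transfer (use coboundaries2_zero in \<open>auto simp: cohomologous2_def\<close>)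
  show "- a + a = 0"
    by transfer (use cocycles2_zero coboundaries2_zero in \<open>auto simp: cohomologous2_def\<close>)
  show "a - b = a + - b"
    by (rule minus_H2_def)
qed

end

lift_definition scaleC_H2 :: "complex \<Rightarrow> 'a::complex_lie_algebra H2 \<Rightarrow> 'a H2"
  is "\<lambda>c f x y. scaleC c (f x y)"
  using cocycles2_scaleC coboundaries2_scaleC
  by (fastforce simp: cohomologous2_def simp flip: scaleC.scale_right_diff_distrib)

interpretation H2: vector_space "scaleC_H2 :: complex \<Rightarrow> 'a::complex_lie_algebra H2 \<Rightarrow> 'a H2"
proof
  fix a b :: complex and f g :: "'a H2"
  show "scaleC_H2 a (f + g) = scaleC_H2 a f + scaleC_H2 a g"
    by transfer (use cocycles2_add cocycles2_scaleC coboundaries2_zero in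
        \<open>auto simp: cohomologous2_def lie_algebra_simps\<close>)
  show "scaleC_H2 (a + b) f = scaleC_H2 a f + scaleC_H2 b f"
    by transfer (use cocycles2_add cocycles2_scaleC coboundaries2_zero in
        \<open>auto simp: cohomologous2_def scaleC_add_left\<close>)
  show "scaleC_H2 a (scaleC_H2 b f) = scaleC_H2 (a * b) f"
    by transfer (use cocycles2_scaleC coboundaries2_zero in
        \<open>auto simp: cohomologous2_def scaleC_scaleC\<close>)
  show "scaleC_H2 1 f = f"
    by transfer (use coboundaries2_zero in \<open>auto simp: cohomologous2_def\<close>)
qed


section \<open>The Lie algebra \<open>\<ss>\<ll>\<^sub>2 \<ltimes> GN(1,1)\<close> for \<open>n = 5\<close>\<close>

text \<open>Every bracket of two basis elements below is a multiple \<open>c \<cdot> l\<close> of a basis element, tabulated as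
  the pair \<open>(c, l)\<close> of a coefficient and a label; 0 is tabulated with coefficient 0 and an arbitrary
  label.  The map \<open>f\<close> sends the coordinate indices to their labels; a label outside its range
  denotes the vector 0.\<close>

definition term_vec :: "('i::finite \<Rightarrow> 'l) \<Rightarrow> int \<times> 'l \<Rightarrow> complex^'i" where
  "term_vec f p = (\<chi> a. if f a = snd p then of_int (fst p) else 0)"

definition bilinear_ext ::
    "('i::finite \<Rightarrow> 'j::finite \<Rightarrow> complex^'k) \<Rightarrow> complex^'i \<Rightarrow> complex^'j \<Rightarrow> complex^'k" where
  "bilinear_ext t v w = (\<Sum>i\<in>UNIV. \<Sum>j\<in>UNIV. (v $ i * w $ j) *s t i j)"

text \<open>The tables list each nonzero bracket in one of its two orders; \<open>skew\<close> supplies the other.\<close>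

definition skew :: "('i \<Rightarrow> 'i \<Rightarrow> 'v::ab_group_add) \<Rightarrow> 'i \<Rightarrow> 'i \<Rightarrow> 'v" where
  "skew t a b = t a b - t b a"

datatype sl2_index = E | F | H

lemma UNIV_sl2_index: "UNIV = {E, F, H}"
  using sl2_index.exhaust by auto

instance sl2_index :: finite
  by standard (simp add: UNIV_sl2_index)

fun sl2_table :: "sl2_index \<Rightarrow> sl2_index \<Rightarrow> int \<times> sl2_index" where
  "sl2_table E F = (1, H)"
| "sl2_table H E = (2, E)"
| "sl2_table H F = (- 2, F)"
| "sl2_table _ _ = (0, H)"

definition sl2_bracket :: "complex^sl2_index \<Rightarrow> complex^sl2_index \<Rightarrow> complex^sl2_index" where
  "sl2_bracket = bilinear_ext (skew (\<lambda>a b. term_vec id (sl2_table a b)))"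

text \<open>\<open>X k i\<close> and \<open>Y k i\<close> stand for \<open>x\<^sup>k\<^sub>i\<close> and \<open>y\<^sup>k\<^sub>i\<close>, with \<open>x\<^sub>i = x\<^sup>1\<^sub>i\<close> and \<open>y\<^sub>i = y\<^sup>1\<^sub>i\<close>.\<close>

datatype gn_label = C | Z int | X int int | Y int int

definition gn_labels :: "gn_label set" where
  "gn_labels = {C} \<union> Z ` {1..3} \<union> (\<Union>k\<in>{1, 3, 4, 5}. X k ` {1..k + 1} \<union> Y k ` {1..k + 1})"

typedef gn_index = gn_labels
  morphisms label_of gn_index_of
  by (auto simp: gn_labels_def)

instance gn_index :: finite
proof
  have "finite gn_labels"
    by (simp add: gn_labels_def)
  then show "finite (UNIV :: gn_index set)"
    by (metis type_definition.univ[OF type_definition_gn_index] finite_imageI)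
qed

text \<open>Equations such as \<open>[x\<^sub>1, z\<^sub>i] = x\<^sup>3\<^sub>i\<close> and \<open>[x\<^sub>2, z\<^sub>i] = x\<^sup>3\<^bsub>i+1\<^esub>\<close> are combined into
  \<open>[x\<^sub>j, z\<^sub>i] = x\<^sup>3\<^bsub>i+j-1\<^esub>\<close>.  Only entries at labels in \<^term>\<open>gn_labels\<close> are used.\<close>

fun gn_table :: "gn_label \<Rightarrow> gn_label \<Rightarrow> int \<times> gn_label" where
  "gn_table (X k j) (X m i) =
     (if k = 1 \<and> j = 1 \<and> m = 1 \<and> i = 2 then (1, C)
      else if k = 1 \<and> m = 3 then (1, X 4 (i + j - 1))
      else if k = 1 \<and> m = 4 then (1, X 5 (i + j - 1))
      else if k = 3 \<and> m = 3 \<and> j < i then (- 3 * (i - j), Y 4 (i + j - 2))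
      else (0, C))"
| "gn_table (Y k j) (Y m i) =
     (if k = 1 \<and> j = 1 \<and> m = 1 \<and> i = 2 then (1, C)
      else if k = 1 \<and> m = 3 then (1, Y 4 (i + j - 1))
      else (0, C))"
| "gn_table (X k j) (Y m i) =
     (if k = 1 \<and> m = 1 then (1, Z (i + j - 1))
      else if k = 1 \<and> m = 5 then (i - 1 - 5 * (j - 1), Y 4 (i + j - 2))
      else (0, C))"
| "gn_table (Y k j) (X m i) =
     (if k = 1 \<and> m = 4 then (1, Y 5 (i + j - 1))
      else if k = 1 \<and> m = 5 then (- (i - 1 - 5 * (j - 1)), Y 4 (i + j - 2))
      else (0, C))"
| "gn_table (X k j) (Z i) = (if k = 1 then (1, X 3 (i + j - 1)) else (0, C))"
| "gn_table (Y k j) (Z i) = (if k = 1 then (1, Y 3 (i + j - 1)) else (0, C))"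
| "gn_table (Z j) (X k i) =
     (if k = 3 then (- 1, Y 5 (i + j - 1))
      else if k = 4 then (2 * (i - 1) - 4 * (j - 1), Y 4 (i + j - 2))
      else (0, C))"
| "gn_table _ _ = (0, C)"

definition gn_bracket :: "complex^gn_index \<Rightarrow> complex^gn_index \<Rightarrow> complex^gn_index" where
  "gn_bracket =
     bilinear_ext (skew (\<lambda>a b. term_vec label_of (gn_table (label_of a) (label_of b))))"

fun sl2_gn_table :: "sl2_index \<Rightarrow> gn_label \<Rightarrow> int \<times> gn_label" where
  "sl2_gn_table H (X k i) = (k + 2 - 2 * i, X k i)"
| "sl2_gn_table E (X k i) = (i - 1, X k (i - 1))"
| "sl2_gn_table F (X k i) = (k + 1 - i, X k (i + 1))"
| "sl2_gn_table H (Y k i) = (k + 2 - 2 * i, Y k i)"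
| "sl2_gn_table E (Y k i) = (i - 1, Y k (i - 1))"
| "sl2_gn_table F (Y k i) = (k + 1 - i, Y k (i + 1))"
| "sl2_gn_table H (Z i) = (4 - 2 * i, Z i)"
| "sl2_gn_table E (Z i) = (i - 1, Z (i - 1))"
| "sl2_gn_table F (Z i) = (3 - i, Z (i + 1))"
| "sl2_gn_table _ C = (0, C)"

definition sl2_gn_action :: "complex^sl2_index \<Rightarrow> complex^gn_index \<Rightarrow> complex^gn_index" where
  "sl2_gn_action = bilinear_ext (\<lambda>s a. term_vec label_of (sl2_gn_table s (label_of a)))"

definition semidirect_bracket ::
    "('s \<Rightarrow> 's \<Rightarrow> 's) \<Rightarrow> ('n \<Rightarrow> 'n \<Rightarrow> 'n::ab_group_add) \<Rightarrow> ('s \<Rightarrow> 'n \<Rightarrow> 'n) \<Rightarrow> 's \<times> 'n \<Rightarrow> 's \<times> 'n \<Rightarrow> 's \<times> 'n"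
  where
  "semidirect_bracket sbr nbr act p q =
     (sbr (fst p) (fst q), nbr (snd p) (snd q) + act (fst p) (snd q) - act (fst q) (snd p))"

typedef sl2_gn = "UNIV :: ((complex^sl2_index) \<times> (complex^gn_index)) set"
  by simp

setup_lifting type_definition_sl2_gn

instantiation sl2_gn :: ab_group_add
begin

lift_definition zero_sl2_gn :: sl2_gn is 0 .
lift_definition plus_sl2_gn :: "sl2_gn \<Rightarrow> sl2_gn \<Rightarrow> sl2_gn" is "(+)" .
lift_definition uminus_sl2_gn :: "sl2_gn \<Rightarrow> sl2_gn" is uminus .
lift_definition minus_sl2_gn :: "sl2_gn \<Rightarrow> sl2_gn \<Rightarrow> sl2_gn" is "(-)" .

instance
  by standard (transfer; simp add: algebra_simps)+

end

subsection \<open>The Lie algebra axioms\<close>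

lemma bilinear_ext_add_left:
  "bilinear_ext t (u + v) w = bilinear_ext t u w + bilinear_ext t v w"
  by (simp add: bilinear_ext_def distrib_right vec.scale_left_distrib sum.distrib)

lemma bilinear_ext_add_right:
  "bilinear_ext t u (v + w) = bilinear_ext t u v + bilinear_ext t u w"
  by (simp add: bilinear_ext_def distrib_left vec.scale_left_distrib sum.distrib)

lemma bilinear_ext_scale_left: "bilinear_ext t (c *s v) w = c *s bilinear_ext t v w"
  by (simp add: bilinear_ext_def vec.scale_sum_right mult.assoc)

lemma bilinear_ext_scale_right: "bilinear_ext t v (c *s w) = c *s bilinear_ext t v w"
  by (simp add: bilinear_ext_def vec.scale_sum_right mult.assoc mult.left_commute)

lemma bilinear_ext_minus_left: "bilinear_ext t (- v) w = - bilinear_ext t v w"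
  using bilinear_ext_scale_left[of t "-1" v w] by simp

lemma bilinear_ext_minus_right: "bilinear_ext t v (- w) = - bilinear_ext t v w"
  using bilinear_ext_scale_right[of t v "-1" w] by simp

lemma bilinear_ext_diff_left:
  "bilinear_ext t (u - v) w = bilinear_ext t u w - bilinear_ext t v w"
  using bilinear_ext_add_left[of t u "- v" w] by (simp add: bilinear_ext_minus_left)

lemma bilinear_ext_diff_right:
  "bilinear_ext t u (v - w) = bilinear_ext t u v - bilinear_ext t u w"
  using bilinear_ext_add_right[of t u v "- w"] by (simp add: bilinear_ext_minus_right)

lemmas bilinear_ext_simps =
  bilinear_ext_add_left bilinear_ext_add_right bilinear_ext_scale_left bilinear_ext_scale_right
  bilinear_ext_diff_left bilinear_ext_diff_right bilinear_ext_minus_left bilinear_ext_minus_right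

lemma bilinear_ext_skew: "bilinear_ext (skew t) v w = bilinear_ext t v w - bilinear_ext t w v"
proof -
  have "bilinear_ext t w v = (\<Sum>i\<in>UNIV. \<Sum>j\<in>UNIV. (v $ i * w $ j) *s t j i)"
    unfolding bilinear_ext_def by (subst sum.swap) (simp add: mult.commute)
  then show ?thesis
    by (simp add: bilinear_ext_def skew_def vec.scale_right_diff_distrib sum_subtractf)
qed

lemma bilinear_ext_axis: "bilinear_ext t (axis i 1) (axis j 1) = t i j"
proof -
  have "(\<Sum>b\<in>UNIV. (axis i 1 $ a * axis j 1 $ b) *s t a b) = (if a = i then t i j else 0)" for a
    by (simp add: axis_def if_distrib[of "\<lambda>c. c *s _"] cong: if_cong)
  then show ?thesis
    by (simp add: bilinear_ext_def)
qed

lemma linear_zero_ext: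
  fixes g :: "complex^'i::finite \<Rightarrow> complex^'k"
  assumes "\<And>x y. g (x + y) = g x + g y" "\<And>c x. g (c *s x) = c *s g x" "\<And>i. g (axis i 1) = 0"
  shows "g v = 0"
proof -
  have 0: "g 0 = 0"
    using assms(1)[of 0 0] by simp
  have "g (\<Sum>i\<in>S. v $ i *s axis i 1) = 0" if "finite S" for S
    using that by induction (simp_all add: 0 assms)
  from this[OF finite[of UNIV]] show ?thesis
    by (simp add: basis_expansion)
qed

lemma term_vec_axis: "inj f \<Longrightarrow> term_vec f (c, f i) = of_int c *s axis i 1"
  by (auto simp: term_vec_def vec_eq_iff axis_def dest: injD)

lemma term_vec_zero: "fst p = 0 \<Longrightarrow> term_vec f p = 0"
  by (simp add: term_vec_def vec_eq_iff)

lemma term_vec_minus: "- term_vec f p = term_vec f (- fst p, snd p)"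
  by (simp add: term_vec_def vec_eq_iff)

definition apply_term :: "('l \<Rightarrow> int \<times> 'm) \<Rightarrow> int \<times> 'l \<Rightarrow> int \<times> 'm" where
  "apply_term g p = (fst p * fst (g (snd p)), snd (g (snd p)))"

lemma bilinear_ext_term_left:
  assumes "inj f" "\<And>i. t i j = term_vec h (T (f i))" "fst p = 0 \<or> snd p \<in> range f"
  shows "bilinear_ext t (term_vec f p) (axis j 1) = term_vec h (apply_term T p)"
proof (cases "fst p = 0")
  case True
  then show ?thesis
    using bilinear_ext_scale_left[of t 0 0] by (simp add: term_vec_zero apply_term_def)
next
  case False
  then obtain i where "snd p = f i"
    using assms(3) by auto
  then have p: "p = (fst p, f i)"
    by (metis prod.collapse)
  show ?thesis
    by (subst p, subst p)
      (simp add: assms(1,2) term_vec_axis bilinear_ext_scale_left bilinear_ext_axis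
        apply_term_def, simp add: term_vec_def vec_eq_iff)
qed

lemma bilinear_ext_term_right:
  assumes "inj f" "\<And>j. t i j = term_vec h (T (f j))" "fst p = 0 \<or> snd p \<in> range f"
  shows "bilinear_ext t (axis i 1) (term_vec f p) = term_vec h (apply_term T p)"
proof (cases "fst p = 0")
  case True
  then show ?thesis
    using bilinear_ext_scale_right[of t _ 0 0] by (simp add: term_vec_zero apply_term_def)
next
  case False
  then obtain j where "snd p = f j"
    using assms(3) by auto
  then have p: "p = (fst p, f j)"
    by (metis prod.collapse)
  show ?thesis
    by (subst p, subst p)
      (simp add: assms(1,2) term_vec_axis bilinear_ext_scale_right bilinear_ext_axis
        apply_term_def, simp add: term_vec_def vec_eq_iff)
qed

definition zero_sum :: "(int \<times> 'l) list \<Rightarrow> bool" where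
  "zero_sum ps \<longleftrightarrow> (\<forall>p\<in>set ps. (\<Sum>q\<leftarrow>ps. if snd q = snd p then fst q else 0) = 0)"

lemma zero_sum_term_vec:
  assumes "zero_sum ps"
  shows "(\<Sum>p\<leftarrow>ps. term_vec f p) = 0"
proof -
  have *: "(\<Sum>p\<leftarrow>qs. term_vec f p) $ a = of_int (\<Sum>p\<leftarrow>qs. if snd p = f a then fst p else 0)" for qs a
    by (induction qs) (auto simp: term_vec_def)
  have "(\<Sum>p\<leftarrow>ps. if snd p = f a then fst p else 0) = 0" for a
  proof (cases "\<exists>p\<in>set ps. snd p = f a")
    case True
    then show ?thesis
      using assms unfolding zero_sum_def by metis
  next
    case False
    then have "map (\<lambda>p. if snd p = f a then fst p else 0) ps = map (\<lambda>p. 0) ps"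
      by (intro map_cong) auto
    then have "(\<Sum>p\<leftarrow>ps. if snd p = f a then fst p else 0) = (\<Sum>p\<leftarrow>ps. 0)"
      by (rule arg_cong)
    then show ?thesis
      by (simp only: sum_list_0)
  qed
  then show ?thesis
    by (simp add: vec_eq_iff *)
qed

lemma zero_sum_3:
  "zero_sum [(p, l), (q, l), (r, l)] \<longleftrightarrow> p + q + r = 0"
  "zero_sum [(0, l), (q, m), (r, m)] \<longleftrightarrow> q + r = 0"
  "zero_sum [(q, m), (0, l), (r, m)] \<longleftrightarrow> q + r = 0"
  "zero_sum [(q, m), (r, m), (0, l)] \<longleftrightarrow> q + r = 0"
  "zero_sum [(q, m), (0, l), (0, k)] \<longleftrightarrow> q = 0"
  "zero_sum [(0, l), (q, m), (0, k)] \<longleftrightarrow> q = 0"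
  "zero_sum [(0, l), (0, k), (q, m)] \<longleftrightarrow> q = 0"
  "zero_sum [(0, l), (0, k), (0, m)]"
  by (auto simp: zero_sum_def)

lemma sl2_bracket_eq:
  "sl2_bracket v w = (\<chi> a. case a of
      E \<Rightarrow> 2 * (v $ H * w $ E - v $ E * w $ H)
    | F \<Rightarrow> - 2 * (v $ H * w $ F - v $ F * w $ H)
    | H \<Rightarrow> v $ E * w $ F - v $ F * w $ E)"
  by (simp add: vec_eq_iff sl2_bracket_def bilinear_ext_def skew_def term_vec_def UNIV_sl2_index
      algebra_simps split: sl2_index.split) (metis sl2_index.exhaust)

lemma sl2_bracket_self: "sl2_bracket v v = 0"
  by (simp add: sl2_bracket_def bilinear_ext_skew)

lemma sl2_jacobi:
  "sl2_bracket u (sl2_bracket v w) + sl2_bracket v (sl2_bracket w u)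
     + sl2_bracket w (sl2_bracket u v) = 0"
  by (simp add: sl2_bracket_eq vec_eq_iff algebra_simps split: sl2_index.split)

fun gn_valid :: "gn_label \<Rightarrow> bool" where
  "gn_valid C = True"
| "gn_valid (Z i) = (1 \<le> i \<and> i \<le> 3)"
| "gn_valid (X k i) = ((k = 1 \<or> k = 3 \<or> k = 4 \<or> k = 5) \<and> 1 \<le> i \<and> i \<le> k + 1)"
| "gn_valid (Y k i) = ((k = 1 \<or> k = 3 \<or> k = 4 \<or> k = 5) \<and> 1 \<le> i \<and> i \<le> k + 1)"

lemma gn_valid_iff: "gn_valid l \<longleftrightarrow> l \<in> range label_of"
  by (cases l) (auto simp: gn_labels_def type_definition.Rep_range[OF type_definition_gn_index])

lemma gn_valid_label: "gn_valid (label_of a)"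
  by (simp add: gn_valid_iff)

lemma inj_label_of: "inj label_of"
  by (simp add: inj_on_def label_of_inject)

lemma gn_valid_cases [consumes 1]:
  assumes "gn_valid a"
  obtains "a = C" | i where "a = Z i" "1 \<le> i" "i \<le> 3"
  | "a = X 1 1" | "a = X 1 2" | i where "a = X 3 i" "1 \<le> i" "i \<le> 4"
  | i where "a = X 4 i" "1 \<le> i" "i \<le> 5" | i where "a = X 5 i" "1 \<le> i" "i \<le> 6"
  | "a = Y 1 1" | "a = Y 1 2" | i where "a = Y 3 i" "1 \<le> i" "i \<le> 4"
  | i where "a = Y 4 i" "1 \<le> i" "i \<le> 5" | i where "a = Y 5 i" "1 \<le> i" "i \<le> 6"
proof (cases a)
  case (X k i)
  moreover have "i = 1 \<or> i = 2" if "k = 1"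
    using assms X that by auto
  ultimately show ?thesis
    using assms that by auto
next
  case (Y k i)
  moreover have "i = 1 \<or> i = 2" if "k = 1"
    using assms Y that by auto
  ultimately show ?thesis
    using assms that by auto
qed (use assms that in auto)

text \<open>The antisymmetrised table again has single-term entries, so the Jacobi and derivation identities
  can be checked on coefficient-label pairs.\<close>

definition gn_flip :: "gn_label \<Rightarrow> gn_label \<Rightarrow> int \<times> gn_label" where
  "gn_flip a b = (if gn_table a b = (0, C) then (- fst (gn_table b a), snd (gn_table b a))
     else gn_table a b)"

fun gn_skew :: "gn_label \<Rightarrow> gn_label \<Rightarrow> int \<times> gn_label" where
  "gn_skew (X k j) (X m i) =
     (if k = 3 \<and> m = 3 then (- 3 * (i - j), Y 4 (i + j - 2)) else gn_flip (X k j) (X m i))"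
| "gn_skew a b = gn_flip a b"

lemma gn_table_one_sided: "gn_table a b = (0, C) \<or> gn_table b a = (0, C)"
  by (cases a; cases b) auto

lemma gn_flip: "term_vec f (gn_table a b) - term_vec f (gn_table b a) = term_vec f (gn_flip a b)"
  using gn_table_one_sided[of a b] by (auto simp: gn_flip_def term_vec_zero term_vec_minus)

lemma gn_skew: "term_vec f (gn_table a b) - term_vec f (gn_table b a) = term_vec f (gn_skew a b)"
proof (cases "\<exists>i j. a = X 3 j \<and> b = X 3 i")
  case True
  then obtain i j where "a = X 3 j" "b = X 3 i"
    by auto
  then show ?thesis
    by (cases i j rule: linorder_cases) (simp_all add: term_vec_zero term_vec_minus algebra_simps)
next
  case False
  then have "gn_skew a b = gn_flip a b"
    by (cases a; cases b) auto
  then show ?thesis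
    by (simp add: gn_flip)
qed

lemma gn_skew_ok:
  assumes "gn_valid a" "gn_valid b"
  shows "fst (gn_skew a b) = 0 \<or> gn_valid (snd (gn_skew a b))"
  using assms(1)
  by (cases rule: gn_valid_cases; use assms(2) in \<open>cases rule: gn_valid_cases\<close>)
    (auto simp: gn_flip_def)

lemma sl2_gn_table_ok: "gn_valid a \<Longrightarrow> fst (sl2_gn_table s a) = 0 \<or> gn_valid (snd (sl2_gn_table s a))"
  by (cases s; cases a) auto

lemma gn_bracket_axis:
  "gn_bracket (axis a 1) (axis b 1) = term_vec label_of (gn_skew (label_of a) (label_of b))"
  by (simp add: gn_bracket_def bilinear_ext_axis skew_def gn_skew)

lemma gn_bracket_term:
  assumes "fst p = 0 \<or> gn_valid (snd p)"
  shows "gn_bracket (axis a 1) (term_vec label_of p) =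
    term_vec label_of (apply_term (gn_skew (label_of a)) p)"
  unfolding gn_bracket_def
  by (rule bilinear_ext_term_right[OF inj_label_of])
    (use assms in \<open>simp_all add: skew_def gn_skew gn_valid_iff\<close>)

lemma sl2_gn_action_axis:
  "sl2_gn_action (axis s 1) (axis a 1) = term_vec label_of (sl2_gn_table s (label_of a))"
  by (simp add: sl2_gn_action_def bilinear_ext_axis)

lemma sl2_gn_action_term:
  assumes "fst p = 0 \<or> gn_valid (snd p)"
  shows "sl2_gn_action (axis s 1) (term_vec label_of p) =
    term_vec label_of (apply_term (sl2_gn_table s) p)"
  unfolding sl2_gn_action_def
  by (rule bilinear_ext_term_right[OF inj_label_of]) (use assms in \<open>simp_all add: gn_valid_iff\<close>)

lemma sl2_gn_action_term_left:
  "sl2_gn_action (term_vec id p) (axis a 1) =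
    term_vec label_of (apply_term (\<lambda>s. sl2_gn_table s (label_of a)) p)"
  unfolding sl2_gn_action_def by (rule bilinear_ext_term_left) simp_all

lemma sl2_gn_action_bracket:
  "sl2_gn_action (sl2_bracket s t) v =
     sl2_gn_action s (sl2_gn_action t v) - sl2_gn_action t (sl2_gn_action s v)"
proof -
  define J where "J s t v = sl2_gn_action (sl2_bracket s t) v -
    sl2_gn_action s (sl2_gn_action t v) + sl2_gn_action t (sl2_gn_action s v)" for s t v
  note J_simps = J_def sl2_bracket_def sl2_gn_action_def bilinear_ext_simps
    vec.scale_right_distrib vec.scale_right_diff_distrib
  have tables: "zero_sum [apply_term (\<lambda>u. sl2_gn_table u a) (sl2_table s t),
      apply_term (\<lambda>u. sl2_gn_table u a) (- fst (sl2_table t s), snd (sl2_table t s)),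
      (- fst (apply_term (sl2_gn_table s) (sl2_gn_table t a)),
        snd (apply_term (sl2_gn_table s) (sl2_gn_table t a))),
      apply_term (sl2_gn_table t) (sl2_gn_table s a)]" for s t a
    by (cases s; cases t; cases a) (auto simp: zero_sum_def apply_term_def algebra_simps)
  have axes: "J (axis s 1) (axis t 1) (axis a 1) = 0" for s t a
  proof -
    have "sl2_bracket (axis s 1) (axis t 1) = term_vec id (sl2_table s t)
        + term_vec id (- fst (sl2_table t s), snd (sl2_table t s))"
      by (simp add: sl2_bracket_def bilinear_ext_axis skew_def flip: term_vec_minus)
    then have "sl2_gn_action (sl2_bracket (axis s 1) (axis t 1)) (axis a 1) =
        sl2_gn_action (term_vec id (sl2_table s t)) (axis a 1)
        + sl2_gn_action (term_vec id (- fst (sl2_table t s), snd (sl2_table t s))) (axis a 1)"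
      by (simp add: sl2_gn_action_def bilinear_ext_add_left)
    then show ?thesis
      using zero_sum_term_vec[OF tables[of "label_of a" s t], of label_of]
      by (simp add: J_def sl2_gn_action_axis sl2_gn_action_term sl2_gn_action_term_left
          sl2_gn_table_ok gn_valid_label algebra_simps
          term_vec_minus[of label_of "apply_term (sl2_gn_table s) p" for p, symmetric])
  qed
  have "J (axis s 1) (axis t 1) v = 0" for s t
    by (rule linear_zero_ext) (simp_all add: axes, simp_all add: J_simps)
  then have "J (axis s 1) t v = 0" for s
    by (rule linear_zero_ext[rotated 2]) (simp_all add: J_simps)
  then have "J s t v = 0"
    by (rule linear_zero_ext[rotated 2]) (simp_all add: J_simps)
  then show ?thesis
    by (simp add: J_def algebra_simps)
qed

lemma gn_bracket_self: "gn_bracket v v = 0"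
  by (simp add: gn_bracket_def bilinear_ext_skew)

lemma gn_bracket_swap: "gn_bracket v w = - gn_bracket w v"
  by (simp add: gn_bracket_def bilinear_ext_skew)

lemma sl2_gn_action_derivation:
  "sl2_gn_action s (gn_bracket v w) =
     gn_bracket v (sl2_gn_action s w) - gn_bracket w (sl2_gn_action s v)"
proof -
  define J where "J s v w = sl2_gn_action s (gn_bracket v w)
    + gn_bracket w (sl2_gn_action s v) - gn_bracket v (sl2_gn_action s w)" for s v w
  note J_simps = J_def gn_bracket_def sl2_gn_action_def bilinear_ext_simps
    vec.scale_right_distrib vec.scale_right_diff_distrib
  have tables: "zero_sum [apply_term (sl2_gn_table s) (gn_skew a b),
      apply_term (gn_skew b) (sl2_gn_table s a),
      (- fst (apply_term (gn_skew a) (sl2_gn_table s b)),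
        snd (apply_term (gn_skew a) (sl2_gn_table s b)))]"
    if a: "gn_valid a" and b: "gn_valid b" for s a b
    using a
    apply (cases rule: gn_valid_cases; use b in \<open>cases rule: gn_valid_cases\<close>; cases s)
    apply (simp_all add: zero_sum_3 apply_term_def gn_flip_def split del: if_split)
    apply (auto simp: zero_sum_def algebra_simps)
    done
  have axes: "J (axis s 1) (axis a 1) (axis b 1) = 0" for s a b
    using zero_sum_term_vec[OF tables[OF gn_valid_label[of a] gn_valid_label[of b], of s], of label_of]
    by (simp add: J_def sl2_gn_action_axis sl2_gn_action_term gn_bracket_axis gn_bracket_term
        sl2_gn_table_ok gn_skew_ok gn_valid_label algebra_simps flip: term_vec_minus)
  have "J (axis s 1) (axis a 1) w = 0" for s a
    by (rule linear_zero_ext) (simp_all add: axes, simp_all add: J_simps)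
  then have "J (axis s 1) v w = 0" for s
    by (rule linear_zero_ext[rotated 2]) (simp_all add: J_simps)
  then have "J s v w = 0"
    by (rule linear_zero_ext[rotated 2]) (simp_all add: J_simps)
  then show ?thesis
    by (simp add: J_def algebra_simps)
qed

text \<open>The Jacobi sum is alternating, so it suffices to check triples that are sorted by rank.\<close>

fun gn_rank :: "gn_label \<Rightarrow> int" where
  "gn_rank C = 0"
| "gn_rank (Z i) = 1"
| "gn_rank (X k i) = (if k = 1 then i + 1 else k + 1)"
| "gn_rank (Y k i) = (if k = 1 then i + 6 else k + 6)"

definition gn_jacobi_sum :: "gn_label \<Rightarrow> gn_label \<Rightarrow> gn_label \<Rightarrow> bool" where
  "gn_jacobi_sum a b c \<longleftrightarrow> zero_sum [apply_term (gn_skew a) (gn_skew b c),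
     apply_term (gn_skew b) (gn_skew c a), apply_term (gn_skew c) (gn_skew a b)]"

lemma gn_jacobi_sum_sorted:
  assumes a: "gn_valid a" and b: "gn_valid b" and c: "gn_valid c"
    and r: "gn_rank a \<le> gn_rank b" "gn_rank b \<le> gn_rank c"
  shows "gn_jacobi_sum a b c"
  using a r
  apply (cases rule: gn_valid_cases; use b in \<open>cases rule: gn_valid_cases\<close>; (simp; fail)?;
    use c in \<open>cases rule: gn_valid_cases\<close>; (simp; fail)?)
  apply (simp_all add: gn_jacobi_sum_def zero_sum_3 apply_term_def gn_flip_def split del: if_split)
  apply (auto simp: zero_sum_def algebra_simps)
  done

lemma gn_jacobi:
  "gn_bracket u (gn_bracket v w) + gn_bracket v (gn_bracket w u) + gn_bracket w (gn_bracket u v) = 0"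
proof -
  define J where "J u v w = gn_bracket u (gn_bracket v w) + gn_bracket v (gn_bracket w u)
    + gn_bracket w (gn_bracket u v)" for u v w
  note J_simps = J_def gn_bracket_def bilinear_ext_simps vec.scale_right_distrib
  have sorted: "J (axis a 1) (axis b 1) (axis c 1) = 0"
    if "gn_rank (label_of a) \<le> gn_rank (label_of b)" "gn_rank (label_of b) \<le> gn_rank (label_of c)"
    for a b c
    using zero_sum_term_vec[OF gn_jacobi_sum_sorted[OF gn_valid_label gn_valid_label gn_valid_label
        that, unfolded gn_jacobi_sum_def], of label_of]
    by (simp add: J_def gn_bracket_axis gn_bracket_term gn_skew_ok gn_valid_label algebra_simps)
  have rotate: "J u v w = J v w u" and swap: "J u v w = - J v u w" for u v w
    using gn_bracket_swap[of u v] gn_bracket_swap[of v w] gn_bracket_swap[of w u]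
    by (simp_all add: J_def gn_bracket_def bilinear_ext_minus_right algebra_simps)
  have axes: "J (axis a 1) (axis b 1) (axis c 1) = 0" for a b c
    using sorted rotate swap by (metis linorder_linear neg_0_equal_iff_equal)
  have "J (axis a 1) (axis b 1) w = 0" for a b
    by (rule linear_zero_ext) (simp_all add: axes, simp_all add: J_simps)
  then have "J (axis a 1) v w = 0" for a
    by (rule linear_zero_ext[rotated 2]) (simp_all add: J_simps)
  then have "J u v w = 0"
    by (rule linear_zero_ext[rotated 2]) (simp_all add: J_simps)
  then show ?thesis
    by (simp add: J_def)
qed

instantiation sl2_gn :: complex_lie_algebra
begin

lift_definition scaleC_sl2_gn :: "complex \<Rightarrow> sl2_gn \<Rightarrow> sl2_gn"
  is "\<lambda>c p. (c *s fst p, c *s snd p)" .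

lift_definition lie_sl2_gn :: "sl2_gn \<Rightarrow> sl2_gn \<Rightarrow> sl2_gn"
  is "semidirect_bracket sl2_bracket gn_bracket sl2_gn_action" .

instance
proof
  note linear_simps = semidirect_bracket_def sl2_bracket_def gn_bracket_def sl2_gn_action_def
    bilinear_ext_simps vec.scale_right_distrib vec.scale_right_diff_distrib
  fix x y z :: sl2_gn and c d :: complex
  show "scaleC c (x + y) = scaleC c x + scaleC c y"
    by transfer (simp add: vec.scale_right_distrib)
  show "scaleC (c + d) x = scaleC c x + scaleC d x"
    by transfer (simp add: vec.scale_left_distrib)
  show "scaleC c (scaleC d x) = scaleC (c * d) x"
    by transfer simp
  show "scaleC 1 x = x"
    by transfer simp
  show "lie (x + y) z = lie x z + lie y z"
    by transfer (simp add: linear_simps)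
  show "lie x (y + z) = lie x y + lie x z"
    by transfer (simp add: linear_simps)
  show "lie (scaleC c x) y = scaleC c (lie x y)"
    by transfer (simp add: linear_simps)
  show "lie x (scaleC c y) = scaleC c (lie x y)"
    by transfer (simp add: linear_simps)
  show "lie x x = 0"
    by transfer (simp add: semidirect_bracket_def sl2_bracket_self gn_bracket_self zero_prod_def)
  have gn_add: "gn_bracket u (v + w) = gn_bracket u v + gn_bracket u w"
    and gn_diff: "gn_bracket u (v - w) = gn_bracket u v - gn_bracket u w" for u v w
    by (simp_all add: gn_bracket_def bilinear_ext_simps)
  have act_add: "sl2_gn_action s (v + w) = sl2_gn_action s v + sl2_gn_action s w"
    and act_diff: "sl2_gn_action s (v - w) = sl2_gn_action s v - sl2_gn_action s w" for s v w
    by (simp_all add: sl2_gn_action_def bilinear_ext_simps)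
  show "lie x (lie y z) + lie y (lie z x) + lie z (lie x y) = 0"
  proof transfer
    fix x y z :: "(complex^sl2_index) \<times> (complex^gn_index)"
    show "semidirect_bracket sl2_bracket gn_bracket sl2_gn_action x
            (semidirect_bracket sl2_bracket gn_bracket sl2_gn_action y z) +
          semidirect_bracket sl2_bracket gn_bracket sl2_gn_action y
            (semidirect_bracket sl2_bracket gn_bracket sl2_gn_action z x) +
          semidirect_bracket sl2_bracket gn_bracket sl2_gn_action z
            (semidirect_bracket sl2_bracket gn_bracket sl2_gn_action x y) = 0"
      using sl2_jacobi[of "fst x" "fst y" "fst z"] gn_jacobi[of "snd x" "snd y" "snd z"]
      by (simp add: semidirect_bracket_def zero_prod_def gn_add gn_diff act_add act_diff
          sl2_gn_action_derivation sl2_gn_action_bracket algebra_simps)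
  qed
qed

end

end

theory Submission
  imports Defs "HOL-Library.Function_Algebras"
begin

text \<open>Write \<open>L\<close> for the algebra.  By Cartan's homotopy formula \<open>sl2\<close> acts trivially on \<open>H\<^sup>2(L, L)\<close>, and
  since the weights of cochains are bounded every cocycle is cohomologous to an \<open>sl2\<close>-invariant one;
  a further coboundary makes it vanish on \<open>sl2 \<times> L\<close>.  Such a cocycle is an \<open>sl2\<close>-equivariant map
  and is determined, component by component, by its values at highest weight vectors.  Subtracting
  the coboundary of an equivariant map and multiples of two explicit cocycles kills 21 of these
  components.  The cocycle identity, evaluated on suitable triples of basis vectors, then kills all
  remaining components that involve \<open>x\<^sub>1, x\<^sub>2, y\<^sub>1, y\<^sub>2\<close>.  The vectors annihilated by a cocycle form a subalgebra,
  and \<open>sl2, x\<^sub>1, x\<^sub>2, y\<^sub>1, y\<^sub>2\<close> generate \<open>L\<close>, so the cocycle vanishes.  The two explicit cocycles are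
  independent modulo coboundaries, as a few coordinates of a general coboundary show.\<close>

section \<open>A weight basis\<close>

text \<open>The obstacle is multiplicity. Every highest weight that occurs, except 0, belongs to two
  components, so by Schur's lemma an equivariant endomorphism consists of 2x2 blocks, and cochain
  components that mix the letters \<open>X\<close> and \<open>Y\<close> have to be treated too.

  The two classes come from two entries that coboundaries of such endomorphisms cannot adjust
  freely. The entry at \<open>(Y1, Y3, X4)\<close> is changed only by the coefficient from
  \<open>Y4\<close> to \<open>X4\<close>, which the entry at \<open>(Y1, Y4, Y5)\<close> already
  fixes. The entry at \<open>(X1, Y1, C0)\<close> is changed only by the two coefficients that mix
  \<open>X1\<close> and \<open>Y1\<close>, which the entries at \<open>(X1, Y3, Y4)\<close> and
  \<open>(Y1, X3, X4)\<close> already fix. Each explicit cocycle compensates for one of these two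
  defects.

  For the lower bound on the dimension the cochain \<open>g\<close> is an arbitrary linear map, so
  there equations at several weight vectors replace equivariance.\<close>

text \<open>The irreducible \<open>sl2\<close>-components of \<open>L\<close>, named by letter and highest weight: \<open>S2\<close> is \<open>sl2\<close> itself, \<open>C0\<close> is
  spanned by \<open>c\<close> and \<open>Z2\<close> by the \<open>z\<^sub>i\<close>.  The label \<open>Z 0\<close> used below is invalid and denotes the vector 0.\<close>

datatype comp = S2 | C0 | Z2 | X1 | Y1 | X3 | Y3 | X4 | Y4 | X5 | Y5

lemma UNIV_comp: "UNIV = {S2, C0, Z2, X1, Y1, X3, Y3, X4, Y4, X5, Y5}"
  using comp.exhaust by auto

instance comp :: finite
  by standard (simp add: UNIV_comp)

fun hw :: "comp \<Rightarrow> int" where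
  "hw S2 = 2" | "hw C0 = 0" | "hw Z2 = 2" | "hw X1 = 1" | "hw Y1 = 1" | "hw X3 = 3" | "hw Y3 = 3"
| "hw X4 = 4" | "hw Y4 = 4" | "hw X5 = 5" | "hw Y5 = 5"

fun lab :: "comp \<Rightarrow> int \<Rightarrow> gn_label" where
  "lab C0 i = (if i = 1 then C else Z 0)" | "lab Z2 i = Z i"
| "lab X1 i = X 1 i" | "lab Y1 i = Y 1 i" | "lab X3 i = X 3 i" | "lab Y3 i = Y 3 i"
| "lab X4 i = X 4 i" | "lab Y4 i = Y 4 i" | "lab X5 i = X 5 i" | "lab Y5 i = Y 5 i"
| "lab S2 i = Z 0"

abbreviation idx :: "comp \<Rightarrow> int \<Rightarrow> bool" where
  "idx t i \<equiv> 1 \<le> i \<and> i \<le> hw t + 1"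

lemma gn_valid_lab: "gn_valid (lab t i) \<longleftrightarrow> t \<noteq> S2 \<and> idx t i"
  by (cases t) auto

lemma lab_inject: "gn_valid (lab t i) \<Longrightarrow> lab t i = lab u j \<longleftrightarrow> t = u \<and> i = j"
  by (cases t; cases u) (auto split: if_splits)

text \<open>The vectors \<open>- e, h / 2, f\<close> behave under \<open>e\<close> and \<open>f\<close> exactly like \<open>z\<^sub>1, z\<^sub>2, z\<^sub>3\<close>, which makes the action
  uniform over all components.\<close>

definition sl2_vec :: "int \<Rightarrow> complex^sl2_index" where
  "sl2_vec i = (if i = 1 then - axis E 1 else if i = 2 then (1 / 2) *s axis H 1
     else if i = 3 then axis F 1 else 0)"

definition base :: "comp \<Rightarrow> int \<Rightarrow> sl2_gn" where
  "base t i = Abs_sl2_gn (if t = S2 then (sl2_vec i, 0) else (0, term_vec label_of (1, lab t i)))"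

text \<open>Dual to \<open>base\<close>: the sign and the factor 2 undo \<open>- e\<close> and
  \<open>h / 2\<close>. The sum has at most one nonzero term and is 0 at an invalid label, so no
  index of type \<open>gn_index\<close> has to be chosen.\<close>

definition coord :: "comp \<Rightarrow> int \<Rightarrow> sl2_gn \<Rightarrow> complex" where
  "coord t i v = (if t = S2
     then if i = 1 then - fst (Rep_sl2_gn v) $ E else if i = 2 then 2 * fst (Rep_sl2_gn v) $ H
       else if i = 3 then fst (Rep_sl2_gn v) $ F else 0
     else \<Sum>a\<in>UNIV. if label_of a = lab t i then snd (Rep_sl2_gn v) $ a else 0)"

lemma coord_add: "coord t i (v + w) = coord t i v + coord t i w"
proof -
  have "(\<Sum>a\<in>UNIV. if label_of a = lab t i then snd (Rep_sl2_gn (v + w)) $ a else 0) =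
      (\<Sum>a\<in>UNIV. if label_of a = lab t i then snd (Rep_sl2_gn v) $ a else 0)
      + (\<Sum>a\<in>UNIV. if label_of a = lab t i then snd (Rep_sl2_gn w) $ a else 0)"
    unfolding sum.distrib[symmetric] by (rule sum.cong) (simp_all add: plus_sl2_gn.rep_eq)
  then show ?thesis
    by (simp add: coord_def plus_sl2_gn.rep_eq algebra_simps)
qed

lemma coord_scaleC: "coord t i (scaleC c v) = c * coord t i v"
proof -
  have "(\<Sum>a\<in>UNIV. if label_of a = lab t i then snd (Rep_sl2_gn (scaleC c v)) $ a else 0) =
      c * (\<Sum>a\<in>UNIV. if label_of a = lab t i then snd (Rep_sl2_gn v) $ a else 0)"
    unfolding sum_distrib_left by (rule sum.cong) (simp_all add: scaleC_sl2_gn.rep_eq)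
  then show ?thesis
    by (simp add: coord_def scaleC_sl2_gn.rep_eq)
qed

lemma coord_0: "coord t i 0 = 0"
  using coord_add[of t i 0 0] by simp

lemma coord_minus: "coord t i (- v) = - coord t i v"
  using coord_add[of t i v "- v"] by (simp add: coord_0 add_eq_0_iff2)

lemma coord_diff: "coord t i (v - w) = coord t i v - coord t i w"
  using coord_add[of t i v "- w"] by (simp add: coord_minus)

lemma coord_sum: "coord t i (sum f A) = (\<Sum>a\<in>A. coord t i (f a))"
  by (induction A rule: infinite_finite_induct) (simp_all add: coord_0 coord_add)

lemmas coord_simps = coord_add coord_scaleC coord_0 coord_minus coord_diff

lemma coord_out: "\<not> idx t i \<Longrightarrow> coord t i v = 0"
proof -
  assume *: "\<not> idx t i"
  show ?thesis
  proof (cases "t = S2")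
    case True
    then show ?thesis
      using * by (auto simp: coord_def)
  next
    case False
    then have "\<not> gn_valid (lab t i)"
      using * gn_valid_lab by auto
    then have "label_of a \<noteq> lab t i" for a
      using gn_valid_label by metis
    then show ?thesis
      using False by (simp add: coord_def)
  qed
qed

lemma base_out: "\<not> idx t i \<Longrightarrow> base t i = 0"
proof -
  assume *: "\<not> idx t i"
  show ?thesis
  proof (cases "t = S2")
    case True
    then show ?thesis
      using * by (auto simp: base_def sl2_vec_def zero_sl2_gn_def zero_prod_def)
  next
    case False
    then have "\<not> gn_valid (lab t i)"
      using * gn_valid_lab by auto
    then have "label_of a \<noteq> lab t i" for a
      using gn_valid_label by metis
    then show ?thesis
      using False by (simp add: base_def zero_sl2_gn_def zero_prod_def term_vec_def zero_vec_def)
  qed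
qed

lemma coord_label:
  assumes "label_of a = lab t i"
  shows "coord t i v = snd (Rep_sl2_gn v) $ a"
proof -
  have "t \<noteq> S2"
    using assms gn_valid_lab gn_valid_label by metis
  moreover have "label_of b = lab t i \<longleftrightarrow> b = a" for b
    using assms label_of_inject by metis
  ultimately show ?thesis
    by (simp add: coord_def)
qed

lemma gn_valid_imp_lab:
  assumes "gn_valid l"
  shows "\<exists>t i. l = lab t i"
  using assms
proof (cases rule: gn_valid_cases)
  case 1
  then have "l = lab C0 1" by simp
  then show ?thesis by blast
qed (metis lab.simps)+

lemma coord_ext:
  assumes "\<And>t i. idx t i \<Longrightarrow> coord t i v = coord t i w"
  shows "v = w"
proof -
  have *: "coord t i v = coord t i w" for t i
    using assms coord_out by metis
  have "snd (Rep_sl2_gn v) $ a = snd (Rep_sl2_gn w) $ a" for a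
    using gn_valid_imp_lab[OF gn_valid_label[of a]] coord_label * by metis
  moreover have "fst (Rep_sl2_gn v) $ s = fst (Rep_sl2_gn w) $ s" for s
    using *[of S2 1] *[of S2 2] *[of S2 3] by (cases s) (simp_all add: coord_def)
  ultimately have "Rep_sl2_gn v = Rep_sl2_gn w"
    by (simp add: prod_eq_iff vec_eq_iff)
  then show ?thesis
    by (simp add: Rep_sl2_gn_inject)
qed

lemma Rep_base: "Rep_sl2_gn (base t i) =
    (if t = S2 then (sl2_vec i, 0) else (0, term_vec label_of (1, lab t i)))"
  by (simp add: base_def Abs_sl2_gn_inverse)

lemma coord_base: "coord u j (base t i) = (if u = t \<and> j = i \<and> idx t i then 1 else 0)"
proof (cases "idx t i \<and> idx u j")
  case False
  then show ?thesis
    by (auto simp: base_out coord_0 coord_out)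
next
  case True
  show ?thesis
  proof (cases "u = S2")
    case u: True
    then show ?thesis
      using True by (cases "t = S2") (auto simp: coord_def Rep_base sl2_vec_def axis_def)
  next
    case False
    then obtain a where a: "label_of a = lab u j"
      using True gn_valid_lab[of u j] gn_valid_iff by auto
    show ?thesis
      using False True a lab_inject[of u j t i] gn_valid_lab[of u j]
      by (auto simp: coord_label[OF a] Rep_base term_vec_def)
  qed
qed

lemma expansion: "v = (\<Sum>t\<in>UNIV. \<Sum>i\<in>{1..hw t + 1}. scaleC (coord t i v) (base t i))"
proof (rule coord_ext)
  fix u j assume *: "idx u j"
  have "coord u j (\<Sum>t\<in>UNIV. \<Sum>i\<in>{1..hw t + 1}. scaleC (coord t i v) (base t i)) =
      (\<Sum>t\<in>UNIV. \<Sum>i\<in>{1..hw t + 1}. if u = t \<and> j = i then coord t i v else 0)"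
    unfolding coord_sum by (intro sum.cong) (auto simp: coord_simps coord_base)
  also have "\<dots> = (\<Sum>t\<in>UNIV. if u = t then coord u j v else 0)"
    by (intro sum.cong) (use * in auto)
  finally show "coord u j v = coord u j (\<Sum>t\<in>UNIV. \<Sum>i\<in>{1..hw t + 1}. scaleC (coord t i v) (base t
      i))"
    by simp
qed

lemma linear_expansion:
  fixes p :: "sl2_gn \<Rightarrow> 'b::ab_group_add"
  assumes "\<And>v w. p (v + w) = p v + p w" "\<And>c v. p (scaleC c v) = s c (p v)"
  shows "p v = (\<Sum>t\<in>UNIV. \<Sum>i\<in>{1..hw t + 1}. s (coord t i v) (p (base t i)))"
proof -
  have "p 0 = 0"
    using assms(1)[of 0 0] by simp
  then have p1: "p (sum h A) = (\<Sum>a\<in>A. p (h a))" for h and A :: "int set"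
    by (induction A rule: infinite_finite_induct) (simp_all add: assms(1))
  have p2: "p (sum h A) = (\<Sum>a\<in>A. p (h a))" for h and A :: "comp set"
    using \<open>p 0 = 0\<close> by (induction A rule: infinite_finite_induct) (simp_all add: assms(1))
  have "p v = p (\<Sum>t\<in>UNIV. \<Sum>i\<in>{1..hw t + 1}. scaleC (coord t i v) (base t i))"
    by (rule arg_cong[OF expansion])
  then show ?thesis
    by (simp only: p1 p2 assms(2))
qed

text \<open>The scaling \<open>s\<close> of the target stays a parameter because the rule is applied
  to scalar-valued coordinates as well as to maps into the algebra.\<close>

lemma linear_eqI:
  fixes p q :: "sl2_gn \<Rightarrow> 'b::ab_group_add"
  assumes "\<And>v w. p (v + w) = p v + p w" "\<And>c v. p (scaleC c v) = s c (p v)"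
    and "\<And>v w. q (v + w) = q v + q w" "\<And>c v. q (scaleC c v) = s c (q v)"
    and "\<And>t i. idx t i \<Longrightarrow> p (base t i) = q (base t i)"
  shows "p v = q v"
proof -
  have "p v = (\<Sum>t\<in>UNIV. \<Sum>i\<in>{1..hw t + 1}. s (coord t i v) (p (base t i)))"
    by (rule linear_expansion[where p = p and s = s, OF assms(1,2)])
  also have "\<dots> = (\<Sum>t\<in>UNIV. \<Sum>i\<in>{1..hw t + 1}. s (coord t i v) (q (base t i)))"
    by (intro sum.cong) (simp_all add: assms(5))
  also have "\<dots> = q v"
    by (rule linear_expansion[where p = q and s = s, OF assms(3,4), symmetric])
  finally show ?thesis .
qed

section \<open>The bracket in the weight basis\<close>

text \<open>An entry \<open>(w, s, \<kappa>)\<close> at \<open>(t, u)\<close> encodes \<open>[t\<^sub>i, u\<^sub>j] = \<kappa> i j \<cdot> w\<^bsub>i+j-1-s\<^esub>\<close>.\<close>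

fun bracket_table :: "comp \<Rightarrow> comp \<Rightarrow> comp \<times> int \<times> (int \<Rightarrow> int \<Rightarrow> complex)" where
  "bracket_table S2 u = (u, 1, \<lambda>i j. of_int (hw u) * of_int (i - 1) / 2 - of_int (j - 1))"
| "bracket_table C0 u = (C0, 0, \<lambda>i j. 0)"
| "bracket_table Z2 u = (case u of
     S2 \<Rightarrow> (Z2, 1, \<lambda>i j. of_int (i - 1) - of_int (j - 1))
   | X1 \<Rightarrow> (X3, 0, \<lambda>i j. - 1) | Y1 \<Rightarrow> (Y3, 0, \<lambda>i j. - 1) | X3 \<Rightarrow> (Y5, 0, \<lambda>i j. - 1)
   | X4 \<Rightarrow> (Y4, 1, \<lambda>i j. 2 * of_int (j - 1) - 4 * of_int (i - 1)) | _ \<Rightarrow> (C0, 0, \<lambda>i j. 0))"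
| "bracket_table X1 u = (case u of
     S2 \<Rightarrow> (X1, 1, \<lambda>i j. of_int (i - 1) - of_int (j - 1) / 2)
   | X1 \<Rightarrow> (C0, 1, \<lambda>i j. of_int (j - i)) | Y1 \<Rightarrow> (Z2, 0, \<lambda>i j. 1) | Z2 \<Rightarrow> (X3, 0, \<lambda>i j. 1)
   | X3 \<Rightarrow> (X4, 0, \<lambda>i j. 1) | X4 \<Rightarrow> (X5, 0, \<lambda>i j. 1)
   | Y5 \<Rightarrow> (Y4, 1, \<lambda>i j. of_int (j - 1) - 5 * of_int (i - 1)) | _ \<Rightarrow> (C0, 0, \<lambda>i j. 0))"
| "bracket_table Y1 u = (case u of
     S2 \<Rightarrow> (Y1, 1, \<lambda>i j. of_int (i - 1) - of_int (j - 1) / 2)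
   | Y1 \<Rightarrow> (C0, 1, \<lambda>i j. of_int (j - i)) | X1 \<Rightarrow> (Z2, 0, \<lambda>i j. - 1) | Z2 \<Rightarrow> (Y3, 0, \<lambda>i j. 1)
   | Y3 \<Rightarrow> (Y4, 0, \<lambda>i j. 1) | X4 \<Rightarrow> (Y5, 0, \<lambda>i j. 1)
   | X5 \<Rightarrow> (Y4, 1, \<lambda>i j. 5 * of_int (i - 1) - of_int (j - 1)) | _ \<Rightarrow> (C0, 0, \<lambda>i j. 0))"
| "bracket_table X3 u = (case u of
     S2 \<Rightarrow> (X3, 1, \<lambda>i j. of_int (i - 1) - 3 * of_int (j - 1) / 2)
   | X1 \<Rightarrow> (X4, 0, \<lambda>i j. - 1) | Z2 \<Rightarrow> (Y5, 0, \<lambda>i j. 1) | X3 \<Rightarrow> (Y4, 1, \<lambda>i j. - 3 * of_int (j - i))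
   | _ \<Rightarrow> (C0, 0, \<lambda>i j. 0))"
| "bracket_table Y3 u = (case u of
     S2 \<Rightarrow> (Y3, 1, \<lambda>i j. of_int (i - 1) - 3 * of_int (j - 1) / 2)
   | Y1 \<Rightarrow> (Y4, 0, \<lambda>i j. - 1) | _ \<Rightarrow> (C0, 0, \<lambda>i j. 0))"
| "bracket_table X4 u = (case u of
     S2 \<Rightarrow> (X4, 1, \<lambda>i j. of_int (i - 1) - 2 * of_int (j - 1))
   | X1 \<Rightarrow> (X5, 0, \<lambda>i j. - 1) | Y1 \<Rightarrow> (Y5, 0, \<lambda>i j. - 1)
   | Z2 \<Rightarrow> (Y4, 1, \<lambda>i j. 4 * of_int (j - 1) - 2 * of_int (i - 1)) | _ \<Rightarrow> (C0, 0, \<lambda>i j. 0))"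
| "bracket_table Y4 u = (case u of
     S2 \<Rightarrow> (Y4, 1, \<lambda>i j. of_int (i - 1) - 2 * of_int (j - 1)) | _ \<Rightarrow> (C0, 0, \<lambda>i j. 0))"
| "bracket_table X5 u = (case u of
     S2 \<Rightarrow> (X5, 1, \<lambda>i j. of_int (i - 1) - 5 * of_int (j - 1) / 2)
   | Y1 \<Rightarrow> (Y4, 1, \<lambda>i j. of_int (i - 1) - 5 * of_int (j - 1)) | _ \<Rightarrow> (C0, 0, \<lambda>i j. 0))"
| "bracket_table Y5 u = (case u of
     S2 \<Rightarrow> (Y5, 1, \<lambda>i j. of_int (i - 1) - 5 * of_int (j - 1) / 2)
   | X1 \<Rightarrow> (Y4, 1, \<lambda>i j. 5 * of_int (j - 1) - of_int (i - 1)) | _ \<Rightarrow> (C0, 0, \<lambda>i j. 0))"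

definition bracket_comp :: "comp \<Rightarrow> comp \<Rightarrow> comp" where
  "bracket_comp t u = fst (bracket_table t u)"

definition bracket_shift :: "comp \<Rightarrow> comp \<Rightarrow> int" where
  "bracket_shift t u = fst (snd (bracket_table t u))"

definition bracket_coeff :: "comp \<Rightarrow> comp \<Rightarrow> int \<Rightarrow> int \<Rightarrow> complex" where
  "bracket_coeff t u = snd (snd (bracket_table t u))"

lemmas bracket_defs = bracket_comp_def bracket_shift_def bracket_coeff_def

definition gn_vec :: "gn_label \<Rightarrow> complex^gn_index" where
  "gn_vec l = term_vec label_of (1, l)"

lemma term_vec_gn: "term_vec label_of (c, l) = of_int c *s gn_vec l"
  by (simp add: gn_vec_def term_vec_def vec_eq_iff)

lemma gn_vec_label: "gn_vec (label_of a) = axis a 1"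
  by (simp add: gn_vec_def term_vec_axis[OF inj_label_of])

lemma gn_bracket_gn_vec:
  assumes "gn_valid l" "gn_valid m"
  shows "gn_bracket (gn_vec l) (gn_vec m) = of_int (fst (gn_skew l m)) *s gn_vec (snd (gn_skew l
      m))"
proof -
  obtain a b where ab: "l = label_of a" "m = label_of b"
    using assms gn_valid_iff by auto
  show ?thesis
    by (simp add: ab gn_vec_label gn_bracket_axis flip: term_vec_gn)
qed

lemma sl2_gn_action_gn_vec:
  assumes "gn_valid l"
  shows "sl2_gn_action (axis s 1) (gn_vec l) =
    of_int (fst (sl2_gn_table s l)) *s gn_vec (snd (sl2_gn_table s l))"
proof -
  obtain a where a: "l = label_of a"
    using assms gn_valid_iff by auto
  show ?thesis
    by (simp add: a gn_vec_label sl2_gn_action_axis flip: term_vec_gn)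
qed

lemma gn_bracket_lab:
  assumes "t \<noteq> S2" "u \<noteq> S2" "idx t i" "idx u j"
  shows "gn_bracket (gn_vec (lab t i)) (gn_vec (lab u j)) =
    bracket_coeff t u i j *s gn_vec (lab (bracket_comp t u) (i + j - 1 - bracket_shift t u))"
proof -
  \<comment> \<open>\<open>gn_table\<close> lists \<open>[x_1, x_2]\<close> and
    \<open>[y_1, y_2]\<close> at explicit indices, \<open>bracket_table\<close> has the coefficient
    \<open>j - i\<close>; the two are compared index by index.\<close>
  have X1: "i = 1 \<or> i = 2" if "t = X1 \<or> t = Y1"
    using assms(3) that by auto
  have Y1: "j = 1 \<or> j = 2" if "u = X1 \<or> u = Y1"
    using assms(4) that by auto
  have [simp]: "gn_vec (Z 0) = 0"
    using gn_valid_label[where a = a for a] by (simp add: gn_vec_def term_vec_def vec_eq_iff)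
        (metis gn_valid.simps(2) gn_valid_label not_one_le_zero)
  show ?thesis
    using assms X1 Y1
    by (subst gn_bracket_gn_vec; (simp add: gn_valid_lab)?; cases t; cases u)
      (auto simp: bracket_defs gn_flip_def vec_eq_iff algebra_simps)
qed

lemma sl2_gn_action_lab:
  assumes "t \<noteq> S2" "idx S2 i" "idx t j"
  shows "sl2_gn_action (sl2_vec i) (gn_vec (lab t j)) =
    (of_int (hw t) * of_int (i - 1) / 2 - of_int (j - 1)) *s gn_vec (lab t (i + j - 2))"
proof -
  have i: "i = 1 \<or> i = 2 \<or> i = 3"
    using assms(2) by auto
  have act: "sl2_gn_action (- v) w = - sl2_gn_action v w"
    "sl2_gn_action (c *s v) w = c *s sl2_gn_action v w" for c v w
    by (simp_all add: sl2_gn_action_def bilinear_ext_simps)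
  have "gn_valid (lab t j)"
    using assms gn_valid_lab by auto
  then show ?thesis
    using i assms(1,3) unfolding sl2_vec_def
    by (cases t) (auto simp: act sl2_gn_action_gn_vec vec_eq_iff algebra_simps)
qed

lemma Rep_lie: "Rep_sl2_gn (lie v w) =
   semidirect_bracket sl2_bracket gn_bracket sl2_gn_action (Rep_sl2_gn v) (Rep_sl2_gn w)"
  by (rule lie_sl2_gn.rep_eq)

lemma Rep_base_cases:
  "Rep_sl2_gn (base S2 i) = (sl2_vec i, 0)"
  "t \<noteq> S2 \<Longrightarrow> Rep_sl2_gn (base t i) = (0, gn_vec (lab t i))"
  by (simp_all add: Rep_base gn_vec_def)

lemma bilinear_0:
  "gn_bracket v 0 = 0" "gn_bracket 0 v = 0" "sl2_bracket s 0 = 0" "sl2_bracket 0 s = 0"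
  "sl2_gn_action 0 v = 0" "sl2_gn_action s 0 = 0"
  by (simp_all add: gn_bracket_def sl2_bracket_def sl2_gn_action_def bilinear_ext_def)

lemma lie_swap: "lie v w = - lie w (v :: 'a::complex_lie_algebra)"
proof -
  have "lie (v + w) (v + w) = lie v w + lie w v"
    unfolding lie_add_left lie_add_right by (simp add: lie_self)
  then show ?thesis
    by (simp add: lie_self eq_neg_iff_add_eq_0)
qed

text \<open>The choice of \<open>- e\<close>, \<open>h / 2\<close>, \<open>f\<close> turns the three
  action rules into one coefficient that is affine in \<open>i\<close>: its values at 1, 2, 3 are
  \<open>- (j - 1)\<close>, \<open>hw u / 2 - (j - 1)\<close> and
  \<open>hw u - (j - 1)\<close>.\<close>

lemma lie_base_S2:
  assumes "idx S2 i" "idx u j"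
  shows "lie (base S2 i) (base u j) =
    scaleC (of_int (hw u) * of_int (i - 1) / 2 - of_int (j - 1)) (base u (i + j - 2))"
proof (cases "u = S2")
  case True
  have ij: "i = 1 \<or> i = 2 \<or> i = 3" "j = 1 \<or> j = 2 \<or> j = 3"
    using True assms by auto
  have "sl2_bracket (sl2_vec i) (sl2_vec j) = (of_int (i - 1) - of_int (j - 1)) *s sl2_vec (i + j
      - 2)"
    using ij by (auto simp: sl2_bracket_eq sl2_vec_def vec_eq_iff axis_def split: sl2_index.splits)
  then have "Rep_sl2_gn (lie (base S2 i) (base S2 j)) =
      Rep_sl2_gn (scaleC (of_int (i - 1) - of_int (j - 1)) (base S2 (i + j - 2)))"
    by (simp only: Rep_lie Rep_base_cases semidirect_bracket_def bilinear_0 scaleC_sl2_gn.rep_eq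
        fst_conv snd_conv)
      simp
  then have "lie (base S2 i) (base S2 j) =
      scaleC (of_int (i - 1) - of_int (j - 1)) (base S2 (i + j - 2))"
    by (simp only: Rep_sl2_gn_inject)
  moreover have "of_int (hw u) * of_int (i - 1) / 2 - of_int (j - 1) =
      (of_int (i - 1) - of_int (j - 1) :: complex)"
    by (simp add: True field_simps)
  ultimately show ?thesis
    by (simp only: True)
next
  case False
  have "Rep_sl2_gn (lie (base S2 i) (base u j)) = Rep_sl2_gn (scaleC
      (of_int (hw u) * of_int (i - 1) / 2 - of_int (j - 1)) (base u (i + j - 2)))"
    using assms False sl2_gn_action_lab[OF False assms]
    by (simp add: Rep_lie Rep_base_cases semidirect_bracket_def bilinear_0 scaleC_sl2_gn.rep_eq)
  then show ?thesis
    by (simp add: Rep_sl2_gn_inject)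
qed

lemma lie_base:
  assumes "idx t i" "idx u j"
  shows "lie (base t i) (base u j) =
    scaleC (bracket_coeff t u i j) (base (bracket_comp t u) (i + j - 1 - bracket_shift t u))"
proof (cases "t = S2 \<or> u = S2")
  case True
  then show ?thesis
  proof
    assume t: "t = S2"
    then show ?thesis
      using lie_base_S2[of i j u] assms by (simp add: bracket_defs algebra_simps)
  next
    assume u: "u = S2"
    have "lie (base t i) (base u j) = - lie (base u j) (base t i)"
      by (rule lie_swap)
    also have "\<dots> = - scaleC (of_int (hw t) * of_int (j - 1) / 2 - of_int (i - 1)) (base t (j + i -
        2))"
      using assms u lie_base_S2[of j i t] by simp
    also have "- (of_int (hw t) * of_int (j - 1) / 2 - of_int (i - 1)) = bracket_coeff t u i j"
      using assms(1) unfolding u by (cases t) (auto simp: bracket_defs field_simps)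
    then have "- scaleC (of_int (hw t) * of_int (j - 1) / 2 - of_int (i - 1)) (base t (j + i - 2)) =
        scaleC (bracket_coeff t u i j) (base t (i + j - 2))"
      by (metis scaleC.scale_minus_left add.commute)
    also have "scaleC (bracket_coeff t u i j) (base t (i + j - 2)) =
        scaleC (bracket_coeff t u i j) (base (bracket_comp t u) (i + j - 1 - bracket_shift t u))"
      unfolding u by (cases t) (simp_all add: bracket_defs algebra_simps)
    finally show ?thesis .
  qed
next
  case False
  then have "bracket_comp t u \<noteq> S2"
    by (cases t; cases u) (simp_all add: bracket_defs)
  then have "Rep_sl2_gn (lie (base t i) (base u j)) = Rep_sl2_gn (scaleC (bracket_coeff t u i j)
      (base (bracket_comp t u) (i + j - 1 - bracket_shift t u)))"
    using False assms gn_bracket_lab[of t u i j]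
    by (simp add: Rep_lie Rep_base_cases semidirect_bracket_def bilinear_0 scaleC_sl2_gn.rep_eq)
  then show ?thesis
    by (simp add: Rep_sl2_gn_inject)
qed

lemma sum_comp: "sum g (UNIV :: comp set) =
    g S2 + g C0 + g Z2 + g X1 + g Y1 + g X3 + g Y3 + g X4 + g Y4 + g X5 + g Y5"
  for g :: "comp \<Rightarrow> 'b::comm_monoid_add"
  by (simp add: UNIV_comp add.assoc)

lemma coord_lie:
  assumes t: "idx t i"
  shows "coord w k (lie (base t i) v) = (if idx w k then
    \<Sum>u\<in>UNIV. if bracket_comp t u = w
      then bracket_coeff t u i (k + 1 + bracket_shift t u - i) * coord u (k + 1 + bracket_shift t
          u - i) v
      else 0 else 0)" (is "?L v = ?R v")
proof (rule linear_eqI[where s = "(*)"])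
  define T where "T u v = (if bracket_comp t u = w
      then bracket_coeff t u i (k + 1 + bracket_shift t u - i) * coord u (k + 1 + bracket_shift t
          u - i) v
      else 0)" for u v
  have T: "T u (v + v') = T u v + T u v'" "T u (scaleC c v) = c * T u v" for u v v' c
    by (simp_all add: T_def coord_simps algebra_simps)
  show "?R (v + v') = ?R v + ?R v'" for v v'
    unfolding T_def[symmetric] by (simp add: T sum.distrib)
  show "?R (scaleC c v) = c * ?R v" for c v
    unfolding T_def[symmetric] by (simp add: T flip: sum_distrib_left)
  fix u j assume u: "idx u j"
  have "(\<Sum>u'\<in>UNIV. if bracket_comp t u' = w then bracket_coeff t u' i (k + 1 + bracket_shift t u'
      - i)
        * coord u' (k + 1 + bracket_shift t u' - i) (base u j) else 0) =
      (\<Sum>u'\<in>UNIV. if u' = u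
      then (if bracket_comp t u = w \<and> j = k + 1 + bracket_shift t u - i then bracket_coeff t u i j
          else 0)
      else 0)"
    using u by (intro sum.cong) (auto simp: coord_base)
  then have "?R (base u j) = (if idx w k then (if bracket_comp t u = w \<and> j = k + 1 + bracket_shift
      t u - i
      then bracket_coeff t u i j else 0) else 0)"
    by simp
  also have "\<dots> = ?L (base u j)"
    using u t by (auto simp: lie_base coord_simps coord_base)
  finally show "?L (base u j) = ?R (base u j)" ..
qed (simp_all add: lie_algebra_simps coord_simps)

section \<open>Invariant representatives in \<open>sl2\<close>-modules\<close>

text \<open>The commutation relations are demanded on \<open>S\<close> only: the ambient space will
  consist of all binary maps, and there \<open>act_lie\<close> holds for bilinear ones.\<close>

locale sl2_module = vector_space scale
  for scale :: "complex \<Rightarrow> 'v::ab_group_add \<Rightarrow> 'v" +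
  fixes S :: "'v set" and e f h :: "'v \<Rightarrow> 'v"
  assumes S: "subspace S"
    and S_closed: "\<And>v. v \<in> S \<Longrightarrow> e v \<in> S" "\<And>v. v \<in> S \<Longrightarrow> f v \<in> S" "\<And>v. v \<in> S \<Longrightarrow> h v \<in> S"
    and e_add: "e (v + w) = e v + e w" and e_scale: "e (scale c v) = scale c (e v)"
    and f_add: "f (v + w) = f v + f w" and f_scale: "f (scale c v) = scale c (f v)"
    and h_add: "h (v + w) = h v + h w" and h_scale: "h (scale c v) = scale c (h v)"
    and h_e: "v \<in> S \<Longrightarrow> h (e v) = e (h v) + scale 2 (e v)"
    and h_f: "v \<in> S \<Longrightarrow> h (f v) = f (h v) - scale 2 (f v)"
    and e_f: "v \<in> S \<Longrightarrow> e (f v) = f (e v) + h v"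
begin

lemma funpow_S: "v \<in> S \<Longrightarrow> (e ^^ n) v \<in> S" "v \<in> S \<Longrightarrow> (f ^^ n) v \<in> S"
  by (induction n) (simp_all add: S_closed)

lemma e_0: "e 0 = 0" and f_0: "f 0 = 0"
  using e_add[of 0 0] f_add[of 0 0] by simp_all

lemma e_diff: "e (v - w) = e v - e w" and f_diff: "f (v - w) = f v - f w" and h_diff: "h (v - w) =
    h v - h w"
  using e_add[of "v - w" w] f_add[of "v - w" w] h_add[of "v - w" w] by (simp_all add: algebra_simps)

lemma funpow_e_diff: "(e ^^ n) (v - w) = (e ^^ n) v - (e ^^ n) w"
  by (induction n) (simp_all add: e_diff)

lemma funpow_e_scale: "(e ^^ n) (scale c v) = scale c ((e ^^ n) v)"
  by (induction n) (simp_all add: e_scale)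

text \<open>A product of factors \<open>h - k\<close>; working with such polynomials in
  \<open>h\<close> replaces a decomposition into weight spaces.\<close>

definition h_shifts :: "int list \<Rightarrow> 'v \<Rightarrow> 'v" where
  "h_shifts ks = foldr (\<lambda>k v. h v - scale (of_int k) v) ks"

lemma h_shifts_simps [simp]:
  "h_shifts [] v = v"
  "h_shifts (k # ks) v = h (h_shifts ks v) - scale (of_int k) (h_shifts ks v)"
  by (simp_all add: h_shifts_def)

lemma h_shifts_append: "h_shifts (ks @ ls) v = h_shifts ks (h_shifts ls v)"
  by (simp add: h_shifts_def)

lemma h_h_shifts: "h (h_shifts ks v) = h_shifts ks (h v)"
  by (induction ks) (simp_all add: h_diff h_scale)

lemma h_shifts_eigenvector:
  assumes "h v = scale \<mu> v"
  shows "h_shifts ks v = scale (\<Prod>k\<leftarrow>ks. \<mu> - of_int k) v"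
  by (induction ks) (simp_all add: assms h_scale left_diff_distrib scale_left_diff_distrib
      mult.commute)

lemma h_funpow_e:
  assumes "v \<in> S" "h v = scale \<mu> v"
  shows "h ((e ^^ n) v) = scale (\<mu> + 2 * of_nat n) ((e ^^ n) v)"
  by (induction n) (simp_all add: assms funpow_S h_e e_scale e_add scale_left_distrib)

lemma h_funpow_f:
  assumes "v \<in> S" "h v = scale \<mu> v"
  shows "h ((f ^^ n) v) = scale (\<mu> - 2 * of_nat n) ((f ^^ n) v)"
  by (induction n) (simp_all add: assms funpow_S h_f f_scale f_diff scale_left_distrib
      scale_left_diff_distrib)

lemma e_funpow_f:
  assumes "v \<in> S" "e v = 0" "h v = scale \<mu> v"
  shows "e ((f ^^ Suc n) v) = scale (of_nat (Suc n) * (\<mu> - of_nat n)) ((f ^^ n) v)"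
proof (induction n)
  case 0
  then show ?case
    by (simp add: e_f assms f_0)
next
  case (Suc n)
  have "e ((f ^^ Suc (Suc n)) v) = f (e ((f ^^ Suc n) v)) + h ((f ^^ Suc n) v)"
    using e_f[OF funpow_S(2)[OF assms(1), of "Suc n"]] by simp
  also have "f (e ((f ^^ Suc n) v)) = scale (of_nat (Suc n) * (\<mu> - of_nat n)) ((f ^^ Suc n) v)"
    by (simp only: Suc.IH f_scale) simp
  also have "h ((f ^^ Suc n) v) = scale (\<mu> - 2 * of_nat (Suc n)) ((f ^^ Suc n) v)"
    by (rule h_funpow_f[OF assms(1,3)])
  also have "scale (of_nat (Suc n) * (\<mu> - of_nat n)) ((f ^^ Suc n) v)
      + scale (\<mu> - 2 * of_nat (Suc n)) ((f ^^ Suc n) v) =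
      scale (of_nat (Suc (Suc n)) * (\<mu> - of_nat (Suc n))) ((f ^^ Suc n) v)"
    unfolding scale_left_distrib[symmetric] by (simp add: algebra_simps)
  finally show ?case .
qed

text \<open>By \<open>e_funpow_f\<close> each step contributes a factor
  \<open>(n + 1) * (2 * m - n)\<close>, which is nonzero for \<open>n < m\<close>. The weight
  \<open>2 * m\<close> is that of \<open>e^m v\<close> for a vector \<open>v\<close> of weight
  0.\<close>

lemma funpow_e_funpow_f:
  assumes "v \<in> S" "e v = 0" "h v = scale (2 * of_nat m) v" "n \<le> m"
  shows "\<exists>c. c \<noteq> 0 \<and> (e ^^ n) ((f ^^ n) v) = scale c v"
  using assms(4)
proof (induction n)
  case 0
  show ?case
    by (rule exI[of _ 1]) simp
next
  case (Suc n)
  then obtain c where c: "c \<noteq> 0" "(e ^^ n) ((f ^^ n) v) = scale c v"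
    by auto
  define d :: complex where "d = of_nat (Suc n) * (2 * of_nat m - of_nat n)"
  have "d = of_nat (Suc n) * of_nat (2 * m - n)"
    using Suc.prems by (simp add: d_def of_nat_diff)
  then have "d \<noteq> 0"
    using Suc.prems by (simp only: mult_eq_0_iff of_nat_eq_0_iff) simp
  moreover have "(e ^^ Suc n) ((f ^^ Suc n) v) = (e ^^ n) (e ((f ^^ Suc n) v))"
    by (simp only: funpow_Suc_right comp_def)
  then have "(e ^^ Suc n) ((f ^^ Suc n) v) = scale (d * c) v"
    by (simp only: e_funpow_f[OF assms(1-3)] funpow_e_scale c d_def[symmetric] scale_scale)
  ultimately show ?case
    using c(1) by (metis mult_eq_0_iff)
qed

text \<open>\<open>B_action\<close> says that \<open>sl2\<close> acts trivially on the quotient of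
  \<open>S\<close> by \<open>B\<close>, \<open>weights\<close> that \<open>h\<close> is
  diagonalizable on \<open>S\<close> with integer weights between \<open>- N\<close> and
  \<open>N\<close>.\<close>

context
  fixes B :: "'v set" and N :: nat
  assumes B: "subspace B"
    and B_action: "\<And>v. v \<in> S \<Longrightarrow> e v \<in> B" "\<And>v. v \<in> S \<Longrightarrow> f v \<in> B" "\<And>v. v \<in> S \<Longrightarrow> h v \<in> B"
    and weights: "\<And>v. v \<in> S \<Longrightarrow> h_shifts [- int N..int N] v = 0"
begin

lemma large_weight_zero:
  assumes "v \<in> S" "h v = scale (of_int m) v" "\<bar>m\<bar> > int N"
  shows "v = 0"
proof -
  have "(\<Prod>k\<leftarrow>[- int N..int N]. of_int m - of_int k :: complex) \<noteq> 0"
    unfolding prod_list_zero_iff using assms(3) by auto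
  then show ?thesis
    using weights[OF assms(1)] by (simp add: h_shifts_eigenvector[OF assms(2)])
qed

text \<open>Modulo \<open>B\<close> the operator \<open>h\<close> is 0, so the product of
  \<open>h - k\<close> over the nonzero \<open>k\<close> acts there as a nonzero scalar. On
  \<open>S\<close> one further factor \<open>h\<close> completes the annihilating polynomial, so the
  image of that product lies in the kernel of \<open>h\<close>.\<close>

lemma weight_zero_representative:
  assumes "v \<in> S"
  shows "\<exists>w\<in>S. v - w \<in> B \<and> h w = 0"
proof -
  have *: "h_shifts ks v \<in> S \<and> (\<exists>c. c \<noteq> 0 \<and> h_shifts ks v - scale c v \<in> B)" if "0 \<notin> set ks" for ks
    using that
  proof (induction ks)
    case Nil
    then show ?case
      using assms by (auto intro!: exI[of _ 1] simp: subspace_0[OF B])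
  next
    case (Cons k ks)
    let ?w = "h_shifts ks v"
    from Cons obtain c where w: "?w \<in> S" and c: "c \<noteq> 0" "?w - scale c v \<in> B"
      by auto
    have "h ?w - scale (of_int k) (?w - scale c v) \<in> B"
      using B_action(3)[OF w] c(2) B by (simp add: subspace_diff subspace_scale)
    moreover have "h ?w - scale (of_int k) (?w - scale c v) =
        h_shifts (k # ks) v - scale (- of_int k * c) v"
      by (simp add: scale_right_diff_distrib)
    moreover have "h_shifts (k # ks) v \<in> S"
      using S_closed(3)[OF w] w S by (simp add: subspace_diff subspace_scale)
    ultimately show ?case
      using c(1) Cons.prems by (intro conjI exI[of _ "- of_int k * c"]) auto
  qed
  define ks where "ks = [- int N..-1] @ [1..int N]"
  have "[- int N..int N] = [- int N..-1] @ 0 # [1..int N]"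
    using upto_split2[of "- int N" "-1" "int N"] upto_rec1[of 0 "int N"] by (cases "N = 0") simp_all
  then have "h (h_shifts ks v) = h_shifts [- int N..int N] v"
    by (simp add: ks_def h_shifts_append h_h_shifts)
  then have "h (h_shifts ks v) = 0"
    using weights assms by simp
  moreover have "0 \<notin> set ks"
    by (simp add: ks_def)
  then obtain c where c: "h_shifts ks v \<in> S" "c \<noteq> 0" "h_shifts ks v - scale c v \<in> B"
    using * by blast
  moreover have "scale (- 1 / c) (h_shifts ks v - scale c v) = v - scale (1 / c) (h_shifts ks v)"
    using c(2) by (simp add: scale_right_diff_distrib)
  then have "v - scale (1 / c) (h_shifts ks v) \<in> B"
    using c(3) subspace_scale[OF B] by metis
  ultimately show ?thesis
    using S by (intro bexI[of _ "scale (1 / c) (h_shifts ks v)"]) (simp_all add: h_scale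
        subspace_scale)
qed

text \<open>If \<open>n\<close> is the last exponent with \<open>e\<^sup>n v \<noteq> 0\<close>, a multiple of \<open>f\<^sup>n e\<^sup>n v\<close> can be subtracted from \<open>v\<close> to lower \<open>n\<close>.\<close>

lemma highest_weight_representative:
  assumes "v \<in> S" "h v = 0" "(e ^^ Suc n) v = 0"
  shows "\<exists>w\<in>S. v - w \<in> B \<and> h w = 0 \<and> e w = 0"
  using assms
proof (induction n arbitrary: v)
  case 0
  then show ?case
    using subspace_0[OF B] by (intro bexI[of _ v]) simp_all
next
  case (Suc n)
  define m u where "m = Suc n" and "u = (e ^^ m) v"
  have u: "u \<in> S" "e u = 0" "h u = scale (2 * of_nat m) u"
    using Suc.prems funpow_S(1)[of v m] h_funpow_e[of v 0 m] by (simp_all add: u_def m_def)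
  obtain c where c: "c \<noteq> 0" "(e ^^ m) ((f ^^ m) u) = scale c u"
    using funpow_e_funpow_f[OF u] by blast
  define w where "w = scale (1 / c) ((f ^^ m) u)"
  have "w \<in> S" "w \<in> B"
    using S B B_action(2) funpow_S(2)[OF u(1)] by (simp_all add: w_def subspace_scale m_def
        S_closed)
  moreover have "(e ^^ Suc n) (v - w) = 0"
    using c by (simp add: w_def funpow_e_diff funpow_e_scale u_def[symmetric] flip: m_def)
  moreover have "h (v - w) = 0"
    using h_funpow_f[OF u(1,3), of m] Suc.prems(2) by (simp add: h_diff w_def h_scale)
  ultimately obtain w' where w': "w' \<in> S" "v - w - w' \<in> B" "h w' = 0" "e w' = 0"
    using Suc.IH[of "v - w"] Suc.prems(1) subspace_diff[OF S] by blast
  moreover have "v - w' = (v - w - w') + w"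
    by simp
  then have "v - w' \<in> B"
    using w'(2) \<open>w \<in> B\<close> subspace_add[OF B] by metis
  ultimately show ?case
    by blast
qed

text \<open>Here \<open>f v\<close> is again killed by \<open>e\<close> and has weight -2. If it
  were nonzero, the factors \<open>(k + 1) * (- 2 - k)\<close> would keep its string under
  \<open>f\<close> from ever ending, against the bound on weights.\<close>

lemma highest_weight_zero_invariant:
  assumes "v \<in> S" "h v = 0" "e v = 0"
  shows "f v = 0"
proof (rule ccontr)
  assume *: "f v \<noteq> 0"
  have w: "f v \<in> S" "e (f v) = 0" "h (f v) = scale (- 2) (f v)"
    using assms by (simp_all add: S_closed e_f h_f f_0)
  have "(f ^^ N) (f v) = 0"
    using h_funpow_f[OF w(1,3), of N] assms(1) funpow_S(2) S_closed(2)
    by (intro large_weight_zero[of _ "- 2 - 2 * int N"]) auto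
  then obtain n where n: "(f ^^ n) (f v) = 0" "\<And>k. k < n \<Longrightarrow> (f ^^ k) (f v) \<noteq> 0"
    using exists_least_iff[of "\<lambda>n. (f ^^ n) (f v) = 0"] by auto
  then obtain k where k: "n = Suc k"
    using * by (cases n) auto
  have "scale (of_nat (Suc k) * (- 2 - of_nat k)) ((f ^^ k) (f v)) = 0"
    using e_funpow_f[OF w, of k] n(1) e_0 unfolding k by metis
  moreover have "of_nat (Suc k) * (- 2 - of_nat k) = - (of_nat (Suc k * (k + 2)) :: complex)"
    by (simp add: algebra_simps)
  then have "of_nat (Suc k) * (- 2 - of_nat k) \<noteq> (0 :: complex)"
    by (simp only: neg_equal_0_iff_equal of_nat_eq_0_iff) simp
  ultimately have "(f ^^ k) (f v) = 0"
    by (metis scale_eq_0_iff)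
  then show False
    using n(2)[of k] k by simp
qed

lemma invariant_representative:
  assumes "v \<in> S"
  shows "\<exists>w\<in>S. v - w \<in> B \<and> e w = 0 \<and> f w = 0 \<and> h w = 0"
proof -
  obtain w where w: "w \<in> S" "v - w \<in> B" "h w = 0"
    using weight_zero_representative[OF assms] by blast
  \<comment> \<open>This vector has weight \<open>2 * (N + 1)\<close>, beyond the bound
    \<open>N\<close>.\<close>
  have "(e ^^ Suc N) w = 0"
    using h_funpow_e[of w 0 "Suc N"] w funpow_S(1)
    by (intro large_weight_zero[of _ "2 * int (Suc N)"]) (auto simp del: funpow.simps)
  then obtain w' where w': "w' \<in> S" "w - w' \<in> B" "h w' = 0" "e w' = 0"
    using highest_weight_representative w by blast
  moreover have "v - w' = (v - w) + (w - w')"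
    by simp
  then have "v - w' \<in> B"
    using w(2) w'(2) subspace_add[OF B] by metis
  ultimately show ?thesis
    using highest_weight_zero_invariant by blast
qed

end

end

section \<open>Reduction to cocycles vanishing on \<open>sl2\<close>\<close>

lemma lie_minus_left: "lie (- x) y = - lie x (y :: 'a::complex_lie_algebra)"
  using lie_add_left[of "- x" x y] by (simp add: eq_neg_iff_add_eq_0)

lemma lie_minus_right: "lie x (- y) = - lie x (y :: 'a::complex_lie_algebra)"
  using lie_add_right[of x "- y" y] by (simp add: eq_neg_iff_add_eq_0)

lemma lie_diff_left: "lie (x - y) z = lie x z - lie y (z :: 'a::complex_lie_algebra)"
  using lie_add_left[of x "- y" z] by (simp add: lie_minus_left)

lemma lie_diff_right: "lie x (y - z) = lie x y - lie x (z :: 'a::complex_lie_algebra)"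
  using lie_add_right[of x y "- z"] by (simp add: lie_minus_right)

lemma lie_lie: "lie (lie x y) z = lie x (lie y z) - lie y (lie x (z :: 'a::complex_lie_algebra))"
  using jacobi[of x y z] lie_swap[of z "lie x y"] lie_swap[of z x]
  by (simp add: lie_minus_right algebra_simps)

lemma cochains1D:
  assumes "g \<in> cochains1"
  shows "g (x + y) = g x + g y" "g (scaleC c x) = scaleC c (g x)" "g 0 = 0" "g (- x) = - g x"
    "g (x - y) = g x - g y"
proof -
  show *: "g (x + y) = g x + g y" "g (scaleC c x) = scaleC c (g x)" for x y c
    using assms by (simp_all add: cochains1_def linear_scaleC_iff)
  show 0: "g 0 = 0"
    using *(1)[of 0 0] by simp
  show minus: "g (- x) = - g x" for x
    using *(2)[of "- 1" x] by simp
  show "g (x - y) = g x - g y"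
    using *(1)[of x "- y"] minus by simp
qed

lemma cochains1I:
  assumes "\<And>x y. g (x + y) = g x + g y" "\<And>c x. g (scaleC c x) = scaleC c (g x)"
  shows "g \<in> cochains1"
  using assms by (simp add: cochains1_def linear_scaleC_iff)

lemma cochains2I:
  assumes "\<And>x. f x \<in> cochains1" "\<And>y. (\<lambda>x. f x y) \<in> cochains1" "\<And>x. f x x = 0"
  shows "f \<in> cochains2"
  using assms by (simp add: cochains1_def cochains2_def)

lemma cochains2_right: "f \<in> cochains2 \<Longrightarrow> f x \<in> cochains1"
  by (simp add: cochains1_def cochains2_def)

lemma cochains2_left: "f \<in> cochains2 \<Longrightarrow> (\<lambda>x. f x y) \<in> cochains1"
  by (simp add: cochains1_def cochains2_def)

lemma cochains2_self: "f \<in> cochains2 \<Longrightarrow> f x x = 0"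
  by (simp add: cochains2_def)

lemmas cochains2D = cochains1D[OF cochains2_right] cochains1D[OF cochains2_left]

lemma cochains2_swap:
  assumes "f \<in> cochains2"
  shows "f x y = - f y x"
proof -
  have "f (x + y) (x + y) = (f x x + f y x) + (f x y + f y y)"
    by (simp only: cochains2D[OF assms])
  then have "f y x + f x y = 0"
    by (simp add: cochains2_self[OF assms])
  then show ?thesis
    by (metis add.commute eq_neg_iff_add_eq_0)
qed

lemma cocycles2_cochains: "f \<in> cocycles2 \<Longrightarrow> f \<in> cochains2"
  by (simp add: cocycles2_def)

lemma diff1_cocycle:
  assumes g: "g \<in> cochains1"
  shows "diff1 g \<in> cocycles2"
proof -
  have "diff1 g \<in> cochains2"
    by (intro cochains2I cochains1I)
      (simp_all add: diff1_def cochains1D[OF g] lie_algebra_simps cochains1D[OF g] lie_self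
          algebra_simps)
  moreover have "diff2 (diff1 g) x y z = 0" for x y z
  proof -
    have "lie z (lie x y) = lie y (lie x z) - lie x (lie y z)"
      using jacobi[of x y z] lie_swap[of z x] by (simp add: lie_minus_right algebra_simps)
    then show ?thesis
      unfolding diff2_def diff1_def
      by (simp add: lie_diff_right lie_diff_left lie_lie cochains1D[OF g] lie_swap[of z y]
          lie_swap[of z x]
          lie_swap[of y x] lie_minus_right lie_minus_left)
  qed
  ultimately show ?thesis
    by (simp add: cocycles2_def)
qed

lemma coboundaries2_subset: "coboundaries2 \<subseteq> cocycles2"
  by (auto simp: coboundaries2_def diff1_cocycle)

definition act :: "'a::complex_lie_algebra \<Rightarrow> ('a \<Rightarrow> 'a \<Rightarrow> 'a) \<Rightarrow> 'a \<Rightarrow> 'a \<Rightarrow> 'a" where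
  "act s f = (\<lambda>x y. lie s (f x y) - f (lie s x) y - f x (lie s y))"

text \<open>Cartan's homotopy formula: the action on a cocycle is the differential of a contraction.\<close>

lemma act_cocycle:
  assumes f: "f \<in> cocycles2"
  shows "act s f = diff1 (f s)"
proof (intro ext)
  fix x y
  note c = cocycles2_cochains[OF f]
  have "diff2 f s x y = 0"
    using f by (simp add: cocycles2_def)
  then show "act s f x y = diff1 (f s) x y"
    using cochains2_swap[OF c, of "lie s y" x] cochains2_swap[OF c, of "lie x y" s]
    by (simp add: act_def diff1_def diff2_def algebra_simps)
qed

lemma act_coboundary: "f \<in> cocycles2 \<Longrightarrow> act s f \<in> coboundaries2"
  unfolding act_cocycle by (simp add: coboundaries2_def cochains2_right cocycles2_cochains)

lemma act_lie:
  assumes f: "f \<in> cochains2"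
  shows "act (lie s t) f = (\<lambda>x y. act s (act t f) x y - act t (act s f) x y)"
  by (simp add: act_def fun_eq_iff lie_lie lie_diff_right cochains2D[OF f])

lemma act_scaleC:
  assumes f: "f \<in> cochains2"
  shows "act (scaleC c s) f = (\<lambda>x y. scaleC c (act s f x y))"
  by (simp add: act_def fun_eq_iff lie_scaleC_left cochains2D[OF f] scaleC.scale_right_diff_distrib)

lemma cochains2_eqI:
  fixes f g :: "sl2_gn \<Rightarrow> sl2_gn \<Rightarrow> sl2_gn"
  assumes f: "f \<in> cochains2" and g: "g \<in> cochains2"
    and "\<And>t i u j. idx t i \<Longrightarrow> idx u j \<Longrightarrow> f (base t i) (base u j) = g (base t i) (base u j)"
  shows "f = g"
proof (intro ext)
  fix x y
  have *: "f (base t i) y = g (base t i) y" if "idx t i" for t i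
    by (rule linear_eqI[where s = scaleC and p = "f (base t i)" and q = "g (base t i)"])
      (simp_all only: cochains2D[OF f] cochains2D[OF g] assms(3) that)
  show "f x y = g x y"
    by (rule linear_eqI[where s = scaleC and p = "\<lambda>x. f x y" and q = "\<lambda>x. g x y"])
      (simp_all only: cochains2D[OF f] cochains2D[OF g] *)
qed

lemma bracket_S2:
  "bracket_comp S2 u = u" "bracket_shift S2 u = 1"
  "bracket_coeff S2 u i j = of_int (hw u) * of_int (i - 1) / 2 - of_int (j - 1)"
  by (simp_all add: bracket_defs)

lemma coord_lie_S2:
  assumes "idx S2 i"
  shows "coord w k (lie (base S2 i) v) = (if idx w k
    then (of_int (hw w) * of_int (i - 1) / 2 - of_int (k + 1 - i)) * coord w (k + 2 - i) v else 0)"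
proof -
  have "coord w k (lie (base S2 i) v) = (if idx w k
      then \<Sum>u\<in>UNIV. if u = w
        then (of_int (hw w) * of_int (i - 1) / 2 - of_int (k + 1 - i)) * coord w (k + 2 - i) v
            else 0
      else 0)"
    unfolding coord_lie[OF assms] by (intro if_cong refl sum.cong) (auto simp: bracket_S2
        algebra_simps)
  then show ?thesis
    by simp
qed

abbreviation sl2_e :: sl2_gn where "sl2_e \<equiv> scaleC (- 1) (base S2 1)"
abbreviation sl2_f :: sl2_gn where "sl2_f \<equiv> base S2 3"
abbreviation sl2_h :: sl2_gn where "sl2_h \<equiv> scaleC 2 (base S2 2)"

lemma sl2_relations:
  "lie sl2_h sl2_e = scaleC 2 sl2_e" "lie sl2_h sl2_f = scaleC (- 2) sl2_f" "lie sl2_e sl2_f =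
      sl2_h"
  by (simp_all add: lie_scaleC_left lie_scaleC_right lie_minus_left lie_minus_right lie_base_S2)

lemma coord_lie_h: "coord w k (lie sl2_h v) = of_int (hw w + 2 - 2 * k) * coord w k v"
  using coord_out[of k w v]
  by (cases "idx w k") (auto simp: lie_scaleC_left coord_scaleC coord_lie_S2 field_simps)

lemma lie_h_base: "lie sl2_h (base t i) = scaleC (of_int (hw t + 2 - 2 * i)) (base t i)"
proof (cases "idx t i")
  case True
  have "lie sl2_h (base t i) = scaleC (2 * (of_int (hw t) / 2 - of_int (i - 1))) (base t i)"
    using True by (simp add: lie_scaleC_left lie_base_S2 scaleC_scaleC)
  also have "2 * (of_int (hw t) / 2 - of_int (i - 1)) = (of_int (hw t + 2 - 2 * i) :: complex)"
    by simp
  finally show ?thesis .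
qed (simp add: base_out)

definition scale_cochain :: "complex \<Rightarrow> ('a::complex_lie_algebra \<Rightarrow> 'a \<Rightarrow> 'a) \<Rightarrow> 'a \<Rightarrow> 'a \<Rightarrow> 'a" where
  "scale_cochain c f = (\<lambda>x y. scaleC c (f x y))"

interpretation cochain: vector_space scale_cochain
  by unfold_locales
    (simp_all add: scale_cochain_def fun_eq_iff scaleC.scale_right_distrib
        scaleC.scale_left_distrib)

lemma subspace_cocycles2: "cochain.subspace cocycles2"
  using cocycles2_zero cocycles2_add cocycles2_scaleC
  by (auto simp: cochain.subspace_def scale_cochain_def zero_fun_def plus_fun_def)

lemma subspace_coboundaries2: "cochain.subspace coboundaries2"
  using coboundaries2_zero coboundaries2_add coboundaries2_scaleC
  by (auto simp: cochain.subspace_def scale_cochain_def zero_fun_def plus_fun_def)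

lemma act_add: "act s (f + g) = act s f + act s g"
proof (intro ext)
  fix x y
  show "act s (f + g) x y = (act s f + act s g) x y"
    by (simp only: act_def plus_fun_apply lie_add_right) simp
qed

lemma act_scale: "act s (scale_cochain c f) = scale_cochain c (act s f)"
  by (simp only: act_def scale_cochain_def lie_scaleC_right scaleC.scale_right_diff_distrib)

interpretation cocycle_module: sl2_module scale_cochain "cocycles2 :: (sl2_gn \<Rightarrow> sl2_gn \<Rightarrow> sl2_gn)
    set"
  "act sl2_e" "act sl2_f" "act sl2_h"
proof unfold_locales
  show "cochain.subspace cocycles2"
    by (rule subspace_cocycles2)
next
  fix f :: "sl2_gn \<Rightarrow> sl2_gn \<Rightarrow> sl2_gn" and s
  assume f: "f \<in> cocycles2"
  show "act sl2_e f \<in> cocycles2" "act sl2_f f \<in> cocycles2" "act sl2_h f \<in> cocycles2"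
    using act_coboundary[OF f] coboundaries2_subset by blast+
  note c = cocycles2_cochains[OF f]
  have transpose: "a = b + d" if "d = a - b" for a b d :: sl2_gn
    using that by simp
  have "act sl2_h (act sl2_e f) x y = act sl2_e (act sl2_h f) x y + scaleC 2 (act sl2_e f x y)"
      for x y
    using fun_cong[OF fun_cong[OF act_lie[OF c, of sl2_h sl2_e]], of x y]
    unfolding sl2_relations act_scaleC[OF c, of 2 sl2_e] by (rule transpose)
  then show "act sl2_h (act sl2_e f) = act sl2_e (act sl2_h f) + scale_cochain 2 (act sl2_e f)"
    by (simp only: scale_cochain_def fun_eq_iff plus_fun_apply simp_thms)
  have "act sl2_h (act sl2_f f) x y = act sl2_f (act sl2_h f) x y + scaleC (- 2) (act sl2_f f x
      y)" for x y
    using fun_cong[OF fun_cong[OF act_lie[OF c, of sl2_h sl2_f]], of x y]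
    unfolding sl2_relations act_scaleC[OF c, of "- 2" sl2_f] by (rule transpose)
  then show "act sl2_h (act sl2_f f) = act sl2_f (act sl2_h f) - scale_cochain 2 (act sl2_f f)"
    by (simp only: scale_cochain_def fun_eq_iff minus_apply scaleC.scale_minus_left
        add_uminus_conv_diff simp_thms)
  have "act sl2_e (act sl2_f f) x y = act sl2_f (act sl2_e f) x y + act sl2_h f x y" for x y
    using fun_cong[OF fun_cong[OF act_lie[OF c, of sl2_e sl2_f]], of x y]
    unfolding sl2_relations by (rule transpose)
  then show "act sl2_e (act sl2_f f) = act sl2_f (act sl2_e f) + act sl2_h f"
    by (simp only: fun_eq_iff plus_fun_apply simp_thms)
qed (rule act_add act_scale)+

text \<open>On a cochain \<open>h\<close> multiplies each coordinate by the weight of the value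
  minus the weights of the two arguments. Each of these three weights lies between -5 and 5, whence
  the bound 15.\<close>

lemma cocycle_weights:
  fixes f :: "sl2_gn \<Rightarrow> sl2_gn \<Rightarrow> sl2_gn"
  assumes f: "f \<in> cocycles2"
  shows "cocycle_module.h_shifts [- int 15..int 15] f = 0"
proof -
  have S: "cocycle_module.h_shifts ks f \<in> cocycles2" for ks
  proof (induction ks)
    case (Cons k ks)
    then show ?case
      unfolding cocycle_module.h_shifts_simps by (intro cochain.subspace_diff[OF subspace_cocycles2]
        cochain.subspace_scale[OF subspace_cocycles2] cocycle_module.S_closed(3))
  qed (simp add: f)
  have *: "coord w k (cocycle_module.h_shifts ks f (base t i) (base u j)) =
      (\<Prod>l\<leftarrow>ks. of_int (hw w + 2 - 2 * k - (hw t + 2 - 2 * i) - (hw u + 2 - 2 * j) - l))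
        * coord w k (f (base t i) (base u j))" for ks t i u j w k
  proof (induction ks)
    case (Cons l ks)
    define F where "F = cocycle_module.h_shifts ks f"
    have F: "F \<in> cochains2"
      unfolding F_def by (rule cocycles2_cochains[OF S])
    have "coord w k (act sl2_h F (base t i) (base u j)) =
        of_int (hw w + 2 - 2 * k - (hw t + 2 - 2 * i) - (hw u + 2 - 2 * j)) * coord w k (F (base t
            i) (base u j))"
      unfolding act_def lie_h_base coord_diff coord_lie_h cochains2D[OF F] coord_scaleC
      by (simp add: algebra_simps)
    then have "coord w k (cocycle_module.h_shifts (l # ks) f (base t i) (base u j)) =
        of_int (hw w + 2 - 2 * k - (hw t + 2 - 2 * i) - (hw u + 2 - 2 * j) - l)
          * coord w k (F (base t i) (base u j))"
      by (simp add: F_def[symmetric] coord_diff scale_cochain_def coord_scaleC algebra_simps)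
    then show ?case
      using Cons.IH by (simp add: F_def)
  qed simp
  have "cocycle_module.h_shifts [- int 15..int 15] f = (\<lambda>x y. 0)"
  proof (rule cochains2_eqI)
    show "cocycle_module.h_shifts [- int 15..int 15] f \<in> cochains2" "(\<lambda>x y. 0) \<in> cochains2"
      using S cocycles2_zero cocycles2_cochains by blast+
    fix t i u j assume tu: "idx t i" "idx u j"
    have hw_le: "hw w \<le> 5" for w
      by (cases w) auto
    show "cocycle_module.h_shifts [- int 15..int 15] f (base t i) (base u j) = 0"
    proof (rule coord_ext)
      fix w k assume w: "idx w k"
      define l where "l = hw w + 2 - 2 * k - (hw t + 2 - 2 * i) - (hw u + 2 - 2 * j)"
      have "l \<in> {- 15..15}"
        using tu w hw_le[of t] hw_le[of u] hw_le[of w] by (simp add: l_def)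
      then have 0: "(\<Prod>m\<leftarrow>[- int 15..int 15]. of_int (l - m) :: complex) = 0"
        unfolding prod_list_zero_iff set_map set_upto by (intro image_eqI[of _ _ l]) simp_all
      show "coord w k (cocycle_module.h_shifts [- int 15..int 15] f (base t i) (base u j)) = coord
          w k 0"
        unfolding * l_def[symmetric] 0 coord_0 by (rule mult_zero_left)
    qed
  qed
  then show ?thesis
    by (simp only: zero_fun_def)
qed

lemma invariant_representative:
  fixes f :: "sl2_gn \<Rightarrow> sl2_gn \<Rightarrow> sl2_gn"
  assumes "f \<in> cocycles2"
  shows "\<exists>g\<in>cocycles2. f - g \<in> coboundaries2 \<and> (\<forall>i. act (base S2 i) g = 0)"
proof -
  have "\<exists>g\<in>cocycles2. f - g \<in> coboundaries2 \<and>
      act sl2_e g = 0 \<and> act sl2_f g = 0 \<and> act sl2_h g = 0"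
    by (rule cocycle_module.invariant_representative[OF subspace_coboundaries2 act_coboundary
        act_coboundary
        act_coboundary cocycle_weights assms])
  then obtain g where g: "g \<in> cocycles2" "f - g \<in> coboundaries2"
    "act sl2_e g = 0" "act sl2_f g = 0" "act sl2_h g = 0"
    by (elim bexE conjE)
  have "act (base S2 i) g = 0" if "idx S2 i" for i
  proof -
    have "scaleC (- 1) sl2_e = base S2 1" "scaleC (1 / 2) sl2_h = base S2 2"
      unfolding scaleC_scaleC by (simp_all only: mult_minus1 minus_minus scaleC_one) (simp add:
          scaleC_one)
    then have "act (base S2 1) g = (\<lambda>x y. scaleC (- 1) (act sl2_e g x y))"
      "act (base S2 2) g = (\<lambda>x y. scaleC (1 / 2) (act sl2_h g x y))"
      using act_scaleC[OF cocycles2_cochains[OF g(1)]] by metis+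
    then have "act (base S2 1) g = 0" "act (base S2 2) g = 0"
      by (simp_all only: g(3,5) zero_fun_def scaleC.scale_zero_right)
    moreover have "i = 1 \<or> i = 2 \<or> i = 3"
      using that by auto
    ultimately show ?thesis
      using g(4) by auto
  qed
  moreover have "act (base S2 i) g = 0" if "\<not> idx S2 i" for i
    by (simp add: base_out[OF that] act_def fun_eq_iff cochains2D[OF cocycles2_cochains[OF g(1)]])
  ultimately have "act (base S2 i) g = 0" for i
    by (cases "idx S2 i") simp_all
  then show ?thesis
    using g(1,2) by (intro bexI[of _ g] conjI allI)
qed

text \<open>For an invariant \<open>F\<close> the map \<open>g\<close> with
  \<open>g [s, t] = F s t\<close> on \<open>sl2\<close>, extended by 0, is equivariant and satisfies
  \<open>F s y = [g s, y]\<close>. Equivariance then reduces \<open>diff1 g s y\<close> to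
  \<open>[g s, y]\<close>, so \<open>F - diff1 g\<close> vanishes as required.\<close>

lemma sl2_relative_representative:
  fixes f :: "sl2_gn \<Rightarrow> sl2_gn \<Rightarrow> sl2_gn"
  assumes "f \<in> cocycles2"
  shows "\<exists>g\<in>cocycles2. f - g \<in> coboundaries2 \<and> (\<forall>i y. g (base S2 i) y = 0)"
proof -
  obtain F where F: "F \<in> cocycles2" "f - F \<in> coboundaries2" and "\<forall>i. act (base S2 i) F = 0"
    using invariant_representative[OF assms] by blast
  then have inv: "lie (base S2 i) (F x y) = F (lie (base S2 i) x) y + F x (lie (base S2 i) y)" for
      i x y
    by (simp add: act_def fun_eq_iff algebra_simps)
  note c = cocycles2_cochains[OF F(1)]
  \<comment> \<open>Invariance replaces the two outer brackets with \<open>sl2\<close> in the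
    cocycle identity; all terms but these two cancel.\<close>
  have inner: "F (lie (base S2 i) (base S2 j)) y = lie (F (base S2 i) (base S2 j)) y" for i j y
  proof -
    have "diff2 F (base S2 i) (base S2 j) y = 0"
      using F(1) by (simp add: cocycles2_def)
    then show ?thesis
      using inv[of i "base S2 j" y] inv[of j "base S2 i" y]
        cochains2_swap[OF c, of "base S2 j" "lie (base S2 i) y"]
        cochains2_swap[OF c, of "base S2 i" "lie (base S2 j) y"]
        lie_swap[of y "F (base S2 i) (base S2 j)"] lie_swap[of "base S2 j" "base S2 i"]
      by (simp add: diff2_def cochains2D[OF c] algebra_simps)
  qed
  \<comment> \<open>With \<open>b_i = base S2 i\<close> the brackets are
    \<open>[b_1, b_2] = - b_1\<close>, \<open>[b_1, b_3] = - 2 b_2\<close> and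
    \<open>[b_2, b_3] = - b_3\<close>, which gives the factors \<open>- 1\<close>,
    \<open>- 1 / 2\<close> and \<open>- 1\<close>.\<close>
  define g where "g v = scaleC (coord S2 1 v) (- F (base S2 1) (base S2 2))
      + scaleC (coord S2 2 v) (scaleC (- 1 / 2) (F (base S2 1) (base S2 3)))
      + scaleC (coord S2 3 v) (- F (base S2 2) (base S2 3))" for v
  have g: "g \<in> cochains1"
    by (rule cochains1I) (simp_all add: g_def coord_simps lie_algebra_simps
        scaleC.scale_left_distrib add_divide_distrib)
  have idx3: "i = 1 \<or> i = 2 \<or> i = 3" if "idx S2 i" for i
    using that by auto
  have gF: "g (lie (base S2 i) (base S2 j)) = F (base S2 i) (base S2 j)" if "idx S2 i" "idx S2 j"
      for i j
    using idx3[OF that(1)] idx3[OF that(2)] cochains2_swap[OF c, of "base S2 2" "base S2 1"]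
      cochains2_swap[OF c, of "base S2 3" "base S2 1"] cochains2_swap[OF c, of "base S2 3" "base
          S2 2"]
    by (elim disjE) (simp_all add: lie_base_S2 g_def coord_simps coord_base cochains2_self[OF c])
  have gS: "F (base S2 i) y = lie (g (base S2 i)) y" if "idx S2 i" for i y
  proof -
    have b: "scaleC (- 1) (lie (base S2 1) (base S2 2)) = base S2 1"
      "scaleC (- 1 / 2) (lie (base S2 1) (base S2 3)) = base S2 2"
      "scaleC (- 1) (lie (base S2 2) (base S2 3)) = base S2 3"
      by (simp_all add: lie_base_S2)
    have gb: "g (base S2 1) = scaleC (- 1) (F (base S2 1) (base S2 2))"
      "g (base S2 2) = scaleC (- 1 / 2) (F (base S2 1) (base S2 3))"
      "g (base S2 3) = scaleC (- 1) (F (base S2 2) (base S2 3))"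
      by (simp_all add: g_def coord_base)
    have "F (scaleC d (lie (base S2 k) (base S2 l))) y = lie (scaleC d (F (base S2 k) (base S2
        l))) y"
      for d k l
      by (simp only: cochains2D[OF c] inner lie_scaleC_left)
    from this[of "- 1" 1 2] this[of "- 1 / 2" 1 3] this[of "- 1" 2 3]
    have "F (base S2 1) y = lie (g (base S2 1)) y" "F (base S2 2) y = lie (g (base S2 2)) y"
      "F (base S2 3) y = lie (g (base S2 3)) y"
      unfolding b gb .
    then show ?thesis
      using idx3[OF that] by auto
  qed
  have equiv: "g (lie (base S2 i) y) = lie (base S2 i) (g y)" if i: "idx S2 i" for i y
  proof (rule linear_eqI[where s = scaleC and p = "\<lambda>y. g (lie (base S2 i) y)" and q = "\<lambda>y. lie
      (base S2 i) (g y)"])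
    fix t j assume j: "idx t j"
    show "g (lie (base S2 i) (base t j)) = lie (base S2 i) (g (base t j))"
    proof (cases "t = S2")
      case True
      then have "g (lie (base S2 i) (base t j)) = - F (base S2 j) (base S2 i)"
        using gF i j cochains2_swap[OF c] by metis
      also have "\<dots> = lie (base S2 i) (g (base t j))"
        using gS[of j "base S2 i"] lie_swap[of "base S2 i"] True j by metis
      finally show ?thesis .
    next
      case False
      then show ?thesis
        using i j by (simp add: lie_base_S2 g_def coord_simps coord_base)
    qed
  qed (simp_all add: cochains1D[OF g] lie_algebra_simps)
  have "(F - diff1 g) (base S2 i) y = 0" for i y
  proof (cases "idx S2 i")
    case True
    then show ?thesis
      using gS[OF True, of y] equiv[OF True, of y] lie_swap[of y "g (base S2 i)"] by (simp add:
          diff1_def)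
  next
    case False
    then show ?thesis
      by (simp add: base_out diff1_def cochains2D[OF c] cochains1D[OF g])
  qed
  moreover have "F - diff1 g \<in> cocycles2"
    using F(1) diff1_cocycle[OF g] cochain.subspace_diff[OF subspace_cocycles2] by blast
  moreover have "f - (F - diff1 g) = (f - F) + diff1 g"
    by simp
  then have "f - (F - diff1 g) \<in> coboundaries2"
    using F(2) g cochain.subspace_add[OF subspace_coboundaries2] coboundaries2I by metis
  ultimately show ?thesis
    by blast
qed

section \<open>Components of an equivariant cocycle\<close>

lemma bracket_coord_simps: "bracket_comp t u = fst (bracket_table t u)"
  "bracket_shift t u = fst (snd (bracket_table t u))" "bracket_coeff t u = snd (snd (bracket_table
      t u))"
  by (simp_all add: bracket_defs)

locale relative_cocycle =
  fixes f :: "sl2_gn \<Rightarrow> sl2_gn \<Rightarrow> sl2_gn"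
  assumes cocycle: "f \<in> cocycles2" and S2_left: "f (base S2 i) y = 0"
begin

lemmas cochain = cocycles2_cochains[OF cocycle]
lemmas f_linear = cochains2D[OF cochain]
lemmas f_self = cochains2_self[OF cochain]
lemmas f_swap = cochains2_swap[OF cochain]

lemma swap: "f (base t a) (base u b) = - f (base u b) (base t a)"
  by (rule f_swap)

lemma S2_right: "f y (base S2 i) = 0"
  using f_swap[of y] S2_left by simp

lemma equivariant:
  "lie (base S2 i) (f x y) = f (lie (base S2 i) x) y + f x (lie (base S2 i) y)"
proof -
  have "diff2 f (base S2 i) x y = 0"
    using cocycle by (simp add: cocycles2_def)
  then show ?thesis
    using f_swap[of "lie (base S2 i) y" x] by (simp add: diff2_def S2_left S2_right algebra_simps)
qed

section \<open>Coordinates of an equivariant bilinear map\<close>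

lemma coord_equivariant:
  assumes "idx S2 i" "idx t a" "idx u b" "idx w k"
  shows "(of_int (hw w) * of_int (i - 1) / 2 - of_int (k + 1 - i)) *
      coord w (k + 2 - i) (f (base t a) (base u b)) =
    (of_int (hw t) * of_int (i - 1) / 2 - of_int (a - 1)) * coord w k (f (base t (i + a - 2))
        (base u b)) +
    (of_int (hw u) * of_int (i - 1) / 2 - of_int (b - 1)) * coord w k (f (base t a) (base u (i + b
        - 2)))"
  using arg_cong[OF equivariant[of i "base t a" "base u b"], of "coord w k"] assms
  by (simp only: coord_lie_S2 lie_base_S2 f_linear coord_simps simp_thms if_True)

lemma weight_zero:
  assumes "hw t + hw u - 2 * a - 2 * b + 2 \<noteq> hw w - 2 * k"
  shows "coord w k (f (base t a) (base u b)) = 0"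
proof (cases "idx t a \<and> idx u b \<and> idx w k")
  case True
  define c where "c = coord w k (f (base t a) (base u b))"
  have "(of_int (hw w) / 2 - of_int (k - 1)) * c =
      (of_int (hw t) / 2 - of_int (a - 1)) * c + (of_int (hw u) / 2 - of_int (b - 1)) * c"
    using coord_equivariant[of 2 a t b u k w] True by (simp add: c_def)
  moreover have "of_int (hw t + hw u - 2 * a - 2 * b + 2 - (hw w - 2 * k)) * c =
      2 * ((of_int (hw t) / 2 - of_int (a - 1)) * c + (of_int (hw u) / 2 - of_int (b - 1)) * c
        - (of_int (hw w) / 2 - of_int (k - 1)) * c)"
    by (simp add: algebra_simps)
  ultimately have "of_int (hw t + hw u - 2 * a - 2 * b + 2 - (hw w - 2 * k)) * c = 0"
    by simp
  then show ?thesis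
    unfolding mult_eq_0_iff of_int_eq_0_iff using assms by (simp add: c_def)
next
  case False
  then show ?thesis
    by (auto simp: base_out coord_out f_linear coord_0)
qed

lemma raise:
  assumes "idx t a" "idx u b" "idx w k"
  shows "of_int k * coord w (k + 1) (f (base t a) (base u b)) =
    of_int (a - 1) * coord w k (f (base t (a - 1)) (base u b)) +
    of_int (b - 1) * coord w k (f (base t a) (base u (b - 1)))"
  using coord_equivariant[of 1 a t b u k w] assms by (simp add: algebra_simps)

text \<open>Nothing is lowered onto a highest weight vector: the coordinate at \<open>w 1\<close> of
  a bracket with \<open>f\<close> is 0.\<close>

lemma lower:
  assumes "idx t a" "idx u b"
  shows "of_int (hw t + 1 - a) * coord w 1 (f (base t (a + 1)) (base u b)) +
    of_int (hw u + 1 - b) * coord w 1 (f (base t a) (base u (b + 1))) = 0"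
proof -
  have "idx w 1"
    by (cases w) auto
  then show ?thesis
    using coord_equivariant[of 3 a t b u 1 w] assms by (simp add: coord_out algebra_simps)
qed

definition vanishing :: "comp \<Rightarrow> comp \<Rightarrow> comp \<Rightarrow> bool" where
  "vanishing t u w \<longleftrightarrow> (\<forall>a b k. coord w k (f (base t a) (base u b)) = 0)"

lemma vanishingD:
  assumes "vanishing t u w"
  shows "coord w k (f (base t a) (base u b)) = 0" "coord w k (f (base u b) (base t a)) = 0"
  using assms f_swap[of "base u b"] by (simp_all add: vanishing_def coord_minus)

lemma vanishing_swap: "vanishing t u w \<Longrightarrow> vanishing u t w"
  unfolding vanishing_def[of u] by (simp add: vanishingD)

text \<open>At the coordinate 1, \<open>lower\<close> passes from \<open>t 1\<close> to every
  \<open>t a\<close>; then \<open>raise\<close> passes to every coordinate. The factors divided by,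
  \<open>hw t - n\<close> and \<open>n + 1\<close>, are nonzero within the ranges.\<close>

lemma vanishing_from_top:
  assumes top: "\<And>b. idx u b \<Longrightarrow> coord w 1 (f (base t 1) (base u b)) = 0"
  shows "vanishing t u w"
proof -
  have top': "coord w 1 (f (base t (int n + 1)) (base u b)) = 0" for n b
  proof (induction n arbitrary: b)
    case 0
    then show ?case
      using top by (cases "idx u b") (auto simp: base_out f_linear coord_0)
  next
    case (Suc n)
    show ?case
    proof (cases "idx u b \<and> idx t (int n + 2)")
      case True
      then have "of_int (hw t - int n) * coord w 1 (f (base t (int n + 2)) (base u b)) = 0"
        using lower[of "int n + 1" t b u w] Suc.IH by (simp add: algebra_simps)
      moreover have "hw t - int n \<noteq> 0"
        using True by auto
      then have "of_int (hw t - int n) \<noteq> (0 :: complex)"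
        unfolding of_int_eq_0_iff .
      ultimately show ?thesis
        by (simp add: algebra_simps)
    next
      case False
      then show ?thesis
        by (auto simp: base_out f_linear coord_0 algebra_simps)
    qed
  qed
  have "coord w (int n + 1) (f (base t a) (base u b)) = 0" for n a b
  proof (induction n arbitrary: a b)
    case 0
    then show ?case
      using top'[of "nat (a - 1)" b] by (cases "idx t a") (auto simp: base_out f_linear coord_0)
  next
    case (Suc n)
    show ?case
    proof (cases "idx t a \<and> idx u b \<and> idx w (int n + 1)")
      case True
      then have "of_int (int n + 1) * coord w (int n + 1 + 1) (f (base t a) (base u b)) = 0"
        using raise[of a t b u "int n + 1" w] Suc.IH by simp
      moreover have "of_int (int n + 1) \<noteq> (0 :: complex)"
        unfolding of_int_eq_0_iff by simp
      ultimately have "coord w (int n + 1 + 1) (f (base t a) (base u b)) = 0"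
        by (metis mult_eq_0_iff)
      then show ?thesis
        by (simp add: algebra_simps)
    next
      case False
      then show ?thesis
        by (auto simp: base_out coord_out f_linear coord_0)
    qed
  qed
  then have "coord w k (f (base t a) (base u b)) = 0" if "idx w k" for a b k
    using that by (metis (no_types) diff_add_cancel diff_ge_0_iff_ge int_nat_eq)
  then show ?thesis
    unfolding vanishing_def using coord_out by metis
qed

lemma vanishingI:
  assumes "coord w 1 (f (base t 1) (base u b)) = 0" "hw t + hw u + 2 = hw w + 2 * b"
  shows "vanishing t u w"
proof (rule vanishing_from_top)
  fix b'
  show "coord w 1 (f (base t 1) (base u b')) = 0"
    using assms weight_zero[of t u 1 b' w 1] by (cases "b' = b") auto
qed

text \<open>The Clebsch-Gordan condition. Outside it no \<open>b\<close> in range has the weight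
  needed for a value at \<open>(t 1, u b)\<close> with a nonzero coordinate at \<open>w 1\<close>;
  one inequality is obtained by exchanging \<open>t\<close> and \<open>u\<close>.\<close>

lemma vanishing_range:
  assumes "hw w > hw t + hw u \<or> hw w < hw t - hw u \<or> hw w < hw u - hw t \<or> odd (hw t + hw u + hw w)"
  shows "vanishing t u w"
proof -
  have *: "vanishing t u w" if "hw w > hw t + hw u \<or> hw w < hw t - hw u \<or> odd (hw t + hw u + hw
      w)" for t u
  proof (rule vanishing_from_top)
    fix b assume "idx u b"
    then have "hw t + hw u - 2 * 1 - 2 * b + 2 \<noteq> hw w - 2 * 1"
      using that by presburger
    then show "coord w 1 (f (base t 1) (base u b)) = 0"
      by (rule weight_zero)
  qed
  show ?thesis
    using assms *[of t u] *[of u t] vanishing_swap[of u t w] by (auto simp: add.commute)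
qed

lemma cocycle_equation:
  assumes "idx t a" "idx u b" "idx v c"
  shows "coord w k (lie (base t a) (f (base u b) (base v c))) - coord w k (lie (base u b) (f (base
      t a) (base v c)))
    + coord w k (lie (base v c) (f (base t a) (base u b)))
    - bracket_coeff t u a b * coord w k (f (base (bracket_comp t u) (a + b - 1 - bracket_shift t
        u)) (base v c))
    + bracket_coeff t v a c * coord w k (f (base (bracket_comp t v) (a + c - 1 - bracket_shift t
        v)) (base u b))
    - bracket_coeff u v b c * coord w k (f (base (bracket_comp u v) (b + c - 1 - bracket_shift u
        v)) (base t a)) = 0"
proof -
  have "diff2 f (base t a) (base u b) (base v c) = 0"
    using cocycle by (simp add: cocycles2_def)
  from arg_cong[OF this, of "coord w k"] show ?thesis
    using assms by (simp only: diff2_def lie_base f_linear coord_simps)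
qed

lemmas equation_simps = bracket_coord_simps coord_lie sum_comp S2_left S2_right f_self f_linear
    coord_simps coord_out

end

section \<open>Normalized cocycles\<close>

text \<open>The component \<open>t \<otimes> u \<rightarrow> w\<close> of an equivariant map is determined by the coordinate at \<open>w\<^sub>1\<close> of the value
  at \<open>(t\<^sub>1, u\<^sub>b)\<close>, where weights force \<open>b\<close>.  The equivariant endomorphisms of \<open>L\<close>
  that vanish on \<open>sl2\<close> form a space of dimension 19, so together with the two nontrivial cocycles
  21 entries can be normalized.\<close>

definition normal_entries :: "(comp \<times> comp \<times> int \<times> comp) list" where
  "normal_entries =
    [(X1, X1, 2, C0), (X1, Y1, 1, Z2), (X1, Y1, 1, S2), (X1, Z2, 1, X3), (Y1, Z2, 1, Y3),
     (X1, X3, 1, X4), (X1, X3, 1, Y4), (Y1, Y3, 1, Y4), (Y1, Y3, 1, X4), (Y1, Y4, 1, Y5),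
     (X1, X4, 1, X5), (Y1, X4, 1, Y5), (X1, Z2, 1, Y3), (Y1, Z2, 1, X3), (X1, X4, 1, Y5),
     (Y1, X4, 1, X5), (X1, Y3, 1, Y4), (Y1, X3, 1, X4), (X1, Y1, 2, C0), (Y1, Y1, 2, C0),
     (X1, Y5, 2, Y4)]"

definition normalized :: "(sl2_gn \<Rightarrow> sl2_gn \<Rightarrow> sl2_gn) \<Rightarrow> bool" where
  "normalized f \<longleftrightarrow>
     (\<forall>(t, u, b, w)\<in>set normal_entries. coord w 1 (f (base t 1) (base u b)) = 0)"

context relative_cocycle
begin

text \<open>In most steps the chosen cocycle equation involves a single component that is not yet known to
  vanish, and that one only through its determining coordinate.\<close>

lemma normalized_vanishing:
  assumes "normalized f"
  shows "vanishing X1 t w" "vanishing Y1 t w"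
proof -
  have entry: "vanishing t u w" if "(t, u, b, w) \<in> set normal_entries" "hw t + hw u + 2 = hw w + 2
      * b" for t u b w
    using assms that by (intro vanishingI[of w t u b]) (auto simp: normalized_def)
  have [simp]: "vanishing X1 X1 C0" "vanishing X1 Y1 Z2" "vanishing X1 Y1 S2" "vanishing X1 Z2 X3"
      "vanishing Y1 Z2 Y3" "vanishing X1 X3 X4" "vanishing X1 X3 Y4" "vanishing Y1 Y3 Y4"
      "vanishing Y1 Y3 X4" "vanishing Y1 Y4 Y5" "vanishing X1 X4 X5" "vanishing Y1 X4 Y5"
      "vanishing X1 Z2 Y3" "vanishing Y1 Z2 X3" "vanishing X1 X4 Y5" "vanishing Y1 X4 X5"
      "vanishing X1 Y3 Y4" "vanishing Y1 X3 X4" "vanishing X1 Y1 C0" "vanishing Y1 Y1 C0"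
      "vanishing X1 Y5 Y4"
    by (rule entry, simp add: normal_entries_def, simp)+
  \<comment> \<open>From here on every component known to vanish is rewritten to 0 in later cocycle
    equations, so each step builds on the facts before it. The instances of \<open>swap\<close>
    bring the surviving value into the argument order of the goal.\<close>
  note [simp] = vanishingD
  have [simp]: "vanishing C0 X1 X3" "vanishing C0 X3 X5" "vanishing C0 X3 Y5" "vanishing C0 Y1 X3"
      "vanishing C0 Y3 Y5" "vanishing X1 Y1 X4" "vanishing X1 Y3 C0" "vanishing Y1 X3 C0"
      "vanishing Z2 X1 X5" "vanishing Z2 Y1 Y5"
    by (rule vanishing_range; simp)+
  \<comment> \<open>These components lie in the symmetric square: their determining value is at a
    pair of equal vectors.\<close>
  have [simp]: "vanishing X1 X1 S2" "vanishing X1 X1 Z2" "vanishing Y1 Y1 S2" "vanishing Y1 Y1 Z2"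
    by (rule vanishingI[where b = 1]; simp add: f_self coord_0)+
  have [simp]: "vanishing C0 X3 Y3"
    using cocycle_equation[of 1 C0 1 Y1 1 X3 Y4 1]
    by (intro vanishingI[where b = 1]) (simp_all add: equation_simps swap[of X3 1 C0 1])
  have [simp]: "vanishing C0 X4 Y4"
    using cocycle_equation[of 1 C0 1 X1 1 X3 Y4 1]
    by (intro vanishingI[where b = 1]) (simp_all add: equation_simps swap[of X4 1 C0 1])
  \<comment> \<open>The equation contains the unknown component at two index pairs and shows the two
    values equal. By \<open>lower\<close> the second is -4 times the first, so both are 0; for
    \<open>X5\<close> below the factor is -5.\<close>
  have "coord Y3 1 (f (base X1 1) (base X4 2)) = coord Y3 1 (f (base X1 2) (base X4 1))"
    using cocycle_equation[of 1 X1 2 X1 1 X3 Y3 1] by (simp add: equation_simps swap[of X4 2 X1 1]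
        swap[of X4 1 X1 2])
  then have [simp]: "vanishing X1 X4 Y3"
    using lower[of 1 X1 1 X4 Y3] by (intro vanishingI[where b = 2]) simp_all
  have "coord Y4 1 (f (base X1 1) (base X5 2)) = coord Y4 1 (f (base X1 2) (base X5 1))"
    using cocycle_equation[of 1 X1 2 X1 1 X4 Y4 1] by (simp add: equation_simps swap[of X5 2 X1 1]
        swap[of X5 1 X1 2])
  then have [simp]: "vanishing X1 X5 Y4"
    using lower[of 1 X1 1 X5 Y4] by (intro vanishingI[where b = 2]) simp_all
  have [simp]: "vanishing Y3 Z2 X3"
    using cocycle_equation[of 1 Z2 2 Z2 1 Y3 Y5 1]
    by (intro vanishingI[where b = 2]) (simp_all add: equation_simps swap[of Z2 2 Y3 1])
  have [simp]: "vanishing Z2 Y1 X1"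
    using cocycle_equation[of 1 Z2 3 Z2 2 Y1 X3 3]
    by (intro vanishingI[where b = 2]) (simp_all add: equation_simps swap[of Y1 2 Z2 1])
  have [simp]: "vanishing C0 X1 X1"
    using cocycle_equation[of 1 X1 1 Y1 2 Y1 X1 1]
    by (intro vanishingI[where b = 1]) (simp_all add: equation_simps swap[of X1 1 C0 1])
  have [simp]: "vanishing C0 X1 Y1"
    using cocycle_equation[of 1 C0 1 X1 1 Y3 Y4 1]
    by (intro vanishingI[where b = 1]) (simp_all add: equation_simps swap[of X1 1 C0 1])
  have [simp]: "vanishing C0 Y1 X1"
    using cocycle_equation[of 1 C0 1 Y1 1 X3 X4 1]
    by (intro vanishingI[where b = 1]) (simp_all add: equation_simps swap[of Y1 1 C0 1])
  have [simp]: "vanishing X1 Z2 Y1"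
    using cocycle_equation[of 2 Z2 1 X1 2 Y1 C0 1]
    by (intro vanishingI[where b = 2]) (simp_all add: equation_simps swap[of Z2 2 X1 1])
  have [simp]: "vanishing C0 Y1 Y1"
    using cocycle_equation[of 1 X1 2 X1 1 Y1 Y1 1]
    by (intro vanishingI[where b = 1]) (simp_all add: equation_simps swap[of Y1 1 C0 1])
  have [simp]: "vanishing X4 Y3 Y3"
    using cocycle_equation[of 1 X1 1 X3 3 Y3 Y3 1]
    by (intro vanishingI[where b = 3]) (simp_all add: equation_simps swap[of Y3 3 X4 1])
  have [simp]: "vanishing X1 X3 S2"
    using cocycle_equation[of 1 X1 2 X3 2 Y3 Y3 1]
    by (intro vanishingI[where b = 2]) (simp_all add: equation_simps swap[of X3 2 X1 1])
  have [simp]: "vanishing C0 X3 X3"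
    using cocycle_equation[of 1 Y1 2 Y1 1 X3 X3 1]
    by (intro vanishingI[where b = 1]) (simp_all add: equation_simps swap[of X3 1 C0 1])
  have [simp]: "vanishing Y3 X3 X4"
    using cocycle_equation[of 1 Z2 2 X1 1 Y3 X4 1]
    by (intro vanishingI[where b = 2]) (simp_all add: equation_simps swap[of X3 2 Y3 1])
  have [simp]: "vanishing Y1 Y5 X4"
    using cocycle_equation[of 1 Z2 1 Y1 2 X3 X4 1]
    by (intro vanishingI[where b = 2]) (simp_all add: equation_simps swap[of Y5 2 Y1 1])
  have [simp]: "vanishing C0 X4 X4"
    using cocycle_equation[of 1 Y1 2 Y1 1 X4 X4 1]
    by (intro vanishingI[where b = 1]) (simp_all add: equation_simps swap[of X4 1 C0 1])
  have [simp]: "vanishing Y1 Y4 X5"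
    using cocycle_equation[of 1 Y1 1 X3 2 X3 X5 1]
    by (intro vanishingI[where b = 1]) (simp_all add: equation_simps swap[of Y4 1 Y1 1])
  have [simp]: "vanishing C0 X5 X5"
    using cocycle_equation[of 1 Y1 2 Y1 1 X5 X5 1]
    by (intro vanishingI[where b = 1]) (simp_all add: equation_simps swap[of X5 1 C0 1])
  have [simp]: "vanishing X5 X1 X4"
    using cocycle_equation[of 1 X1 2 X1 1 X5 X5 1]
    by (intro vanishingI[where b = 2]) (simp_all add: equation_simps swap[of X1 2 X5 1])
  have [simp]: "vanishing X4 X1 X3"
    using cocycle_equation[of 1 X1 2 X1 1 X4 X4 1]
    by (intro vanishingI[where b = 2]) (simp_all add: equation_simps swap[of X1 2 X4 1])
  have [simp]: "vanishing X3 X1 Z2"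
    using cocycle_equation[of 1 X1 2 X1 1 X3 X3 1]
    by (intro vanishingI[where b = 2]) (simp_all add: equation_simps swap[of X1 2 X3 1])
  have [simp]: "vanishing Y3 X1 S2"
    using cocycle_equation[of 2 X1 1 Y3 4 Y3 Y3 3]
    by (intro vanishingI[where b = 2]) (simp_all add: equation_simps swap[of X1 2 Y3 1])
  have [simp]: "vanishing X1 Y3 X4"
    using cocycle_equation[of 1 Z2 1 X1 1 Y1 X4 1]
    by (intro vanishingI[where b = 1]) (simp_all add: equation_simps swap[of Y3 1 X1 1])
  have [simp]: "vanishing C0 Y3 X3"
    using cocycle_equation[of 1 C0 1 Z2 1 Y3 Y5 1]
    by (intro vanishingI[where b = 1]) (simp_all add: equation_simps swap[of Y3 1 C0 1])
  have [simp]: "vanishing Y3 X1 Z2"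
    using cocycle_equation[of 1 X1 2 X1 1 Y3 X3 1]
    by (intro vanishingI[where b = 2]) (simp_all add: equation_simps swap[of X1 2 Y3 1])
  have [simp]: "vanishing Y4 X3 Y5"
    using cocycle_equation[of 2 Z2 1 X1 1 Y4 Y5 1]
    by (intro vanishingI[where b = 2]) (simp_all add: equation_simps swap[of X3 2 Y4 1])
  have [simp]: "vanishing X1 Y4 X3"
    using cocycle_equation[of 2 Z2 1 X1 2 Y4 Y5 2]
    by (intro vanishingI[where b = 2]) (simp_all add: equation_simps swap[of Y4 2 X1 1])
  have [simp]: "vanishing Y5 Z2 Y5"
    using cocycle_equation[of 1 X1 2 Y1 1 Y5 Y5 1]
    by (intro vanishingI[where b = 2]) (simp_all add: equation_simps swap[of Z2 2 Y5 1])
  have [simp]: "vanishing X1 Y5 X4"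
    using cocycle_equation[of 1 X1 2 Y1 2 Y5 Y5 2]
    by (intro vanishingI[where b = 2]) (simp_all add: equation_simps swap[of Y5 2 X1 1])
  have [simp]: "vanishing C0 Y5 X5"
    using cocycle_equation[of 1 C0 1 Z2 1 X3 X5 1]
    by (intro vanishingI[where b = 1]) (simp_all add: equation_simps swap[of Y5 1 C0 1])
  have [simp]: "vanishing X1 Y4 X5"
    using cocycle_equation[of 1 X1 2 X1 1 Y5 X5 1]
    by (intro vanishingI[where b = 1]) (simp_all add: equation_simps swap[of Y4 1 X1 1])
  have [simp]: "vanishing Y4 Z2 Y4"
    using cocycle_equation[of 1 X1 2 Y1 1 Y4 Y4 1]
    by (intro vanishingI[where b = 2]) (simp_all add: equation_simps swap[of Z2 2 Y4 1])
  have [simp]: "vanishing X1 Y4 Y3"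
    using cocycle_equation[of 1 X1 2 Y1 2 Y4 Y4 2]
    by (intro vanishingI[where b = 2]) (simp_all add: equation_simps swap[of Y4 2 X1 1])
  have [simp]: "vanishing C0 Y5 Y5"
    using cocycle_equation[of 1 Y1 2 Y1 1 Y5 Y5 1]
    by (intro vanishingI[where b = 1]) (simp_all add: equation_simps swap[of Y5 1 C0 1])
  have [simp]: "vanishing X1 Y4 Y5"
    using cocycle_equation[of 1 X1 2 X1 1 Y5 Y5 1]
    by (intro vanishingI[where b = 1]) (simp_all add: equation_simps swap[of Y4 1 X1 1])
  have [simp]: "vanishing X3 Y1 S2"
    using cocycle_equation[of 2 Y1 1 X3 6 X5 X5 5]
    by (intro vanishingI[where b = 2]) (simp_all add: equation_simps swap[of Y1 2 X3 1])
  have [simp]: "vanishing Y1 X3 Y4"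
    using cocycle_equation[of 1 Z2 1 X1 1 Y1 Y4 1]
    by (intro vanishingI[where b = 1]) (simp_all add: equation_simps swap[of X3 1 Y1 1])
  have [simp]: "vanishing X3 Y1 Z2"
    using cocycle_equation[of 1 Y1 2 Y1 1 X3 Y3 1]
    by (intro vanishingI[where b = 2]) (simp_all add: equation_simps swap[of Y1 2 X3 1])
  have [simp]: "vanishing C0 X5 Y5"
    using cocycle_equation[of 1 X1 2 X1 1 X5 Y5 1]
    by (intro vanishingI[where b = 1]) (simp_all add: equation_simps swap[of X5 1 C0 1])
  have [simp]: "vanishing X5 Y1 X4"
    using cocycle_equation[of 1 Y1 2 Y1 1 X5 Y5 1]
    by (intro vanishingI[where b = 2]) (simp_all add: equation_simps swap[of Y1 2 X5 1])
  have [simp]: "vanishing X4 Z2 X4"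
    using cocycle_equation[of 2 X1 1 Y1 1 X4 X4 1]
    by (intro vanishingI[where b = 2]) (simp_all add: equation_simps swap[of Z2 2 X4 1])
  have [simp]: "vanishing Y3 X4 Y5"
    using cocycle_equation[of 1 X1 2 X3 1 Y3 Y5 1]
    by (intro vanishingI[where b = 2]) (simp_all add: equation_simps swap[of X4 2 Y3 1])
  have [simp]: "vanishing Y1 X4 X3"
    using cocycle_equation[of 1 Z2 1 Y1 2 X4 Y5 1]
    by (intro vanishingI[where b = 2]) (simp_all add: equation_simps swap[of X4 2 Y1 1])
  have [simp]: "vanishing Z2 X3 X5"
    using cocycle_equation[of 1 X1 1 Y1 1 X3 X5 1]
    by (intro vanishingI[where b = 1]) (simp_all add: equation_simps swap[of X3 1 Z2 1])
  have [simp]: "vanishing Z2 Y3 Y5"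
    using cocycle_equation[of 1 X1 1 Y1 1 Y3 Y5 1]
    by (intro vanishingI[where b = 1]) (simp_all add: equation_simps swap[of Y3 1 Z2 1])
  have [simp]: "vanishing X3 Y3 Y4"
    using cocycle_equation[of 1 Z2 1 X1 2 Y3 Y4 1]
    by (intro vanishingI[where b = 2]) (simp_all add: equation_simps swap[of Y3 2 X3 1])
  have [simp]: "vanishing Y5 Y1 Y4"
    using cocycle_equation[of 1 Z2 2 Y1 1 X3 Y4 1]
    by (intro vanishingI[where b = 2]) (simp_all add: equation_simps swap[of Y1 2 Y5 1])
  have [simp]: "vanishing X4 Y1 Y3"
    using cocycle_equation[of 1 Y1 2 Y1 1 X4 Y4 1]
    by (intro vanishingI[where b = 2]) (simp_all add: equation_simps swap[of Y1 2 X4 1])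
  have [simp]: "vanishing Y4 X3 X3"
    using cocycle_equation[of 2 Z2 2 X1 1 Y4 X3 1]
    by (intro vanishingI[where b = 3]) (simp_all add: equation_simps swap[of X3 3 Y4 1])
  have [simp]: "vanishing Y1 Y3 S2"
    using cocycle_equation[of 1 Y1 2 X3 2 Y3 X3 1]
    by (intro vanishingI[where b = 2]) (simp_all add: equation_simps swap[of Y3 2 Y1 1])
  have [simp]: "vanishing Y3 Y1 Z2"
    using cocycle_equation[of 2 Y1 1 X3 1 Y3 Y5 1]
    by (intro vanishingI[where b = 2]) (simp_all add: equation_simps swap[of Y1 2 Y3 1])
  have [simp]: "vanishing Y4 Z2 X4"
    using cocycle_equation[of 2 X1 1 Y1 1 Y4 X4 1]
    by (intro vanishingI[where b = 2]) (simp_all add: equation_simps swap[of Z2 2 Y4 1])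
  have [simp]: "vanishing Y1 Y4 X3"
    using cocycle_equation[of 2 X1 1 Y1 2 Y4 X4 2]
    by (intro vanishingI[where b = 2]) (simp_all add: equation_simps swap[of Y4 2 Y1 1])
  have [simp]: "vanishing Y4 Y1 Y3"
    using cocycle_equation[of 2 Y1 1 X3 2 X3 Y3 1]
    by (intro vanishingI[where b = 2]) (simp_all add: equation_simps swap[of Y1 2 Y4 1])
  have [simp]: "vanishing X3 X3 X4"
    using cocycle_equation[of 1 Y1 1 X3 2 X3 Y5 1]
    by (intro vanishingI[where b = 2]) (simp_all add: equation_simps swap[of X3 2 X3 1])
  have [simp]: "vanishing Z2 X1 X1"
    using cocycle_equation[of 1 Z2 2 X1 1 X3 X4 1]
    by (intro vanishingI[where b = 2]) (simp_all add: equation_simps swap[of X1 2 Z2 1])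
  have [simp]: "vanishing Z2 Y1 Y1"
    using cocycle_equation[of 1 Z2 2 Y1 5 X4 Y5 5]
    by (intro vanishingI[where b = 2]) (simp_all add: equation_simps swap[of Y1 2 Z2 1])
  have [simp]: "vanishing Z2 X3 Y5"
    using cocycle_equation[of 1 X1 1 Y1 1 X3 Y5 1]
    by (intro vanishingI[where b = 1]) (simp_all add: equation_simps swap[of X3 1 Z2 1])
  \<comment> \<open>This equation reaches only the coordinate at \<open>Y4 2\<close>. With
    \<open>p\<close> at \<open>(Z2 1, X4 2)\<close> and \<open>q\<close> at
    \<open>(Z2 2, X4 1)\<close>, \<open>raise\<close> turns it into \<open>p + q = 0\<close>, and
    \<open>lower\<close> gives \<open>4 p + 2 q = 0\<close>.\<close>
  have "coord Y4 2 (f (base Z2 2) (base X4 2)) = 0"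
    using cocycle_equation[of 2 Z2 1 X1 2 X3 Y4 2] by (simp add: equation_simps swap[of X4 2 Z2 2])
  then have "coord Y4 1 (f (base Z2 1) (base X4 2)) + coord Y4 1 (f (base Z2 2) (base X4 1)) = 0"
    using raise[of 2 Z2 2 X4 1 Y4] by simp
  then have "coord Y4 1 (f (base Z2 2) (base X4 1)) = - coord Y4 1 (f (base Z2 1) (base X4 2))"
    by (metis add.commute eq_neg_iff_add_eq_0)
  then have "coord Y4 1 (f (base Z2 1) (base X4 2)) = 0"
    using lower[of 1 Z2 1 X4 Y4] by simp
  then have [simp]: "vanishing Z2 X4 Y4"
    by (rule vanishingI) simp
  have [simp]: "vanishing Y1 X5 Y4"
    using cocycle_equation[of 1 X1 1 Y1 2 X4 Y4 1]
    by (intro vanishingI[where b = 2]) (simp_all add: equation_simps swap[of X5 2 Y1 1])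
  \<comment> \<open>Each remaining triple either violates the Clebsch-Gordan condition or is among
    the components collected above.\<close>
  show "vanishing X1 t w" "vanishing Y1 t w"
    by (cases t; cases w; (rule vanishing_range; simp; fail)?; unfold vanishing_def; simp add:
        S2_right coord_0)+
qed

end

section \<open>From generators to the whole algebra\<close>

context relative_cocycle
begin

lemma kernel_lie:
  assumes x: "\<forall>z. f x z = 0" and y: "\<forall>z. f y z = 0"
  shows "\<forall>z. f (lie x y) z = 0"
proof
  fix z
  have "f z x = 0" "f z y = 0" for z
    using f_swap[of z x] f_swap[of z y] x y by simp_all
  moreover have "diff2 f x y z = 0"
    using cocycle by (simp add: cocycles2_def)
  ultimately show "f (lie x y) z = 0"
    using x y by (simp add: diff2_def)
qed

lemma normalized_zero:
  assumes "normalized f"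
  shows "f x y = 0"
proof -
  define K where "K t \<longleftrightarrow> (\<forall>i y. f (base t i) y = 0)" for t
  have left: "f (base t i) y = 0" if "\<And>u w. vanishing t u w" for t i y
  proof (rule linear_eqI[where s = scaleC and p = "f (base t i)" and q = "\<lambda>_. 0"])
    fix u j
    show "f (base t i) (base u j) = 0"
      by (rule coord_ext) (simp add: vanishingD[OF that] coord_0)
  qed (simp_all add: f_linear)
  have X1: "K X1" and Y1: "K Y1"
    unfolding K_def using left normalized_vanishing[OF assms] by blast+
  \<comment> \<open>Since \<open>hw t = 1\<close>, the vectors \<open>[t_1, u_k] = w_k\<close> give
    every index but the last, \<open>hw w + 1\<close>, which exceeds the range of \<open>u\<close>;
    that one is \<open>[t_2, u_(k-1)]\<close>.\<close>
  have gen: "K w" if t: "K t" and u: "K u" and w: "bracket_table t u = (w, 0, \<lambda>i j. 1)" "hw w = hw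
      t + hw u"
    "hw t = 1" for t u w
  proof -
    have "f (base w k) y = 0" if k: "idx w k" for k y
    proof (cases "k = hw w + 1")
      case True
      moreover have "hw u \<ge> 0"
        by (cases u) simp_all
      ultimately have "lie (base t 2) (base u (k - 1)) = base w k"
        using k w by (subst lie_base) (simp_all add: bracket_defs)
      then show ?thesis
        using kernel_lie[of "base t 2" "base u (k - 1)"] t u by (simp add: K_def)
    next
      case False
      then have "lie (base t 1) (base u k) = base w k"
        using k w by (subst lie_base) (simp_all add: bracket_defs)
      then show ?thesis
        using kernel_lie[of "base t 1" "base u k"] t u by (simp add: K_def)
    qed
    then show ?thesis
      unfolding K_def by (metis base_out f_linear(8))
  qed
  have Z2: "K Z2"
    by (rule gen[OF X1 Y1]) simp_all
  have X3: "K X3" and Y3: "K Y3"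
    by (rule gen[OF X1 Z2] gen[OF Y1 Z2]; simp)+
  have X4: "K X4" and Y4: "K Y4"
    by (rule gen[OF X1 X3] gen[OF Y1 Y3]; simp)+
  have X5: "K X5" and Y5: "K Y5"
    by (rule gen[OF X1 X4] gen[OF Y1 X4]; simp)+
  have "lie (base X1 1) (base X1 2) = base C0 1"
    by (simp add: lie_base bracket_defs)
  then have "f (base C0 1) y = 0" for y
    using kernel_lie[of "base X1 1" "base X1 2"] X1 by (simp add: K_def)
  moreover have "f (base C0 i) y = 0" if "i \<noteq> 1" for i y
    using that by (simp add: base_out f_linear)
  ultimately have "K C0"
    unfolding K_def by metis
  then have "K t" for t
    using X1 Y1 Z2 X3 Y3 X4 Y4 X5 Y5 by (cases t) (simp_all add: K_def S2_left)
  then have K: "f (base t i) y = 0" for t i y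
    by (simp add: K_def)
  show ?thesis
    by (rule linear_eqI[where s = scaleC and p = "\<lambda>x. f x y" and q = "\<lambda>_. 0"]) (simp_all add:
        f_linear K)
qed

end

section \<open>Equivariant endomorphisms\<close>

definition lin_ext :: "(comp \<Rightarrow> int \<Rightarrow> sl2_gn) \<Rightarrow> sl2_gn \<Rightarrow> sl2_gn" where
  "lin_ext G v = (\<Sum>t\<in>UNIV. \<Sum>i\<in>{1..hw t + 1}. scaleC (coord t i v) (G t i))"

lemma lin_ext_add: "lin_ext G (v + w) = lin_ext G v + lin_ext G w"
  by (simp only: lin_ext_def coord_add scaleC_add_left sum.distrib)

lemma lin_ext_scaleC: "lin_ext G (scaleC c v) = scaleC c (lin_ext G v)"
  by (simp only: lin_ext_def coord_scaleC scaleC_scaleC[symmetric] scaleC.scale_sum_right)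

lemma lin_ext_cochain: "lin_ext G \<in> cochains1"
  by (intro cochains1I lin_ext_add lin_ext_scaleC)

lemma lin_ext_fun_add: "lin_ext (\<lambda>t i. G t i + G' t i) v = lin_ext G v + lin_ext G' v"
  by (simp only: lin_ext_def scaleC_add_right sum.distrib)

lemma lin_ext_fun_scaleC: "lin_ext (\<lambda>t i. scaleC c (G t i)) v = scaleC c (lin_ext G v)"
  by (simp only: lin_ext_def scaleC.scale_left_commute[of _ c] scaleC.scale_sum_right)

lemma lin_ext_base:
  assumes "idx t i"
  shows "lin_ext G (base t i) = G t i"
proof -
  have "lin_ext G (base t i) = (\<Sum>t'\<in>UNIV. \<Sum>i'\<in>{1..hw t' + 1}. if t' = t \<and> i' = i then G t i else 0)"
    unfolding lin_ext_def by (intro sum.cong refl) (use assms in \<open>auto simp: coord_base\<close>)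
  also have "\<dots> = (\<Sum>t'\<in>UNIV. if t' = t then G t i else 0)"
    by (intro sum.cong refl) (use assms in auto)
  finally show ?thesis
    by simp
qed

text \<open>When \<tau> is supported on pairs of equal highest weight, this is the general
  equivariant endomorphism, by Schur's lemma. The support condition is imposed in
  \<open>gauge_relative\<close>.\<close>

definition gauge :: "(comp \<Rightarrow> comp \<Rightarrow> complex) \<Rightarrow> sl2_gn \<Rightarrow> sl2_gn" where
  "gauge \<tau> = lin_ext (\<lambda>t i. \<Sum>u\<in>UNIV. scaleC (\<tau> t u) (base u i))"

lemma gauge_cochain: "gauge \<tau> \<in> cochains1"
  unfolding gauge_def by (rule lin_ext_cochain)

lemma gauge_base: "idx t i \<Longrightarrow> gauge \<tau> (base t i) = (\<Sum>u\<in>UNIV. scaleC (\<tau> t u) (base u i))"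
  unfolding gauge_def by (rule lin_ext_base)

lemma coord_gauge:
  assumes "idx t i"
  shows "coord w j (gauge \<tau> (base t i)) = (if j = i \<and> idx w j then \<tau> t w else 0)"
proof -
  have "coord w j (gauge \<tau> (base t i)) = (\<Sum>u\<in>UNIV. if u = w then if j = i \<and> idx w j then \<tau> t w
      else 0 else 0)"
    unfolding gauge_base[OF assms] coord_sum by (intro sum.cong refl) (auto simp: coord_simps
        coord_base)
  then show ?thesis
    by simp
qed

lemma gauge_relative:
  assumes "\<And>u. \<tau> S2 u = 0" and hw: "\<And>t u. \<tau> t u \<noteq> 0 \<Longrightarrow> hw t = hw u"
  shows "diff1 (gauge \<tau>) (base S2 i) y = 0"
proof (cases "idx S2 i")
  case True
  note g = cochains1D[OF gauge_cochain]
  have gauge_S2: "gauge \<tau> (base S2 i) = 0"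
    by (simp add: gauge_base[OF True] assms(1))
  \<comment> \<open>Components coupled by \<tau> have the same index range, so both sides are 0 at
    an index outside it.\<close>
  have all: "gauge \<tau> (base t k) = (\<Sum>u\<in>UNIV. scaleC (\<tau> t u) (base u k))" for t k
  proof (cases "idx t k")
    case False
    then have "scaleC (\<tau> t u) (base u k) = 0" for u
      using hw[of t u] base_out[of k u] by (cases "\<tau> t u = 0") auto
    then have "(\<Sum>u\<in>UNIV. scaleC (\<tau> t u) (base u k)) = 0"
      by (intro sum.neutral ballI)
    then show ?thesis
      using False by (simp add: base_out g)
  qed (rule gauge_base)
  show ?thesis
  proof (rule linear_eqI[where s = scaleC and p = "diff1 (gauge \<tau>) (base S2 i)" and q = "\<lambda>_. 0"])
    fix u j assume u: "idx u j"
    define c where "c v = (of_int (hw v) * of_int (i - 1) / 2 - of_int (j - 1) :: complex)" for v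
    have "lie (base S2 i) (scaleC (\<tau> u v) (base v j)) = scaleC (c u) (scaleC (\<tau> u v) (base v (i +
        j - 2)))" for v
    proof (cases "\<tau> u v = 0")
      case False
      then have "hw v = hw u"
        using hw by simp
      moreover from this have "idx v j"
        using u by simp
      ultimately show ?thesis
        by (simp add: lie_scaleC_right lie_base_S2[OF True] c_def scaleC.scale_left_commute)
    qed simp
    then have "lie (base S2 i) (gauge \<tau> (base u j)) = (\<Sum>v\<in>UNIV. scaleC (c u) (scaleC (\<tau> u v) (base
        v (i + j - 2))))"
      unfolding gauge_base[OF u] sum_comp lie_add_right by simp
    also have "\<dots> = gauge \<tau> (lie (base S2 i) (base u j))"
      by (simp add: lie_base_S2[OF True u] g all scaleC.scale_sum_right c_def)
    finally show "diff1 (gauge \<tau>) (base S2 i) (base u j) = 0"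
      by (simp add: diff1_def gauge_S2)
  qed (simp_all add: diff1_def gauge_S2 g lie_algebra_simps)
next
  case False
  then show ?thesis
    by (simp add: base_out diff1_def cochains1D[OF gauge_cochain])
qed

lemma coord_diff1_gauge:
  assumes "idx t i" "idx u j"
  shows "coord w k (diff1 (gauge \<tau>) (base t i) (base u j)) =
    coord w k (lie (base t i) (gauge \<tau> (base u j))) - coord w k (lie (base u j) (gauge \<tau> (base t
        i)))
    - bracket_coeff t u i j * coord w k (gauge \<tau> (base (bracket_comp t u) (i + j - 1 -
        bracket_shift t u)))"
  by (simp add: diff1_def lie_base[OF assms] cochains1D[OF gauge_cochain] coord_simps)

section \<open>The two deformations\<close>

definition table_vec :: "comp \<times> int \<times> (int \<Rightarrow> int \<Rightarrow> complex) \<Rightarrow> int \<Rightarrow> int \<Rightarrow> sl2_gn" where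
  "table_vec p i j = scaleC (snd (snd p) i j) (base (fst p) (i + j - 1 - fst (snd p)))"

definition table_map :: "(comp \<Rightarrow> comp \<Rightarrow> comp \<times> int \<times> (int \<Rightarrow> int \<Rightarrow> complex)) \<Rightarrow> sl2_gn \<Rightarrow> sl2_gn \<Rightarrow>
    sl2_gn" where
  "table_map T v w = lin_ext (\<lambda>t i. lin_ext (\<lambda>u. table_vec (T t u) i) w) v"

lemma table_map_base:
  "table_map T (base t i) (base u j) = (if idx t i \<and> idx u j then table_vec (T t u) i j else 0)"
  using cochains1D(3)[OF lin_ext_cochain]
  by (auto simp: table_map_def lin_ext_base base_out) (simp_all add: lin_ext_def)

lemma table_map_left: "(\<lambda>v. table_map T v w) \<in> cochains1"
  unfolding table_map_def by (rule lin_ext_cochain)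

lemma table_map_right: "table_map T v \<in> cochains1"
  by (intro cochains1I)
    (simp_all only: table_map_def lin_ext_add lin_ext_scaleC lin_ext_fun_add lin_ext_fun_scaleC)

lemma table_map_cochain:
  assumes "\<And>t u. fst (T u t) = fst (T t u)" "\<And>t u. fst (snd (T u t)) = fst (snd (T t u))"
    and "\<And>t u i j. snd (snd (T u t)) j i = - snd (snd (T t u)) i j"
  shows "table_map T \<in> cochains2"
proof (rule cochains2I)
  fix v
  have vec: "table_vec (T t u) i j = - table_vec (T u t) j i" for t u i j
    using assms(1)[of t u] assms(2)[of t u] assms(3)[of t u i j]
    by (simp add: table_vec_def add.commute)
  have *: "table_map T x y = - table_map T y x" for x y
  proof (rule linear_eqI[where s = scaleC and p = "\<lambda>x. table_map T x y" and q = "\<lambda>x. - table_map T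
      y x"])
    fix t i
    show "table_map T (base t i) y = - table_map T y (base t i)"
    proof (rule linear_eqI[where s = scaleC and p = "table_map T (base t i)" and q = "\<lambda>y. -
        table_map T y (base t i)"])
      fix u j
      show "table_map T (base t i) (base u j) = - table_map T (base u j) (base t i)"
        using vec[of t u i j] by (auto simp: table_map_base)
    qed (simp_all add: cochains1D[OF table_map_right] cochains1D[OF table_map_left])
  qed (simp_all add: cochains1D[OF table_map_right] cochains1D[OF table_map_left])
  \<comment> \<open>A vector equal to its negative is seen to be 0 in its complex
    coordinates.\<close>
  have "coord t i (table_map T v v) = - coord t i (table_map T v v)" for t i
    using arg_cong[OF *[of v v], of "coord t i"] by (simp only: coord_minus)
  then show "table_map T v v = 0"
    by (intro coord_ext) (simp add: coord_0)
qed (rule table_map_left table_map_right)+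

lemma diff2_linear:
  assumes f: "f \<in> cochains2"
  shows "diff2 f (x + x') y z = diff2 f x y z + diff2 f x' y z"
    "diff2 f (scaleC c x) y z = scaleC c (diff2 f x y z)"
    "diff2 f x y z = - diff2 f y x z" "diff2 f x y z = - diff2 f x z y"
proof -
  note lin = cochains2D[OF f]
  show "diff2 f (x + x') y z = diff2 f x y z + diff2 f x' y z"
    by (simp add: diff2_def lie_add_left lie_add_right lin)
  show "diff2 f (scaleC c x) y z = scaleC c (diff2 f x y z)"
    by (simp add: diff2_def lie_scaleC_left lie_scaleC_right lin scaleC.scale_right_diff_distrib
        scaleC.scale_right_distrib)
  show "diff2 f x y z = - diff2 f y x z"
    using cochains2_swap[OF f, of x y] lie_swap[of x y] by (simp add: diff2_def lie_minus_right lin)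
  show "diff2 f x y z = - diff2 f x z y"
    using cochains2_swap[OF f, of y z] lie_swap[of y z] by (simp add: diff2_def lie_minus_right lin)
qed

lemma cocycles2I:
  assumes f: "f \<in> cochains2"
    and "\<And>t i u j v k. idx t i \<Longrightarrow> idx u j \<Longrightarrow> idx v k \<Longrightarrow> diff2 f (base t i) (base u j) (base v k) = 0"
  shows "f \<in> cocycles2"
proof -
  have ext: "diff2 f x y z = 0" if "\<And>t i. idx t i \<Longrightarrow> diff2 f (base t i) y z = 0" for x y z
    by (rule linear_eqI[where s = scaleC and p = "\<lambda>x. diff2 f x y z" and q = "\<lambda>_. 0"])
      (simp_all add: diff2_linear(1,2)[OF f] that)
  have "diff2 f x (base u j) (base v k) = 0" if "idx u j" "idx v k" for x u j v k
    using ext assms(2) that by blast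
  then have "diff2 f (base u j) x (base v k) = 0" if "idx u j" "idx v k" for x u j v k
    using diff2_linear(3)[OF f, of "base u j" x] that by simp
  then have "diff2 f y x (base v k) = 0" if "idx v k" for x y v k
    using ext that by blast
  then have "diff2 f (base v k) y x = 0" if "idx v k" for x y v k
    using diff2_linear(3)[OF f, of "base v k" y x] diff2_linear(4)[OF f, of y "base v k" x] that
        by simp
  then have "diff2 f x y z = 0" for x y z
    using ext by blast
  then show ?thesis
    using f by (simp add: cocycles2_def)
qed

text \<open>\<open>diff2 f\<close> is alternating, so triples sorted by \<open>hw\<close> suffice.
  With an argument in \<open>sl2\<close> the identity is just equivariance.\<close>

lemma relative_cocycles2I:
  assumes f: "f \<in> cochains2" and S2: "\<And>i y. f (base S2 i) y = 0"
    and equivariant: "\<And>i u j v k. idx S2 i \<Longrightarrow> idx u j \<Longrightarrow> idx v k \<Longrightarrow> lie (base S2 i) (f (base u j)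
        (base v k)) =
      f (lie (base S2 i) (base u j)) (base v k) + f (base u j) (lie (base S2 i) (base v k))"
    and rest: "\<And>t i u j v k. t \<noteq> S2 \<Longrightarrow> u \<noteq> S2 \<Longrightarrow> v \<noteq> S2 \<Longrightarrow>
      hw t \<le> hw u \<Longrightarrow> hw u \<le> hw v \<Longrightarrow> idx t i \<Longrightarrow> idx u j \<Longrightarrow> idx v k \<Longrightarrow>
      diff2 f (base t i) (base u j) (base v k) = 0"
  shows "f \<in> cocycles2"
proof (rule cocycles2I[OF f])
  have *: "diff2 f (base S2 i) (base u j) (base v k) = 0" if "idx S2 i" "idx u j" "idx v k" for i
      u j v k
  proof -
    have "f y (base S2 i) = 0" for y
      using cochains2_swap[OF f, of y] S2 by simp
    then show ?thesis
      using equivariant[OF that] cochains2_swap[OF f, of "lie (base S2 i) (base v k)" "base u j"]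
      by (simp add: diff2_def S2)
  qed
  fix t i u j v k assume idx: "idx t i" "idx u j" "idx v k"
  consider "t = S2" | "u = S2" | "v = S2" | "t \<noteq> S2" "u \<noteq> S2" "v \<noteq> S2"
    by blast
  then show "diff2 f (base t i) (base u j) (base v k) = 0"
  proof cases
    case 2
    then show ?thesis
      using *[of j i t k v] idx diff2_linear(3)[OF f, of "base t i" "base u j"] by simp
  next
    case 3
    then show ?thesis
      using *[of k i t j u] idx diff2_linear(3)[OF f, of "base t i" "base v k" "base u j"]
        diff2_linear(4)[OF f, of "base t i" "base u j" "base v k"] by simp
  next
    case 4
    note swap = diff2_linear(3,4)[OF f]
    let ?D = "diff2 f (base t i) (base u j) (base v k)"
    have eqs: "?D = - diff2 f (base u j) (base t i) (base v k)" "?D = - diff2 f (base t i) (base v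
        k) (base u j)"
      "?D = diff2 f (base u j) (base v k) (base t i)" "?D = diff2 f (base v k) (base t i) (base u
          j)"
      "?D = - diff2 f (base v k) (base u j) (base t i)"
      using swap(1)[of "base t i" "base u j" "base v k"] swap(2)[of "base t i" "base u j" "base v
          k"]
        swap(2)[of "base u j" "base t i" "base v k"] swap(1)[of "base t i" "base v k" "base u j"]
        swap(2)[of "base v k" "base t i" "base u j"] by simp_all
    consider (tuv) "hw t \<le> hw u" "hw u \<le> hw v" | (tvu) "hw t \<le> hw v" "hw v \<le> hw u"
      | (utv) "hw u \<le> hw t" "hw t \<le> hw v" | (uvt) "hw u \<le> hw v" "hw v \<le> hw t"
      | (vtu) "hw v \<le> hw t" "hw t \<le> hw u" | (vut) "hw v \<le> hw u" "hw u \<le> hw t"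
      by linarith
    then show ?thesis
    proof cases
      case tuv
      then show ?thesis
        by (intro rest 4 idx)
    next
      case tvu
      then have "diff2 f (base t i) (base v k) (base u j) = 0"
        by (intro rest 4 idx)
      then show ?thesis
        unfolding eqs(2) by simp
    next
      case utv
      then have "diff2 f (base u j) (base t i) (base v k) = 0"
        by (intro rest 4 idx)
      then show ?thesis
        unfolding eqs(1) by simp
    next
      case uvt
      then have "diff2 f (base u j) (base v k) (base t i) = 0"
        by (intro rest 4 idx)
      then show ?thesis
        unfolding eqs(3) .
    next
      case vtu
      then have "diff2 f (base v k) (base t i) (base u j) = 0"
        by (intro rest 4 idx)
      then show ?thesis
        unfolding eqs(4) .
    next
      case vut
      then have "diff2 f (base v k) (base u j) (base t i) = 0"
        by (intro rest 4 idx)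
      then show ?thesis
        unfolding eqs(5) by simp
    qed
  qed (use * idx in simp)
qed

text \<open>Adds \<open>x^4\<close> to the brackets \<open>[y, y^3]\<close>. The cocycle identity on
  \<open>X1, Y1, Y3\<close> then leads to the entry at \<open>Z2, Y3\<close>, and on
  \<open>Z2, Y1, Y3\<close> to the one at \<open>Y3, Y3\<close>, whose coefficient is that of
  \<open>[X3, X3]\<close>.\<close>

definition shift_table :: "comp \<Rightarrow> comp \<Rightarrow> comp \<times> int \<times> (int \<Rightarrow> int \<Rightarrow> complex)" where
  "shift_table t u =
     (if t = Y1 \<and> u = Y3 then (X4, 0, \<lambda>i j. 1) else if t = Y3 \<and> u = Y1 then (X4, 0, \<lambda>i j. - 1)
      else if t = Z2 \<and> u = Y3 then (X5, 0, \<lambda>i j. 1) else if t = Y3 \<and> u = Z2 then (X5, 0, \<lambda>i j. - 1)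
      else if t = Y3 \<and> u = Y3 then (Y4, 1, \<lambda>i j. - 3 * of_int (j - i)) else (C0, 0, \<lambda>i j. 0))"

text \<open>Adds \<open>c\<close> to \<open>[x_1, y_2]\<close> and \<open>- c\<close> to
  \<open>[x_2, y_1]\<close>. Both orders share the formula \<open>j - i\<close> because exchanging
  the arguments also exchanges the indices.\<close>

definition central_table :: "comp \<Rightarrow> comp \<Rightarrow> comp \<times> int \<times> (int \<Rightarrow> int \<Rightarrow> complex)" where
  "central_table t u = (if t = X1 \<and> u = Y1 \<or> t = Y1 \<and> u = X1 then (C0, 1, \<lambda>i j. of_int (j - i))
     else (C0, 0, \<lambda>i j. 0))"

lemma lie_base_if: "lie (base t i) (base u j) = (if idx t i \<and> idx u j then
    scaleC (bracket_coeff t u i j) (base (bracket_comp t u) (i + j - 1 - bracket_shift t u)) else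
        0)"
  by (auto simp: lie_base base_out)

lemma shift_table_cochain: "table_map shift_table \<in> cochains2"
proof -
  have "fst (shift_table u t) = fst (shift_table t u) \<and> fst (snd (shift_table u t)) = fst (snd
      (shift_table t u)) \<and>
      (\<forall>i j. snd (snd (shift_table u t)) j i = - snd (snd (shift_table t u)) i j)" for t u
    by (cases t; cases u; simp add: shift_table_def)
  then show ?thesis
    by (intro table_map_cochain) blast+
qed

lemma central_table_cochain: "table_map central_table \<in> cochains2"
proof -
  have "fst (central_table u t) = fst (central_table t u) \<and> fst (snd (central_table u t)) = fst
      (snd (central_table t u)) \<and>
      (\<forall>i j. snd (snd (central_table u t)) j i = - snd (snd (central_table t u)) i j)" for t u
    by (cases t; cases u; simp add: central_table_def)
  then show ?thesis
    by (intro table_map_cochain) blast+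
qed

lemma table_map_S2:
  assumes "\<And>u i j. table_vec (T S2 u) i j = 0"
  shows "table_map T (base S2 i) y = 0"
  by (rule linear_eqI[where s = scaleC and p = "table_map T (base S2 i)" and q = "\<lambda>_. 0"])
    (simp_all add: cochains1D[OF table_map_right] table_map_base assms)

text \<open>All three terms of the equivariance identity are multiples of one basis vector, so
  comparing coefficients suffices. The guards account for basis vectors outside the range being
  0.\<close>

definition scalar_equivariant :: "(comp \<Rightarrow> comp \<Rightarrow> comp \<times> int \<times> (int \<Rightarrow> int \<Rightarrow> complex)) \<Rightarrow> comp \<Rightarrow> comp
    \<Rightarrow> int \<Rightarrow> int \<Rightarrow> int \<Rightarrow> bool" where
  "scalar_equivariant T u v i j k \<longleftrightarrow> (case T u v of (w, s, \<kappa>) \<Rightarrow>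
     \<kappa> j k * (if idx w (j + k - 1 - s) then of_int (hw w) * of_int (i - 1) / 2 - of_int (j + k - 2
         - s) else 0) =
     (of_int (hw u) * of_int (i - 1) / 2 - of_int (j - 1)) * (if idx u (i + j - 2) then \<kappa> (i + j -
         2) k else 0) +
     (of_int (hw v) * of_int (i - 1) / 2 - of_int (k - 1)) * (if idx v (i + k - 2) then \<kappa> j (i + k
         - 2) else 0))"

lemma table_map_equivariant:
  assumes idx: "idx S2 i" "idx u j" "idx v k" and scalar: "scalar_equivariant T u v i j k"
  shows "lie (base S2 i) (table_map T (base u j) (base v k)) =
    table_map T (lie (base S2 i) (base u j)) (base v k) + table_map T (base u j) (lie (base S2 i)
        (base v k))"
proof -
  obtain w s \<kappa> where T: "T u v = (w, s, \<kappa>)"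
    by (cases "T u v") auto
  define b where "b = base w (i + j + k - 3 - s)"
  have index: "j + k - 1 - s + i - 2 = i + j + k - 3 - s" "i + j - 2 + k - 1 - s = i + j + k - 3 -
      s"
    "j + (i + k - 2) - 1 - s = i + j + k - 3 - s" "i + (j + k - 1 - s) - 2 = i + j + k - 3 - s"
    by simp_all
  have *: "table_map T (base u j) (base v k) = scaleC (\<kappa> j k) (base w (j + k - 1 - s))"
    using idx by (simp add: table_map_base table_vec_def T)
  have "lie (base S2 i) (base w (j + k - 1 - s)) =
      scaleC (if idx w (j + k - 1 - s) then of_int (hw w) * of_int (i - 1) / 2 - of_int (j + k - 2
          - s) else 0) b"
  proof (cases "idx w (j + k - 1 - s)")
    case True
    then show ?thesis
      unfolding lie_base_S2[OF idx(1) True] index b_def by (simp add: algebra_simps)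
  next
    case False
    then show ?thesis
      by (simp only: base_out[OF False] False if_False lie_zero_right scaleC.scale_zero_left)
  qed
  then have "lie (base S2 i) (table_map T (base u j) (base v k)) = scaleC (\<kappa> j k *
      (if idx w (j + k - 1 - s) then of_int (hw w) * of_int (i - 1) / 2 - of_int (j + k - 2 - s)
          else 0)) b"
    unfolding * lie_scaleC_right by (simp only: scaleC_scaleC)
  moreover have "table_map T (base u (i + j - 2)) (base v k) = scaleC (if idx u (i + j - 2) then \<kappa>
      (i + j - 2) k else 0) b"
    using idx(3) by (simp only: table_map_base table_vec_def T fst_conv snd_conv index
        b_def[symmetric]) simp
  moreover have "table_map T (base u j) (base v (i + k - 2)) = scaleC (if idx v (i + k - 2) then \<kappa>
      j (i + k - 2) else 0) b"
    using idx(2) by (simp only: table_map_base table_vec_def T fst_conv snd_conv index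
        b_def[symmetric]) simp
  ultimately show ?thesis
    using scalar unfolding lie_base_S2[OF idx(1,2)] lie_base_S2[OF idx(1,3)]
      cochains1D(2)[OF table_map_left] cochains1D(2)[OF table_map_right]
    by (simp only: scalar_equivariant_def T prod.case scaleC_scaleC scaleC_add_left)
qed

lemma shift_table_cocycle: "table_map shift_table \<in> cocycles2"
proof (rule relative_cocycles2I[OF shift_table_cochain])
  note lin = cochains2D[OF shift_table_cochain]
  show "table_map shift_table (base S2 i) y = 0" for i y
    by (rule table_map_S2) (simp add: table_vec_def shift_table_def)
  show "lie (base S2 i) (table_map shift_table (base u j) (base v k)) =
      table_map shift_table (lie (base S2 i) (base u j)) (base v k) + table_map shift_table (base
          u j) (lie (base S2 i) (base v k))"
    if idx: "idx S2 i" "idx u j" "idx v k" for i u j v k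
  proof (rule table_map_equivariant[OF idx])
    have i: "i = 1 \<or> i = 2 \<or> i = 3"
      using idx(1) by auto
    have j: "u = Y1 \<Longrightarrow> j = 1 \<or> j = 2" "u = Z2 \<Longrightarrow> j = 1 \<or> j = 2 \<or> j = 3"
      "u = Y3 \<Longrightarrow> j = 1 \<or> j = 2 \<or> j = 3 \<or> j = 4"
      using idx(2) by auto
    have k: "v = Y1 \<Longrightarrow> k = 1 \<or> k = 2" "v = Z2 \<Longrightarrow> k = 1 \<or> k = 2 \<or> k = 3"
      "v = Y3 \<Longrightarrow> k = 1 \<or> k = 2 \<or> k = 3 \<or> k = 4"
      using idx(3) by auto
    have "shift_table u v = (C0, 0, \<lambda>i j. 0)" if "(u, v) \<notin> {(Y1, Y3), (Y3, Y1), (Z2, Y3), (Y3,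
        Z2), (Y3, Y3)}"
      using that by (auto simp: shift_table_def)
    then consider "u = Y1" "v = Y3" | "u = Y3" "v = Y1" | "u = Z2" "v = Y3" | "u = Y3" "v = Z2" |
        "u = Y3" "v = Y3"
      | "shift_table u v = (C0, 0, \<lambda>i j. 0)"
      by fast
    then show "scalar_equivariant shift_table u v i j k"
    proof cases
      case 1
      show ?thesis
        using i j(1)[OF 1(1)] k(3)[OF 1(2)] unfolding 1
        by (elim disjE) (simp_all add: scalar_equivariant_def shift_table_def)
    next
      case 2
      show ?thesis
        using i j(3)[OF 2(1)] k(1)[OF 2(2)] unfolding 2
        by (elim disjE) (simp_all add: scalar_equivariant_def shift_table_def)
    next
      case 3
      show ?thesis
        using i j(2)[OF 3(1)] k(3)[OF 3(2)] unfolding 3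
        by (elim disjE) (simp_all add: scalar_equivariant_def shift_table_def)
    next
      case 4
      show ?thesis
        using i j(3)[OF 4(1)] k(2)[OF 4(2)] unfolding 4
        by (elim disjE) (simp_all add: scalar_equivariant_def shift_table_def)
    next
      case 5
      show ?thesis
        using i j(3)[OF 5(1)] k(3)[OF 5(2)] unfolding 5
        by (elim disjE) (simp_all add: scalar_equivariant_def shift_table_def)
    next
      case 6
      then show ?thesis
        by (simp add: scalar_equivariant_def)
    qed
  qed
  show "diff2 (table_map shift_table) (base t i) (base u j) (base v k) = 0"
    if "t \<noteq> S2" "u \<noteq> S2" "v \<noteq> S2" and "hw t \<le> hw u" "hw u \<le> hw v" and idx: "idx t i" "idx u j"
        "idx v k"
    for t i u j v k
    using that(1-5) idx
    by (cases t; cases u; (simp; fail)?; cases v; (simp; fail)?;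
        simp add: diff2_def lie_base_if bracket_defs table_map_base table_vec_def shift_table_def
            lin lie_scaleC_right add_ac;
        intro coord_ext; simp add: coord_simps coord_base algebra_simps)
qed

lemma central_table_cocycle: "table_map central_table \<in> cocycles2"
proof (rule relative_cocycles2I[OF central_table_cochain])
  note lin = cochains2D[OF central_table_cochain]
  show "table_map central_table (base S2 i) y = 0" for i y
    by (rule table_map_S2) (simp add: table_vec_def central_table_def)
  show "lie (base S2 i) (table_map central_table (base u j) (base v k)) =
      table_map central_table (lie (base S2 i) (base u j)) (base v k) + table_map central_table
          (base u j) (lie (base S2 i) (base v k))"
    if idx: "idx S2 i" "idx u j" "idx v k" for i u j v k
  proof (rule table_map_equivariant[OF idx])
    have i: "i = 1 \<or> i = 2 \<or> i = 3"
      using idx(1) by auto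
    have jk: "j = 1 \<or> j = 2" "k = 1 \<or> k = 2" if "hw u = 1" "hw v = 1"
      using idx(2,3) that by auto
    have "central_table u v = (C0, 0, \<lambda>i j. 0)" if "(u, v) \<notin> {(X1, Y1), (Y1, X1)}"
      using that by (auto simp: central_table_def)
    then consider "u = X1" "v = Y1" | "u = Y1" "v = X1" | "central_table u v = (C0, 0, \<lambda>i j. 0)"
      by fast
    then show "scalar_equivariant central_table u v i j k"
    proof cases
      case 1
      then have "j = 1 \<or> j = 2" "k = 1 \<or> k = 2"
        using jk by simp_all
      then show ?thesis
        using i unfolding 1 by (elim disjE) (simp_all add: scalar_equivariant_def central_table_def)
    next
      case 2
      then have "j = 1 \<or> j = 2" "k = 1 \<or> k = 2"
        using jk by simp_all
      then show ?thesis
        using i unfolding 2 by (elim disjE) (simp_all add: scalar_equivariant_def central_table_def)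
    next
      case 3
      then show ?thesis
        by (simp add: scalar_equivariant_def)
    qed
  qed
  \<comment> \<open>Every term is 0: \<open>c\<close> commutes with all these components, and none
    of their brackets lands in \<open>X1\<close> or \<open>Y1\<close>.\<close>
  show "diff2 (table_map central_table) (base t i) (base u j) (base v k) = 0"
    if "t \<noteq> S2" "u \<noteq> S2" "v \<noteq> S2" and "hw t \<le> hw u" "hw u \<le> hw v" and idx: "idx t i" "idx u j"
        "idx v k"
    for t i u j v k
    using that(1-5) idx
    by (cases t; cases u; (simp; fail)?; cases v; (simp; fail)?;
        simp add: diff2_def lie_base_if bracket_defs table_map_base table_vec_def
            central_table_def lin lie_scaleC_right)
qed

section \<open>Dimension of the cohomology space\<close>

lemma coord_table_map: "coord w k (table_map T (base t i) (base u j)) = (if idx t i \<and> idx u j then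
    if w = fst (T t u) \<and> idx w k \<and> k = i + j - 1 - fst (snd (T t u)) then snd (snd (T t u)) i j
        else 0 else 0)"
  by (auto simp: table_map_base table_vec_def coord_simps coord_base)

text \<open>The 21 normalization conditions form a triangular linear system for the entries of \<open>\<tau>\<close>, \<open>a\<close> and \<open>b\<close>,
  apart from \<open>A\<close> and \<open>D\<close>, which solve the pair of conditions at \<open>(Y1, Y1, C0)\<close> and \<open>(X1, Y5, Y4)\<close>.\<close>

lemma relative_cocycle_normalization:
  assumes "relative_cocycle f"
  shows "\<exists>\<tau> a b. f = diff1 (gauge \<tau>) + scale_cochain a (table_map shift_table) + scale_cochain b
      (table_map central_table)"
proof -
  interpret f: relative_cocycle f
    by (rule assms)
  define q where "q t u j w = coord w 1 (f (base t 1) (base u j))" for t u j w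
  \<comment> \<open>The conditions at \<open>(X1, X1, C0)\<close> and \<open>(Y1, Y1, C0)\<close>
    contain the same coefficient on \<open>c\<close>; their difference gives
    \<open>D - A = h\<close>.\<close>
  define h where "h = (q Y1 Y1 2 C0 - q X1 X1 2 C0) / 2"
  define A where "A = (q X1 Y5 2 Y4 + h + q X1 Z2 1 X3 + q X1 X3 1 X4 + q Y1 X4 1 Y5
    - q Y1 Z2 1 Y3 - q Y1 Y3 1 Y4) / 2"
  define D where "D = A + h"
  define B where "B = q X1 Y3 1 Y4"
  define G where "G = q Y1 X3 1 X4"
  define zz where "zz = A + D - q X1 Y1 1 Z2"
  define x3x3 where "x3x3 = A + zz - q X1 Z2 1 X3"
  define y3y3 where "y3y3 = D + zz - q Y1 Z2 1 Y3"
  define x4x4 where "x4x4 = A + x3x3 - q X1 X3 1 X4"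
  define y4x4 where "y4x4 = q Y1 Y4 1 Y5"
  define \<tau> where "\<tau> = (\<lambda>t u. 0 :: complex)(
    C0 := (\<lambda>u. 0)(C0 := 2 * A - q X1 X1 2 C0),
    Z2 := (\<lambda>u. 0)(Z2 := zz, S2 := - q X1 Y1 1 S2),
    X1 := (\<lambda>u. 0)(X1 := A, Y1 := B),
    Y1 := (\<lambda>u. 0)(X1 := G, Y1 := D),
    X3 := (\<lambda>u. 0)(X3 := x3x3, Y3 := B - q X1 Z2 1 Y3),
    Y3 := (\<lambda>u. 0)(X3 := G - q Y1 Z2 1 X3, Y3 := y3y3),
    X4 := (\<lambda>u. 0)(X4 := x4x4, Y4 := - q X1 X3 1 Y4),
    Y4 := (\<lambda>u. 0)(X4 := y4x4, Y4 := D + y3y3 - q Y1 Y3 1 Y4),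
    X5 := (\<lambda>u. 0)(X5 := A + x4x4 - q X1 X4 1 X5, Y5 := B - q X1 X4 1 Y5),
    Y5 := (\<lambda>u. 0)(X5 := G - q Y1 X4 1 X5, Y5 := D + x4x4 - q Y1 X4 1 Y5))"
  \<comment> \<open>All coefficients of \<tau> are fixed by now. At \<open>(Y1, Y3, X4)\<close> the
    gauge contributes \<open>- y4x4\<close> and at \<open>(X1, Y1, C0)\<close> it contributes
    \<open>B + G\<close>; \<open>a\<close> and \<open>b\<close> absorb what is left.\<close>
  define a where "a = q Y1 Y3 1 X4 + y4x4"
  define b where "b = q X1 Y1 2 C0 - B - G"
  define F' where "F' = f - diff1 (gauge \<tau>) - scale_cochain a (table_map shift_table) -
      scale_cochain b (table_map central_table)"
  have F': "F' x y = f x y - diff1 (gauge \<tau>) x y - scaleC a (table_map shift_table x y) - scaleC b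
      (table_map central_table x y)" for x y
    by (simp add: F'_def scale_cochain_def)
  have \<tau>_hw: "hw t = hw u" if "\<tau> t u \<noteq> 0" for t u
    using that by (cases t; cases u; simp add: \<tau>_def)
  have "diff1 (gauge \<tau>) (base S2 i) y = 0" for i y
    by (rule gauge_relative) (simp add: \<tau>_def, rule \<tau>_hw)
  moreover have "table_map shift_table (base S2 i) y = 0" "table_map central_table (base S2 i) y =
      0" for i y
    by (rule table_map_S2; simp add: table_vec_def shift_table_def central_table_def)+
  ultimately have "F' (base S2 i) y = 0" for i y
    by (simp add: F' f.S2_left)
  moreover have "F' \<in> cocycles2"
    unfolding F'_def
    by (intro cochain.subspace_diff[OF subspace_cocycles2] cochain.subspace_scale[OF
        subspace_cocycles2]
        f.cocycle diff1_cocycle gauge_cochain shift_table_cocycle central_table_cocycle)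
  ultimately interpret F': relative_cocycle F'
    by unfold_locales
  have yy: "q Y1 Y1 2 C0 = 2 * D - (2 * A - q X1 X1 2 C0)"
    by (simp add: D_def h_def field_simps)
  have x5: "q X1 Y5 2 Y4 = x4x4 + (A + (q Y1 Y3 1 Y4 - y3y3) - q Y1 X4 1 Y5)"
    by (simp add: x4x4_def x3x3_def y3y3_def zz_def D_def A_def field_simps)
  have "normalized F'"
    unfolding normalized_def normal_entries_def
    by (simp add: F' coord_diff coord_scaleC coord_diff1_gauge coord_table_map coord_gauge
        bracket_coord_simps coord_lie sum_comp coord_out shift_table_def central_table_def \<tau>_def;
            fold q_def;
        simp add: yy x5 zz_def x3x3_def y3y3_def x4x4_def y4x4_def a_def b_def B_def G_def)
  then have "F' x y = 0" for x y
    by (rule F'.normalized_zero)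
  then have "F' = 0"
    by (simp add: fun_eq_iff)
  then show ?thesis
    by (intro exI[of _ \<tau>] exI[of _ a] exI[of _ b]) (simp add: F'_def algebra_simps)
qed

lemma shift_central_independent:
  assumes g: "g \<in> cochains1"
    and eq: "scale_cochain a (table_map shift_table) + scale_cochain b (table_map central_table) =
        diff1 g"
  shows "a = 0" "b = 0"
proof -
  have eqn: "a * coord w k (table_map shift_table (base t i) (base u j)) + b * coord w k
      (table_map central_table (base t i) (base u j)) =
      coord w k (lie (base t i) (g (base u j))) - coord w k (lie (base u j) (g (base t i)))
      - bracket_coeff t u i j * coord w k (g (base (bracket_comp t u) (i + j - 1 - bracket_shift t
          u)))"
    if "idx t i" "idx u j" for t i u j w k
    using arg_cong[OF fun_cong[OF fun_cong[OF eq, of "base t i"], of "base u j"], of "coord w k"]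
        that
    by (simp add: diff1_def scale_cochain_def lie_base cochains1D[OF g] coord_simps)
  note eval = coord_table_map shift_table_def central_table_def bracket_coord_simps coord_lie
      sum_comp coord_out coord_simps
  \<comment> \<open>The second equation, at \<open>(Y1, Y4)\<close>, shows that \<open>g\<close> has
    no component from \<open>y^4_1\<close> to \<open>x^4_1\<close>, the only way to produce the
    first value.\<close>
  have "a = - coord X4 1 (g (base Y4 1))"
    using eqn[of 1 Y1 1 Y3 X4 1] by (simp add: eval)
  moreover have "coord X4 1 (g (base Y4 1)) = 0"
    using eqn[of 1 Y1 1 Y4 Y5 1] by (simp add: eval)
  ultimately show "a = 0"
    by simp
  \<comment> \<open>The \<open>Y5\<close> coordinates of \<open>g\<close> on \<open>Y3\<close> are
    unknown here. With \<open>p\<close>, \<open>r\<close> for the two \<open>Y1\<close> coordinates,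
    the first pair of equations gives \<open>r = - 4 p\<close> and the second
    \<open>p = - 4 r\<close>, so both are 0.\<close>
  have "coord Y1 1 (g (base X1 1)) = - coord Y5 2 (g (base Y3 1))"
    using eqn[of 1 X1 1 Y3 Y4 1] by (simp add: eval add_eq_0_iff2)
  moreover have "coord Y1 2 (g (base X1 2)) = 4 * coord Y5 2 (g (base Y3 1))"
    using eqn[of 2 X1 1 Y3 Y4 2] by (simp add: eval)
  moreover have "coord Y1 1 (g (base X1 1)) = - 4 * coord Y5 5 (g (base Y3 4))"
    using eqn[of 1 X1 4 Y3 Y4 4] by (simp add: eval add_eq_0_iff2)
  moreover have "coord Y1 2 (g (base X1 2)) = coord Y5 5 (g (base Y3 4))"
    using eqn[of 2 X1 4 Y3 Y4 5] by (simp add: eval)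
  ultimately have XY: "coord Y1 1 (g (base X1 1)) = 0" "coord Y1 2 (g (base X1 2)) = 0"
    by simp_all
  have YX: "coord X1 1 (g (base Y1 1)) = 0" "coord X1 2 (g (base Y1 2)) = 0"
    using eqn[of 1 Y1 1 X3 X4 1] eqn[of 2 Y1 1 X3 X4 2] by (simp_all add: eval)
  \<comment> \<open>\<open>central_table\<close> has opposite signs at \<open>(x_1, y_2)\<close> and
    \<open>(x_2, y_1)\<close>, whereas both brackets equal \<open>z_2\<close>, so \<open>g\<close>
    contributes the same value to both.\<close>
  have "b = - coord C0 1 (g (base Z2 2))"
    using eqn[of 1 X1 2 Y1 C0 1] XY YX by (simp add: eval)
  moreover have "- b = - coord C0 1 (g (base Z2 2))"
    using eqn[of 2 X1 1 Y1 C0 1] XY YX by (simp add: eval)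
  ultimately show "b = 0"
    by simp
qed

section \<open>Passing to cohomology classes\<close>

lemma cohomologous2_iff: "cohomologous2 f g \<longleftrightarrow> f \<in> cocycles2 \<and> g \<in> cocycles2 \<and> f - g \<in> coboundaries2"
  by (simp add: cohomologous2_def fun_diff_def)

lemma abs_H2_eq_iff:
  assumes "f \<in> cocycles2" "g \<in> cocycles2"
  shows "abs_H2 f = abs_H2 g \<longleftrightarrow> f - g \<in> coboundaries2"
proof -
  have "cohomologous2 f f" "cohomologous2 g g"
    using assms cochain.subspace_0[OF subspace_coboundaries2] by (simp_all add: cohomologous2_iff)
  then show ?thesis
    using Quotient3_rel[OF Quotient3_H2, of f g] assms by (simp add: cohomologous2_iff)
qed

lemma abs_H2_linear:
  assumes "f \<in> cocycles2" "g \<in> cocycles2"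
  shows "abs_H2 (scale_cochain a f + scale_cochain b g) = scaleC_H2 a (abs_H2 f) + scaleC_H2 b
      (abs_H2 g)"
proof -
  have self: "cohomologous2 f f" if "f \<in> cocycles2" for f :: "'a \<Rightarrow> 'a \<Rightarrow> 'a"
    using that cochain.subspace_0[OF subspace_coboundaries2] by (simp add: cohomologous2_iff)
  have scale: "scaleC_H2 c (abs_H2 f) = abs_H2 (scale_cochain c f)" if "f \<in> cocycles2" for c and f
      :: "'a \<Rightarrow> 'a \<Rightarrow> 'a"
    using scaleC_H2.abs_eq[OF self[OF that], of c] by (simp add: scale_cochain_def)
  have add: "abs_H2 f + abs_H2 g = abs_H2 (f + g)" if "f \<in> cocycles2" "g \<in> cocycles2" for f g ::
      "'a \<Rightarrow> 'a \<Rightarrow> 'a"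
    using plus_H2.abs_eq[OF self[OF that(1)] self[OF that(2)]] by (simp add: plus_fun_def)
  note closed = cochain.subspace_scale[OF subspace_cocycles2]
  show ?thesis
    by (simp only: scale assms add closed)
qed

theorem proposition3p3:
  shows "H2.dim (UNIV :: sl2_gn H2 set) = 2"
proof -
  define c0 c2 where "c0 = abs_H2 (table_map shift_table)" and "c2 = abs_H2 (table_map
      central_table)"
  note cocycles = shift_table_cocycle central_table_cocycle
  have comb: "scaleC_H2 a c0 + scaleC_H2 b c2 = abs_H2 (scale_cochain a (table_map shift_table) +
      scale_cochain b (table_map central_table))" for a b
    unfolding c0_def c2_def by (rule abs_H2_linear[OF cocycles, symmetric])
  have comb_cocycle: "scale_cochain a (table_map shift_table) + scale_cochain b (table_map
      central_table) \<in> cocycles2" for a b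
    by (intro cochain.subspace_add[OF subspace_cocycles2] cochain.subspace_scale[OF
        subspace_cocycles2] cocycles)
  have zero: "(0 :: sl2_gn H2) = abs_H2 0"
    by (simp add: zero_H2_def zero_fun_def)
  have indep: "a = 0 \<and> b = 0" if "scaleC_H2 a c0 + scaleC_H2 b c2 = 0" for a b
  proof -
    have "scale_cochain a (table_map shift_table) + scale_cochain b (table_map central_table) \<in>
        coboundaries2"
      using that abs_H2_eq_iff[OF comb_cocycle[of a b] cochain.subspace_0[OF subspace_cocycles2]]
      unfolding comb zero by simp
    then obtain g where "g \<in> cochains1"
      "scale_cochain a (table_map shift_table) + scale_cochain b (table_map central_table) = diff1
          g"
      by (auto simp: coboundaries2_def)
    then show ?thesis
      using shift_central_independent by blast
  qed
  have span: "\<exists>a b. x = scaleC_H2 a c0 + scaleC_H2 b c2" for x :: "sl2_gn H2"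
  proof -
    obtain f where f: "f \<in> cocycles2" "x = abs_H2 f"
      using Quotient3_rel_rep[OF Quotient3_H2] Quotient3_abs_rep[OF Quotient3_H2, of x]
          Quotient3_rep_reflp[OF Quotient3_H2, of x]
      by (metis cohomologous2_iff)
    obtain F where F: "F \<in> cocycles2" "f - F \<in> coboundaries2" "\<forall>i y. F (base S2 i) y = 0"
      using sl2_relative_representative[OF f(1)] by blast
    then have "relative_cocycle F"
      by unfold_locales auto
    then obtain \<tau> a b where ab: "F = diff1 (gauge \<tau>) + scale_cochain a (table_map shift_table) +
        scale_cochain b (table_map central_table)"
      using relative_cocycle_normalization by blast
    have "f - (scale_cochain a (table_map shift_table) + scale_cochain b (table_map
        central_table)) = (f - F) + diff1 (gauge \<tau>)"
      unfolding ab by simp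
    also have "\<dots> \<in> coboundaries2"
      using F(2) gauge_cochain by (intro cochain.subspace_add[OF subspace_coboundaries2]) (auto
          simp: coboundaries2_def)
    finally have "x = scaleC_H2 a c0 + scaleC_H2 b c2"
      unfolding comb f(2) using abs_H2_eq_iff[OF f(1) comb_cocycle] by blast
    then show ?thesis
      by blast
  qed
  have c2: "c2 \<noteq> 0"
    using indep[of 0 1] by (auto simp: H2.scale_one)
  have c0: "c0 \<notin> H2.span {c2}"
  proof
    assume "c0 \<in> H2.span {c2}"
    then obtain k where "c0 = scaleC_H2 k c2"
      by (auto simp: H2.span_singleton)
    then have "scaleC_H2 1 c0 + scaleC_H2 (- k) c2 = 0"
      by simp
    then show False
      using indep by fastforce
  qed
  have "H2.independent {c0, c2}"
    using c0 c2 by (simp add: H2.independent_insert)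
  moreover have "UNIV \<subseteq> H2.span {c0, c2}"
  proof
    fix x
    obtain a b where "x = scaleC_H2 a c0 + scaleC_H2 b c2"
      using span by blast
    then show "x \<in> H2.span {c0, c2}"
      by (auto intro: H2.span_add H2.span_scale H2.span_base)
  qed
  moreover have "c0 \<noteq> c2"
    using c0 H2.span_base by blast
  then have "card {c0, c2} = 2"
    by simp
  ultimately show ?thesis
    by (intro H2.dim_unique[of "{c0, c2}"]) simp_all
qed

end
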